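(* Let $\mathbb{K}$ be a field, let $\mathcal{A},\mathcal{T}$ be $\mathbb{K}$-linear triangulated categories, let $\mathcal{J}$ be a set of pairwise non-equivalent $\mathbb{K}$-linear triangulated categories, and let $\Gamma\subset\mathrm{Aut}_{\mathbb{K}}(\mathcal{T})$ be a subgroup. Assume that $\mathcal{A}$ is generated (as a triangulated category) by the vertices of $G_{\mathcal{J},\mathbb{K}}(\mathcal{A})$. Then there is a well-defined injective function $$C^{\Gamma}_{\mathcal{A},\mathbb{K}}(\mathcal{T})\longrightarrow \left\{B\subset G_{\mathcal{J},\mathbb{K}}(\mathcal{T}) : B \text{ is a full subgraph such that there exists an isomorphism of digraphs } G_{\mathcal{J},\mathbb{K}}(\mathcal{A})\to B\right\}/\Gamma,\qquad [F]\mapsto[\mathrm{Im}(F_* )],$$ where for a fully faithful exact $\mathbb{K}$-linear functor $F:\mathcal{A}\to\mathcal{T}$, $F_*:G_{\mathcal{J},\mathbb{K}}(\mathcal{A})\to G_{\mathcal{J},\mathbb{K}}(\mathcal{T})$ is the induced full embedding of digraphs $\mathcal{B}\mapsto F(\mathcal{B})$, $\mathrm{Im}(F_* )$ is the full subgraph of $G_{\mathcal{J},\mathbb{K}}(\mathcal{T})$ determined by this embedding, and the quotient by $\Gamma$ means that two subgraphs $B_1,B_2$ are identified iff $\beta_*(B_1)=B_2$ for some $[\beta]\in\Gamma$.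
   Context: A triangulated subcategory of a triangulated category is a non-empty full subcategory closed under $[\pm1]$ and extensions. $\mathrm{Aut}(\mathcal{A})$ is the group of exact auto-equivalences of $\mathcal{A}$ modulo graded natural isomorphism, and $\mathrm{Aut}_{\mathbb{K}}(\mathcal{A})$ its subgroup of $\mathbb{K}$-linear ones. $C^{\Gamma}_{\mathcal{A},\mathbb{K}}(\mathcal{T})$ is the set of $\mathbb{K}$-linear fully faithful exact functors $F:\mathcal{A}\to\mathcal{T}$ modulo the equivalence relation: $F\sim F'$ iff $F\circ\alpha\cong\beta\circ F'$ (graded natural isomorphism) for some $[\alpha]\in\mathrm{Aut}(\mathcal{A})$, $[\beta]\in\Gamma$. For a $\mathbb{K}$-linear triangulated category $\mathcal{S}$, $G_{\mathcal{J},\mathbb{K}}(\mathcal{S})$ is the directed graph whose vertices are the triangulated subcategories $\mathcal{B}\subset\mathcal{S}$ that are $\mathbb{K}$-linearly exactly equivalent to some element of $\mathcal{J}$, and whose edges are the pairs $(\mathcal{B}_1,\mathcal{B}_2)$ of different vertices with $\mathrm{Hom}(X_2,X_1)=0$ for all $X_1\in\mathcal{B}_1,X_2\in\mathcal{B}_2$. For a fully faithful exact functor $F$ and a triangulated subcategory $\mathcal{B}$, $F(\mathcal{B})$ is the full subcategory of objects isomorphic to $F(A)$ with $A\in\mathcal{B}$. A $\mathbb{K}$-linear fully faithful exact functor $F:\mathcal{S}_1\to\mathcal{S}_2$ induces a map $F_*$ of digraphs, injective on vertices and such that $(a,b)$ is an edge iff $(F(a),F(b))$ is an edge; if $F$ is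 an equivalence, $F_*$ is an isomorphism. *)

theory Defs
  imports
    "Graph_Theory.Digraph_Isomorphism"
    "HOL-Algebra.Module"
begin

section \<open>Categories, functors, natural isomorphisms\<close>

record ('o, 'm) cat =
  Obj :: "'o set"
  Arr :: "'m set"
  Src :: "'m \<Rightarrow> 'o"
  Tgt :: "'m \<Rightarrow> 'o"
  Idn :: "'o \<Rightarrow> 'm"
  Cmp :: "'m \<Rightarrow> 'm \<Rightarrow> 'm"  (infixl "\<cdot>\<index>" 70)

definition Hom :: "('o, 'm, 'z) cat_scheme \<Rightarrow> 'o \<Rightarrow> 'o \<Rightarrow> 'm set" where
  "Hom C X Y = {f \<in> Arr C. Src C f = X \<and> Tgt C f = Y}"

locale category =
  fixes C :: "('o, 'm, 'z) cat_scheme" (structure)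
  assumes Src_closed: "f \<in> Arr C \<Longrightarrow> Src C f \<in> Obj C"
    and Tgt_closed: "f \<in> Arr C \<Longrightarrow> Tgt C f \<in> Obj C"
    and Idn_closed: "X \<in> Obj C \<Longrightarrow> Idn C X \<in> Hom C X X"
    and Cmp_closed: "\<lbrakk>f \<in> Hom C X Y; g \<in> Hom C Y Z\<rbrakk> \<Longrightarrow> g \<cdot> f \<in> Hom C X Z"
    and Cmp_Idn: "f \<in> Hom C X Y \<Longrightarrow> f \<cdot> Idn C X = f"
    and Idn_Cmp: "f \<in> Hom C X Y \<Longrightarrow> Idn C Y \<cdot> f = f"
    and Cmp_assoc: "\<lbrakk>f \<in> Hom C W X; g \<in> Hom C X Y; h \<in> Hom C Y Z\<rbrakk>
                      \<Longrightarrow> (h \<cdot> g) \<cdot> f = h \<cdot> (g \<cdot> f)"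

definition is_iso :: "('o, 'm, 'z) cat_scheme \<Rightarrow> 'm \<Rightarrow> bool" where
  "is_iso C f \<longleftrightarrow> f \<in> Arr C \<and>
     (\<exists>g \<in> Hom C (Tgt C f) (Src C f).
        g \<cdot>\<^bsub>C\<^esub> f = Idn C (Src C f) \<and> f \<cdot>\<^bsub>C\<^esub> g = Idn C (Tgt C f))"

definition isomorphic :: "('o, 'm, 'z) cat_scheme \<Rightarrow> 'o \<Rightarrow> 'o \<Rightarrow> bool" where
  "isomorphic C X Y \<longleftrightarrow> (\<exists>f \<in> Hom C X Y. is_iso C f)"

definition zero_object :: "('o, 'm, 'z) cat_scheme \<Rightarrow> 'o \<Rightarrow> bool" where
  "zero_object C Z \<longleftrightarrow> Z \<in> Obj C \<and>
     (\<forall>X \<in> Obj C. (\<exists>!f. f \<in> Hom C X Z) \<and> (\<exists>!f. f \<in> Hom C Z X))"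

record ('o, 'm, 'p, 'n) funct =
  FO :: "'o \<Rightarrow> 'p"
  FA :: "'m \<Rightarrow> 'n"

definition cat_functor ::
  "('o, 'm, 'y) cat_scheme \<Rightarrow> ('p, 'n, 'z) cat_scheme \<Rightarrow> ('o, 'm, 'p, 'n, 'f) funct_scheme \<Rightarrow> bool"
where
  "cat_functor C D F \<longleftrightarrow>
     (\<forall>X \<in> Obj C. FO F X \<in> Obj D \<and> FA F (Idn C X) = Idn D (FO F X)) \<and>
     (\<forall>f \<in> Arr C. FA F f \<in> Hom D (FO F (Src C f)) (FO F (Tgt C f))) \<and>
     (\<forall>f \<in> Arr C. \<forall>g \<in> Arr C. Src C g = Tgt C f \<longrightarrow>
        FA F (g \<cdot>\<^bsub>C\<^esub> f) = FA F g \<cdot>\<^bsub>D\<^esub> FA F f)"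

definition id_funct :: "('o, 'm, 'o, 'm) funct" where
  "id_funct = \<lparr>FO = (\<lambda>X. X), FA = (\<lambda>f. f)\<rparr>"

definition comp_funct ::
  "('p, 'n, 'q, 'l, 'g) funct_scheme \<Rightarrow> ('o, 'm, 'p, 'n, 'f) funct_scheme \<Rightarrow> ('o, 'm, 'q, 'l) funct"
where
  "comp_funct G F = \<lparr>FO = FO G \<circ> FO F, FA = FA G \<circ> FA F\<rparr>"

definition nat_iso ::
  "('o, 'm, 'y) cat_scheme \<Rightarrow> ('p, 'n, 'z) cat_scheme \<Rightarrow>
   ('o, 'm, 'p, 'n, 'f) funct_scheme \<Rightarrow> ('o, 'm, 'p, 'n, 'g) funct_scheme \<Rightarrow> ('o \<Rightarrow> 'n) \<Rightarrow> bool"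
where
  "nat_iso C D F G \<theta> \<longleftrightarrow>
     (\<forall>X \<in> Obj C. \<theta> X \<in> Hom D (FO F X) (FO G X) \<and> is_iso D (\<theta> X)) \<and>
     (\<forall>f \<in> Arr C. \<theta> (Tgt C f) \<cdot>\<^bsub>D\<^esub> FA F f = FA G f \<cdot>\<^bsub>D\<^esub> \<theta> (Src C f))"

definition fully_faithful ::
  "('o, 'm, 'y) cat_scheme \<Rightarrow> ('p, 'n, 'z) cat_scheme \<Rightarrow> ('o, 'm, 'p, 'n, 'f) funct_scheme \<Rightarrow> bool"
where
  "fully_faithful C D F \<longleftrightarrow>
     (\<forall>X \<in> Obj C. \<forall>Y \<in> Obj C. bij_betw (FA F) (Hom C X Y) (Hom D (FO F X) (FO F Y)))"

definition equivalence ::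
  "('o, 'm, 'y) cat_scheme \<Rightarrow> ('p, 'n, 'z) cat_scheme \<Rightarrow> ('o, 'm, 'p, 'n, 'f) funct_scheme \<Rightarrow> bool"
where
  "equivalence C D F \<longleftrightarrow> cat_functor C D F \<and>
     (\<exists>G :: ('p, 'n, 'o, 'm) funct. cat_functor D C G \<and>
        (\<exists>\<theta>. nat_iso C C (comp_funct G F) id_funct \<theta>) \<and>
        (\<exists>\<theta>. nat_iso D D (comp_funct F G) id_funct \<theta>))"


section \<open>Linear triangulated categories\<close>

record ('o, 'm, 'k) lincat = "('o, 'm) cat" +
  ZeroA :: "'o \<Rightarrow> 'o \<Rightarrow> 'm"
  AddA :: "'m \<Rightarrow> 'm \<Rightarrow> 'm"
  SmulA :: "'k \<Rightarrow> 'm \<Rightarrow> 'm"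

text \<open>
  The library's modules extend the ring record; the multiplicative fields play no role in
  \<^const>\<open>module\<close> and are left undefined.
\<close>

definition hom_module ::
  "('o, 'm, 'k, 'z) lincat_scheme \<Rightarrow> 'o \<Rightarrow> 'o \<Rightarrow> ('k, 'm) module" where
  "hom_module C X Y =
     \<lparr>carrier = Hom C X Y, mult = undefined, one = undefined,
      zero = ZeroA C X Y, add = AddA C, smult = SmulA C\<rparr>"

locale linear_category = category C + field K
  for K :: "('k, 'x) ring_scheme" and C :: "('o, 'm, 'k, 'z) lincat_scheme" (structure) +
  assumes Hom_module: "\<lbrakk>X \<in> Obj C; Y \<in> Obj C\<rbrakk> \<Longrightarrow> module K (hom_module C X Y)"
    and Cmp_add_right: "\<lbrakk>f \<in> Hom C X Y; f' \<in> Hom C X Y; g \<in> Hom C Y Z\<rbrakk>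
           \<Longrightarrow> g \<cdot> AddA C f f' = AddA C (g \<cdot> f) (g \<cdot> f')"
    and Cmp_add_left: "\<lbrakk>f \<in> Hom C X Y; g \<in> Hom C Y Z; g' \<in> Hom C Y Z\<rbrakk>
           \<Longrightarrow> AddA C g g' \<cdot> f = AddA C (g \<cdot> f) (g' \<cdot> f)"
    and Cmp_smul_right: "\<lbrakk>a \<in> carrier K; f \<in> Hom C X Y; g \<in> Hom C Y Z\<rbrakk>
           \<Longrightarrow> g \<cdot> SmulA C a f = SmulA C a (g \<cdot> f)"
    and Cmp_smul_left: "\<lbrakk>a \<in> carrier K; f \<in> Hom C X Y; g \<in> Hom C Y Z\<rbrakk>
           \<Longrightarrow> SmulA C a g \<cdot> f = SmulA C a (g \<cdot> f)"

locale linear_additive_category = linear_category +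
  assumes ex_zero_object: "\<exists>Z. zero_object C Z"
    and ex_biproduct: "\<lbrakk>X \<in> Obj C; Y \<in> Obj C\<rbrakk> \<Longrightarrow>
      \<exists>P. \<exists>i \<in> Hom C X P. \<exists>j \<in> Hom C Y P. \<exists>p \<in> Hom C P X. \<exists>q \<in> Hom C P Y.
        p \<cdot> i = Idn C X \<and> q \<cdot> j = Idn C Y \<and>
        p \<cdot> j = ZeroA C Y X \<and> q \<cdot> i = ZeroA C X Y \<and>
        AddA C (i \<cdot> p) (j \<cdot> q) = Idn C P"

definition additive_functor ::
  "('o, 'm, 'k, 'y) lincat_scheme \<Rightarrow> ('p, 'n, 'l, 'z) lincat_scheme \<Rightarrow>
   ('o, 'm, 'p, 'n, 'f) funct_scheme \<Rightarrow> bool"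
where
  "additive_functor C D F \<longleftrightarrow> cat_functor C D F \<and>
     (\<forall>X \<in> Obj C. \<forall>Y \<in> Obj C. \<forall>f \<in> Hom C X Y. \<forall>g \<in> Hom C X Y.
        FA F (AddA C f g) = AddA D (FA F f) (FA F g))"

definition linear_functor ::
  "('k, 'x) ring_scheme \<Rightarrow> ('o, 'm, 'k, 'y) lincat_scheme \<Rightarrow> ('p, 'n, 'k, 'z) lincat_scheme \<Rightarrow>
   ('o, 'm, 'p, 'n, 'f) funct_scheme \<Rightarrow> bool"
where
  "linear_functor K C D F \<longleftrightarrow> additive_functor C D F \<and>
     (\<forall>a \<in> carrier K. \<forall>f \<in> Arr C. FA F (SmulA C a f) = SmulA D a (FA F f))"

text \<open>
  The shift \<open>[1]\<close> is an autoequivalence, not necessarily an automorphism.  A triple \<open>(u, v, w)\<close> in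
  \<open>Dist\<close> is a distinguished triangle \<open>X \<rightarrow> Y \<rightarrow> Z \<rightarrow> X[1]\<close>; the objects are recovered from the arrows.
\<close>

record ('o, 'm, 'k) tricat = "('o, 'm, 'k) lincat" +
  Shift :: "('o, 'm, 'o, 'm) funct"
  Dist :: "('m \<times> 'm \<times> 'm) set"

abbreviation ShO :: "('o, 'm, 'k, 'z) tricat_scheme \<Rightarrow> 'o \<Rightarrow> 'o" where
  "ShO C \<equiv> FO (Shift C)"

abbreviation ShA :: "('o, 'm, 'k, 'z) tricat_scheme \<Rightarrow> 'm \<Rightarrow> 'm" where
  "ShA C \<equiv> FA (Shift C)"

definition triangle ::
  "('o, 'm, 'k, 'z) tricat_scheme \<Rightarrow> 'o \<Rightarrow> 'o \<Rightarrow> 'o \<Rightarrow> 'm \<Rightarrow> 'm \<Rightarrow> 'm \<Rightarrow> bool" where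
  "triangle C X Y Z u v w \<longleftrightarrow> u \<in> Hom C X Y \<and> v \<in> Hom C Y Z \<and> w \<in> Hom C Z (ShO C X)"

definition dist_triangle ::
  "('o, 'm, 'k, 'z) tricat_scheme \<Rightarrow> 'o \<Rightarrow> 'o \<Rightarrow> 'o \<Rightarrow> 'm \<Rightarrow> 'm \<Rightarrow> 'm \<Rightarrow> bool" where
  "dist_triangle C X Y Z u v w \<longleftrightarrow> triangle C X Y Z u v w \<and> (u, v, w) \<in> Dist C"

locale linear_triangulated_category = linear_additive_category K C
  for K :: "('k, 'x) ring_scheme" and C :: "('o, 'm, 'k, 'z) tricat_scheme" (structure) +
  assumes Shift_linear: "linear_functor K C C (Shift C)"
    and Shift_equivalence: "equivalence C C (Shift C)"
    and Dist_triangle: "(u, v, w) \<in> Dist C \<Longrightarrow> \<exists>X Y Z. triangle C X Y Z u v w"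
    and Dist_iso:
      "\<lbrakk>dist_triangle C X Y Z u v w; triangle C X' Y' Z' u' v' w';
        a \<in> Hom C X X'; b \<in> Hom C Y Y'; c \<in> Hom C Z Z'; is_iso C a; is_iso C b; is_iso C c;
        b \<cdot> u = u' \<cdot> a; c \<cdot> v = v' \<cdot> b; ShA C a \<cdot> w = w' \<cdot> c\<rbrakk>
       \<Longrightarrow> dist_triangle C X' Y' Z' u' v' w'"
    and TR1_Idn:
      "\<lbrakk>X \<in> Obj C; zero_object C Z\<rbrakk>
       \<Longrightarrow> dist_triangle C X X Z (Idn C X) (ZeroA C X Z) (ZeroA C Z (ShO C X))"
    and TR1_ex: "u \<in> Hom C X Y \<Longrightarrow> \<exists>Z v w. dist_triangle C X Y Z u v w"
    and TR2:
      "triangle C X Y Z u v w \<Longrightarrow>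
       dist_triangle C X Y Z u v w \<longleftrightarrow>
       dist_triangle C Y Z (ShO C X) v w (\<ominus>\<^bsub>hom_module C (ShO C X) (ShO C Y)\<^esub> ShA C u)"
    and TR3:
      "\<lbrakk>dist_triangle C X Y Z u v w; dist_triangle C X' Y' Z' u' v' w';
        a \<in> Hom C X X'; b \<in> Hom C Y Y'; b \<cdot> u = u' \<cdot> a\<rbrakk>
       \<Longrightarrow> \<exists>c \<in> Hom C Z Z'. c \<cdot> v = v' \<cdot> b \<and> ShA C a \<cdot> w = w' \<cdot> c"
    and TR4_octahedral:
      "\<lbrakk>dist_triangle C X Y Z' u j k; dist_triangle C Y Z X' v l i;
        dist_triangle C X Z Y' (v \<cdot> u) m n\<rbrakk>
       \<Longrightarrow> \<exists>f \<in> Hom C Z' Y'. \<exists>g \<in> Hom C Y' X'.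
             dist_triangle C Z' Y' X' f g (ShA C j \<cdot> i) \<and>
             f \<cdot> j = m \<cdot> v \<and> n \<cdot> f = k \<and> g \<cdot> m = l \<and> i \<cdot> g = ShA C u \<cdot> n"


section \<open>Exact functors and graded natural isomorphisms\<close>

text \<open>
  A graded functor is a functor \<open>F\<close> together with a natural isomorphism
  \<open>Eta X : F(X[1]) \<rightarrow> F(X)[1]\<close>.
\<close>

record ('o, 'm, 'p, 'n) gfunct = "('o, 'm, 'p, 'n) funct" +
  Eta :: "'o \<Rightarrow> 'n"

definition exact_functor ::
  "('o, 'm, 'k, 'y) tricat_scheme \<Rightarrow> ('p, 'n, 'l, 'z) tricat_scheme \<Rightarrow>
   ('o, 'm, 'p, 'n) gfunct \<Rightarrow> bool"
where
  "exact_functor C D F \<longleftrightarrow> additive_functor C D F \<and>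
     nat_iso C D (comp_funct F (Shift C)) (comp_funct (Shift D) F) (Eta F) \<and>
     (\<forall>X Y Z u v w. dist_triangle C X Y Z u v w \<longrightarrow>
        dist_triangle D (FO F X) (FO F Y) (FO F Z) (FA F u) (FA F v) (Eta F X \<cdot>\<^bsub>D\<^esub> FA F w))"

definition id_gfunct :: "('o, 'm, 'k, 'z) tricat_scheme \<Rightarrow> ('o, 'm, 'o, 'm) gfunct" where
  "id_gfunct C = \<lparr>FO = (\<lambda>X. X), FA = (\<lambda>f. f), Eta = (\<lambda>X. Idn C (ShO C X))\<rparr>"

definition comp_gfunct ::
  "('q, 'l, 'k, 'z) tricat_scheme \<Rightarrow> ('p, 'n, 'q, 'l) gfunct \<Rightarrow> ('o, 'm, 'p, 'n) gfunct \<Rightarrow>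
   ('o, 'm, 'q, 'l) gfunct"
where
  "comp_gfunct E G F =
     \<lparr>FO = FO G \<circ> FO F, FA = FA G \<circ> FA F,
      Eta = (\<lambda>X. Eta G (FO F X) \<cdot>\<^bsub>E\<^esub> FA G (Eta F X))\<rparr>"

definition graded_iso ::
  "('o, 'm, 'k, 'y) tricat_scheme \<Rightarrow> ('p, 'n, 'l, 'z) tricat_scheme \<Rightarrow>
   ('o, 'm, 'p, 'n) gfunct \<Rightarrow> ('o, 'm, 'p, 'n) gfunct \<Rightarrow> bool"
where
  "graded_iso C D F G \<longleftrightarrow>
     (\<exists>\<theta>. nat_iso C D F G \<theta> \<and>
        (\<forall>X \<in> Obj C. Eta G X \<cdot>\<^bsub>D\<^esub> \<theta> (ShO C X) = ShA D (\<theta> X) \<cdot>\<^bsub>D\<^esub> Eta F X))"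

definition linearly_exactly_equivalent ::
  "('k, 'x) ring_scheme \<Rightarrow> ('o, 'm, 'k, 'y) tricat_scheme \<Rightarrow> ('p, 'n, 'k, 'z) tricat_scheme \<Rightarrow> bool"
where
  "linearly_exactly_equivalent K C D \<longleftrightarrow>
     (\<exists>F :: ('o, 'm, 'p, 'n) gfunct.
        exact_functor C D F \<and> linear_functor K C D F \<and> equivalence C D F)"


section \<open>Groups of exact auto-equivalences\<close>

definition autoequivalences :: "('o, 'm, 'k, 'z) tricat_scheme \<Rightarrow> ('o, 'm, 'o, 'm) gfunct set" where
  "autoequivalences C = {F. exact_functor C C F \<and> equivalence C C F}"

definition autoeq_rel ::
  "('o, 'm, 'k, 'z) tricat_scheme \<Rightarrow> ('o, 'm, 'o, 'm) gfunct rel" where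
  "autoeq_rel C =
     {(F, G). F \<in> autoequivalences C \<and> G \<in> autoequivalences C \<and> graded_iso C C F G}"

definition Aut :: "('o, 'm, 'k, 'z) tricat_scheme \<Rightarrow> ('o, 'm, 'o, 'm) gfunct set monoid" where
  "Aut C =
     \<lparr>carrier = autoequivalences C // autoeq_rel C,
      mult = (\<lambda>b a. \<Union>\<beta> \<in> b. \<Union>\<alpha> \<in> a. autoeq_rel C `` {comp_gfunct C \<beta> \<alpha>}),
      one = autoeq_rel C `` {id_gfunct C}\<rparr>"

definition AutK ::
  "('k, 'x) ring_scheme \<Rightarrow> ('o, 'm, 'k, 'z) tricat_scheme \<Rightarrow> ('o, 'm, 'o, 'm) gfunct set monoid"
where
  "AutK K C =
     (Aut C)\<lparr>carrier := {autoeq_rel C `` {F} | F. F \<in> autoequivalences C \<and> linear_functor K C C F}\<rparr>"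


section \<open>Triangulated subcategories\<close>

text \<open>
  A full subcategory is given by its set of objects.  Closure under \<open>[-1]\<close> is stated for every
  object \<open>Y\<close> with \<open>Y[1] \<cong> X\<close>, since no quasi-inverse of the shift is fixed; as closure under
  extensions makes the subcategory closed under isomorphism, the choice does not matter.
\<close>

definition triangulated_subcat :: "('o, 'm, 'k, 'z) tricat_scheme \<Rightarrow> 'o set \<Rightarrow> bool" where
  "triangulated_subcat C B \<longleftrightarrow> B \<noteq> {} \<and> B \<subseteq> Obj C \<and>
     (\<forall>X \<in> B. ShO C X \<in> B) \<and>
     (\<forall>X \<in> B. \<forall>Y \<in> Obj C. isomorphic C (ShO C Y) X \<longrightarrow> Y \<in> B) \<and>
     (\<forall>X Y Z u v w. dist_triangle C X Y Z u v w \<longrightarrow> X \<in> B \<longrightarrow> Z \<in> B \<longrightarrow> Y \<in> B)"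

definition full_subcat ::
  "('o, 'm, 'k, 'z) tricat_scheme \<Rightarrow> 'o set \<Rightarrow> ('o, 'm, 'k, 'z) tricat_scheme" where
  "full_subcat C B =
     C\<lparr>Obj := B, Arr := {f \<in> Arr C. Src C f \<in> B \<and> Tgt C f \<in> B},
       Dist := {(u, v, w) \<in> Dist C. Src C u \<in> B \<and> Tgt C u \<in> B \<and> Tgt C v \<in> B}\<rparr>"

definition generated_subcat :: "('o, 'm, 'k, 'z) tricat_scheme \<Rightarrow> 'o set \<Rightarrow> 'o set" where
  "generated_subcat C S = \<Inter>{B. triangulated_subcat C B \<and> S \<subseteq> B}"

definition image_subcat ::
  "('o, 'm, 'k, 'y) tricat_scheme \<Rightarrow> ('p, 'n, 'l, 'z) tricat_scheme \<Rightarrow>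
   ('o, 'm, 'p, 'n) gfunct \<Rightarrow> 'o set \<Rightarrow> 'p set"
where
  "image_subcat C D F B = {Y \<in> Obj D. \<exists>X \<in> B. isomorphic D (FO F X) Y}"


section \<open>The digraph of subcategories\<close>

definition G_vertices ::
  "('k, 'x) ring_scheme \<Rightarrow> ('p, 'n, 'k) tricat set \<Rightarrow> ('o, 'm, 'k) tricat \<Rightarrow> 'o set set" where
  "G_vertices K \<J> S =
     {B. triangulated_subcat S B \<and> (\<exists>J \<in> \<J>. linearly_exactly_equivalent K (full_subcat S B) J)}"

definition G_digraph ::
  "('k, 'x) ring_scheme \<Rightarrow> ('p, 'n, 'k) tricat set \<Rightarrow> ('o, 'm, 'k) tricat \<Rightarrow>
   ('o set, 'o set \<times> 'o set) pre_digraph"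
where
  "G_digraph K \<J> S =
     \<lparr>verts = G_vertices K \<J> S,
      arcs = {(B1, B2). B1 \<in> G_vertices K \<J> S \<and> B2 \<in> G_vertices K \<J> S \<and> B1 \<noteq> B2 \<and>
                (\<forall>X1 \<in> B1. \<forall>X2 \<in> B2. Hom S X2 X1 = {ZeroA S X2 X1})},
      tail = fst, head = snd\<rparr>"

text \<open>
  \<open>F\<^sub>*\<close> as a map of digraphs with pairs as arcs.  Its \<open>Im\<close> is the full subgraph on the images of the
  vertices.
\<close>

definition star ::
  "('o, 'm, 'k) tricat \<Rightarrow> ('p, 'n, 'k) tricat \<Rightarrow> ('o, 'm, 'p, 'n) gfunct \<Rightarrow>
   ('o set, 'o set \<times> 'o set, 'p set, 'p set \<times> 'p set) digraph_isomorphism"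
where
  "star C D F =
     \<lparr>iso_verts = image_subcat C D F,
      iso_arcs = map_prod (image_subcat C D F) (image_subcat C D F),
      iso_head = snd, iso_tail = fst\<rparr>"

definition Im_star ::
  "('k, 'x) ring_scheme \<Rightarrow> ('q, 'l, 'k) tricat set \<Rightarrow> ('o, 'm, 'k) tricat \<Rightarrow> ('p, 'n, 'k) tricat \<Rightarrow>
   ('o, 'm, 'p, 'n) gfunct \<Rightarrow> ('p set, 'p set \<times> 'p set) pre_digraph"
where
  "Im_star K \<J> A T F =
     G_digraph K \<J> T \<restriction> (iso_verts (star A T F) ` verts (G_digraph K \<J> A))"

definition subgraphs_iso_to ::
  "('k, 'x) ring_scheme \<Rightarrow> ('q, 'l, 'k) tricat set \<Rightarrow> ('o, 'm, 'k) tricat \<Rightarrow> ('p, 'n, 'k) tricat \<Rightarrow>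
   ('p set, 'p set \<times> 'p set) pre_digraph set"
where
  "subgraphs_iso_to K \<J> A T =
     {B. induced_subgraph B (G_digraph K \<J> T) \<and> digraph_iso (G_digraph K \<J> A) B}"

text \<open>Here \<open>app_iso (star T T \<beta>) B\<close> is the subgraph \<open>\<beta>\<^sub>*(B)\<close>.\<close>

definition subgraph_rel ::
  "('k, 'x) ring_scheme \<Rightarrow> ('q, 'l, 'k) tricat set \<Rightarrow> ('o, 'm, 'k) tricat \<Rightarrow> ('p, 'n, 'k) tricat \<Rightarrow>
   ('p, 'n, 'p, 'n) gfunct set set \<Rightarrow> ('p set, 'p set \<times> 'p set) pre_digraph rel"
where
  "subgraph_rel K \<J> A T \<Gamma> =
     {(B1, B2). B1 \<in> subgraphs_iso_to K \<J> A T \<and> B2 \<in> subgraphs_iso_to K \<J> A T \<and>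
        (\<exists>b \<in> \<Gamma>. \<exists>\<beta> \<in> b. app_iso (star T T \<beta>) B1 = B2)}"


section \<open>Fully faithful functors modulo auto-equivalences\<close>

definition ff_functors ::
  "('k, 'x) ring_scheme \<Rightarrow> ('o, 'm, 'k) tricat \<Rightarrow> ('p, 'n, 'k) tricat \<Rightarrow> ('o, 'm, 'p, 'n) gfunct set"
where
  "ff_functors K A T =
     {F. exact_functor A T F \<and> linear_functor K A T F \<and> fully_faithful A T F}"

definition C_rel ::
  "('k, 'x) ring_scheme \<Rightarrow> ('o, 'm, 'k) tricat \<Rightarrow> ('p, 'n, 'k) tricat \<Rightarrow>
   ('p, 'n, 'p, 'n) gfunct set set \<Rightarrow> ('o, 'm, 'p, 'n) gfunct rel"
where
  "C_rel K A T \<Gamma> =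
     {(F, F'). F \<in> ff_functors K A T \<and> F' \<in> ff_functors K A T \<and>
        (\<exists>a \<in> carrier (Aut A). \<exists>\<alpha> \<in> a. \<exists>b \<in> \<Gamma>. \<exists>\<beta> \<in> b.
           graded_iso A T (comp_gfunct T F \<alpha>) (comp_gfunct T \<beta> F'))}"

definition C_set ::
  "('k, 'x) ring_scheme \<Rightarrow> ('o, 'm, 'k) tricat \<Rightarrow> ('p, 'n, 'k) tricat \<Rightarrow>
   ('p, 'n, 'p, 'n) gfunct set set \<Rightarrow> ('o, 'm, 'p, 'n) gfunct set set"
where
  "C_set K A T \<Gamma> = ff_functors K A T // C_rel K A T \<Gamma>"

end

theory Submission
  imports Defs
begin

text \<open>
  The theorem rests on one criterion: for fully faithful exact linear functors \<open>F\<close> and \<open>F'\<close> from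
  \<open>A\<close> to \<open>T\<close>, there are an auto-equivalence \<open>\<alpha>\<close> of \<open>A\<close> and \<open>[\<beta>] \<in> \<Gamma>\<close> with \<open>F \<alpha> \<cong> \<beta> F'\<close> if and only if
  \<open>\<beta>\<^sub>*(Im F'\<^sub>*) = Im F\<^sub>*\<close> for some \<open>[\<beta>] \<in> \<Gamma>\<close> (\<open>C_rel_iff\<close>).  As \<open>\<Gamma>\<close> is a group, the relation on subgraphs is
  an equivalence relation; by the criterion so is the relation on functors, and \<open>[F] \<mapsto> [Im F\<^sub>*]\<close> is
  well defined and injective.

  The main tool is a lifting principle (\<open>lift_exact\<close>): if \<open>F\<close> is fully faithful and exact and \<open>G\<close>
  is an exact functor all of whose values lie in the essential image of \<open>F\<close>, then \<open>G \<cong> F H\<close> as graded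
  functors with \<open>H\<close> exact.  Full faithfulness of \<open>F\<close> determines \<open>H\<close> on
  arrows, and the shift isomorphism of \<open>H\<close> is the preimage of the one of \<open>G\<close>.  That \<open>H\<close> preserves distinguished triangles means that \<open>F\<close> reflects
  them (\<open>reflect_dist\<close>), which follows from the five lemma for triangles (\<open>triangle_five\<close>).
  The lift is linear if \<open>F\<close> and \<open>G\<close> are.  The principle is used four times.

  \<^item> Lifting the inclusion of the subcategory \<open>F(B)\<close> through \<open>F\<close> gives a linear exact equivalence from
    \<open>F(B)\<close> to \<open>B\<close>.  Hence \<open>F\<^sub>*\<close> maps vertices to vertices; as \<open>F(B)\<close> is triangulated
    (\<open>image_triangulated\<close>), \<open>F\<^sub>*\<close> is an embedding onto a full subgraph.
  \<^item> Lifting the identity through an auto-equivalence gives its quasi-inverse, so that the classes of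
    linear auto-equivalences form a group (\<open>group_AutK\<close>).
  \<^item> If \<open>F \<alpha> \<cong> \<beta> F'\<close>, then \<open>\<alpha>\<close> is a lift of a linear functor, thus linear.  It permutes the vertices of
    the digraph of \<open>A\<close>, and therefore \<open>\<beta>\<^sub>*(Im F'\<^sub>*) = Im F\<^sub>*\<close>.
  \<^item> If \<open>\<beta>\<^sub>*(Im F'\<^sub>*) = Im F\<^sub>*\<close>, then the essential images of \<open>F\<close> and \<open>\<beta> F'\<close> agree on the vertices.  The
    objects that one of these functors sends into the essential image of the other form a
    triangulated subcategory, which is all of \<open>A\<close> because the vertices generate \<open>A\<close>.  So \<open>\<beta> F'\<close> lifts through \<open>F\<close> to an
    auto-equivalence \<open>\<alpha>\<close>.
\<close>

section \<open>Categories, fully faithful functors and equivalences\<close>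

lemma Hom_iff: "f \<in> Hom C X Y \<longleftrightarrow> f \<in> Arr C \<and> Src C f = X \<and> Tgt C f = Y"
  by (simp add: Hom_def)

text \<open>Two arrows \<open>f : X \<rightarrow> Y\<close> and \<open>g : Y \<rightarrow> X\<close> that are inverse to each other.\<close>

definition mutually_inverse ::
  "('o, 'm, 'z) cat_scheme \<Rightarrow> 'o \<Rightarrow> 'o \<Rightarrow> 'm \<Rightarrow> 'm \<Rightarrow> bool" where
  "mutually_inverse C X Y f g \<longleftrightarrow> f \<in> Hom C X Y \<and> g \<in> Hom C Y X \<and>
     g \<cdot>\<^bsub>C\<^esub> f = Idn C X \<and> f \<cdot>\<^bsub>C\<^esub> g = Idn C Y"

lemma mutually_inverseD:
  assumes "mutually_inverse C X Y f g"
  shows "f \<in> Arr C" "Src C f = X" "Tgt C f = Y" "g \<in> Arr C" "Src C g = Y" "Tgt C g = X"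
    "g \<cdot>\<^bsub>C\<^esub> f = Idn C X" "f \<cdot>\<^bsub>C\<^esub> g = Idn C Y"
  using assms by (auto simp: mutually_inverse_def Hom_iff)

lemma mutually_inverse_sym: "mutually_inverse C X Y f g \<Longrightarrow> mutually_inverse C Y X g f"
  by (auto simp: mutually_inverse_def)

lemma is_iso_iff: "f \<in> Hom C X Y \<Longrightarrow> is_iso C f \<longleftrightarrow> (\<exists>g. mutually_inverse C X Y f g)"
  by (auto simp: is_iso_def mutually_inverse_def Hom_iff)

lemma mutually_inverse_imp_is_iso: "mutually_inverse C X Y f g \<Longrightarrow> is_iso C f"
  by (auto simp: is_iso_def mutually_inverse_def Hom_iff)

lemma isomorphic_iff: "isomorphic C X Y \<longleftrightarrow> (\<exists>f g. mutually_inverse C X Y f g)"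
  unfolding isomorphic_def by (metis is_iso_iff mutually_inverse_def)

context category
begin

lemma Cmp_Arr [simp]:
  assumes "f \<in> Arr C" "g \<in> Arr C" "Src C g = Tgt C f"
  shows "g \<cdot> f \<in> Arr C" "Src C (g \<cdot> f) = Src C f" "Tgt C (g \<cdot> f) = Tgt C g"
  using Cmp_closed[of f "Src C f" "Tgt C f" g "Tgt C g"] assms by (simp_all add: Hom_iff)

lemma Idn_Arr [simp]:
  assumes "X \<in> Obj C"
  shows "Idn C X \<in> Arr C" "Src C (Idn C X) = X" "Tgt C (Idn C X) = X"
  using Idn_closed[OF assms] by (simp_all add: Hom_iff)

lemma Cmp_Idn_Arr [simp]: "f \<in> Arr C \<Longrightarrow> Src C f = X \<Longrightarrow> f \<cdot> Idn C X = f"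
  using Cmp_Idn[of f X "Tgt C f"] by (simp add: Hom_iff)

lemma Idn_Cmp_Arr [simp]: "f \<in> Arr C \<Longrightarrow> Tgt C f = X \<Longrightarrow> Idn C X \<cdot> f = f"
  using Idn_Cmp[of f "Src C f" X] by (simp add: Hom_iff)

lemma Cmp_assoc_Arr [simp]:
  "\<lbrakk>f \<in> Arr C; g \<in> Arr C; h \<in> Arr C; Src C g = Tgt C f; Src C h = Tgt C g\<rbrakk>
   \<Longrightarrow> (h \<cdot> g) \<cdot> f = h \<cdot> (g \<cdot> f)"
  using Cmp_assoc[of f "Src C f" "Tgt C f" g "Tgt C g" h "Tgt C h"] by (simp add: Hom_iff)

lemma Src_Obj [simp]: "f \<in> Arr C \<Longrightarrow> Src C f \<in> Obj C"
  and Tgt_Obj [simp]: "f \<in> Arr C \<Longrightarrow> Tgt C f \<in> Obj C"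
  by (simp_all add: Src_closed Tgt_closed)

lemma Hom_Obj: "f \<in> Hom C X Y \<Longrightarrow> X \<in> Obj C \<and> Y \<in> Obj C"
  by (auto simp: Hom_iff)

lemma mutually_inverse_Obj: "mutually_inverse C X Y f g \<Longrightarrow> X \<in> Obj C \<and> Y \<in> Obj C"
  by (auto simp: mutually_inverse_def dest: Hom_Obj)

lemma inverse_cancel:
  assumes "mutually_inverse C X Y f g"
  shows "\<And>h. \<lbrakk>h \<in> Arr C; Tgt C h = X\<rbrakk> \<Longrightarrow> g \<cdot> (f \<cdot> h) = h"
    and "\<And>h. \<lbrakk>h \<in> Arr C; Tgt C h = Y\<rbrakk> \<Longrightarrow> f \<cdot> (g \<cdot> h) = h"
proof -
  note m = mutually_inverseD[OF assms]
  show "g \<cdot> (f \<cdot> h) = h" if "h \<in> Arr C" "Tgt C h = X" for h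
    using Cmp_assoc_Arr[of h f g] that m by simp
  show "f \<cdot> (g \<cdot> h) = h" if "h \<in> Arr C" "Tgt C h = Y" for h
    using Cmp_assoc_Arr[of h g f] that m by simp
qed

lemma iso_monic:
  assumes "mutually_inverse C X Y f g" "h \<in> Arr C" "h' \<in> Arr C" "Tgt C h = X" "Tgt C h' = X"
    "f \<cdot> h = f \<cdot> h'"
  shows "h = h'"
  by (metis assms inverse_cancel(1))

lemma iso_epic:
  assumes "mutually_inverse C X Y f g" "h \<in> Arr C" "h' \<in> Arr C" "Src C h = Y" "Src C h' = Y"
    "h \<cdot> f = h' \<cdot> f"
  shows "h = h'"
proof -
  note m = mutually_inverseD[OF assms(1)]
  have "h = (h \<cdot> f) \<cdot> g" using m assms(2,4) by simp
  also have "\<dots> = (h' \<cdot> f) \<cdot> g" using assms(6) by simp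
  also have "\<dots> = h'" using m assms(3,5) by simp
  finally show ?thesis .
qed

lemma mutually_inverse_refl: "X \<in> Obj C \<Longrightarrow> mutually_inverse C X X (Idn C X) (Idn C X)"
  by (simp add: mutually_inverse_def Hom_iff)

lemma mutually_inverse_Cmp:
  assumes "mutually_inverse C X Y f g" "mutually_inverse C Y Z f' g'"
  shows "mutually_inverse C X Z (f' \<cdot> f) (g \<cdot> g')"
  using mutually_inverseD[OF assms(1)] mutually_inverseD[OF assms(2)]
    inverse_cancel[OF assms(1)] inverse_cancel[OF assms(2)]
  by (simp add: mutually_inverse_def Hom_iff)

lemma isomorphic_refl: "X \<in> Obj C \<Longrightarrow> isomorphic C X X"
  unfolding isomorphic_iff using mutually_inverse_refl by metis

lemma isomorphic_sym: "isomorphic C X Y \<Longrightarrow> isomorphic C Y X"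
  unfolding isomorphic_iff using mutually_inverse_sym by metis

lemma isomorphic_trans: "isomorphic C X Y \<Longrightarrow> isomorphic C Y Z \<Longrightarrow> isomorphic C X Z"
  unfolding isomorphic_iff using mutually_inverse_Cmp by metis

lemma isomorphic_Obj: "isomorphic C X Y \<Longrightarrow> X \<in> Obj C \<and> Y \<in> Obj C"
  unfolding isomorphic_iff using mutually_inverse_Obj by metis

text \<open>A two-sided inverse can be assembled from a left and a right inverse.\<close>

lemma is_iso_if_left_right:
  assumes "f \<in> Hom C X Y" "l \<in> Hom C Y X" "r \<in> Hom C Y X"
    "l \<cdot> f = Idn C X" "f \<cdot> r = Idn C Y"
  shows "is_iso C f"
proof -
  have "l = l \<cdot> (f \<cdot> r)" using assms by (auto simp: Hom_iff)
  also have "\<dots> = (l \<cdot> f) \<cdot> r" using assms(1-3) by (auto simp: Hom_iff)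
  also have "\<dots> = r" using assms by (auto simp: Hom_iff simp del: Cmp_assoc_Arr)
  finally show ?thesis using assms by (auto simp: is_iso_def Hom_iff)
qed

end

lemma comp_funct_simps [simp]:
  "FO (comp_funct G F) X = FO G (FO F X)" "FA (comp_funct G F) f = FA G (FA F f)"
  by (simp_all add: comp_funct_def)

lemma comp_funct_assoc: "comp_funct (comp_funct F G) H = comp_funct F (comp_funct G H)"
  by (simp add: comp_funct_def o_assoc)

lemma id_funct_simps [simp]: "FO id_funct X = X" "FA id_funct f = f"
  by (simp_all add: id_funct_def)

text \<open>A functor between two categories; \<open>ff_functor\<close> below adds full faithfulness.\<close>

locale functor_between = Dom: category C + Cod: category D
  for C :: "('o, 'm, 'y) cat_scheme" and D :: "('p, 'n, 'z) cat_scheme"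
    and F :: "('o, 'm, 'p, 'n, 'f) funct_scheme" +
  assumes cat_functor: "cat_functor C D F"
begin

lemma Obj [simp]: "X \<in> Obj C \<Longrightarrow> FO F X \<in> Obj D"
  and Idn [simp]: "X \<in> Obj C \<Longrightarrow> FA F (Idn C X) = Idn D (FO F X)"
  and Arr [simp]: "f \<in> Arr C \<Longrightarrow> FA F f \<in> Arr D"
  and Src [simp]: "f \<in> Arr C \<Longrightarrow> Src D (FA F f) = FO F (Src C f)"
  and Tgt [simp]: "f \<in> Arr C \<Longrightarrow> Tgt D (FA F f) = FO F (Tgt C f)"
  and Cmp [simp]: "f \<in> Arr C \<Longrightarrow> g \<in> Arr C \<Longrightarrow> Src C g = Tgt C f \<Longrightarrow>
    FA F (g \<cdot>\<^bsub>C\<^esub> f) = FA F g \<cdot>\<^bsub>D\<^esub> FA F f"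
  using cat_functor by (auto simp: cat_functor_def Hom_iff)

lemma Hom: "f \<in> Hom C X Y \<Longrightarrow> FA F f \<in> Hom D (FO F X) (FO F Y)"
  by (auto simp: Hom_iff)

lemma mutually_inverse:
  assumes "mutually_inverse C X Y f g"
  shows "mutually_inverse D (FO F X) (FO F Y) (FA F f) (FA F g)"
proof -
  note m = mutually_inverseD[OF assms]
  have "X \<in> Obj C" "Y \<in> Obj C" using m by auto
  then show ?thesis
    unfolding mutually_inverse_def using m Cmp[of f g] Cmp[of g f] by (simp add: Hom_iff)
qed

lemma isomorphic: "isomorphic C X Y \<Longrightarrow> isomorphic D (FO F X) (FO F Y)"
  unfolding isomorphic_iff using mutually_inverse by metis

end

lemma cat_functor_id: "category C \<Longrightarrow> cat_functor C C id_funct"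
  by (auto simp: cat_functor_def Hom_iff category.Idn_Arr)

lemma cat_functor_comp:
  assumes "functor_between C D F" "functor_between D E G"
  shows "cat_functor C E (comp_funct G F)"
proof -
  interpret F: functor_between C D F by fact
  interpret G: functor_between D E G by fact
  show ?thesis by (auto simp: cat_functor_def Hom_iff)
qed

lemma functor_between_comp:
  assumes "functor_between C D F" "functor_between D E G"
  shows "functor_between C E (comp_funct G F)"
  using assms cat_functor_comp[OF assms]
  by (simp add: functor_between_def functor_between_axioms_def)

lemma functor_betweenI:
  "category C \<Longrightarrow> category D \<Longrightarrow> cat_functor C D F \<Longrightarrow> functor_between C D F"
  by (simp add: functor_between_def functor_between_axioms_def)

locale ff_functor = functor_between C D F
  for C :: "('o, 'm, 'y) cat_scheme" and D :: "('p, 'n, 'z) cat_scheme"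
    and F :: "('o, 'm, 'p, 'n, 'f) funct_scheme" +
  assumes fully_faithful: "fully_faithful C D F"
begin

lemma faithful:
  assumes "f \<in> Hom C X Y" "g \<in> Hom C X Y" "FA F f = FA F g"
  shows "f = g"
proof -
  have "X \<in> Obj C" "Y \<in> Obj C" using assms(1) Dom.Hom_Obj by auto
  then have "inj_on (FA F) (Hom C X Y)"
    using fully_faithful by (auto simp: fully_faithful_def bij_betw_def)
  then show ?thesis using assms by (auto dest: inj_onD)
qed

lemma full:
  assumes "h \<in> Hom D (FO F X) (FO F Y)" "X \<in> Obj C" "Y \<in> Obj C"
  obtains f where "f \<in> Hom C X Y" "FA F f = h"
proof -
  have "FA F ` Hom C X Y = Hom D (FO F X) (FO F Y)"
    using fully_faithful assms by (auto simp: fully_faithful_def bij_betw_def)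
  then show thesis using assms(1) that by (metis imageE)
qed

lemma reflect_mutually_inverse:
  assumes "f \<in> Hom C X Y" "g \<in> Hom C Y X"
    and inv: "mutually_inverse D (FO F X) (FO F Y) (FA F f) (FA F g)"
  shows "mutually_inverse C X Y f g"
proof -
  note m = mutually_inverseD[OF inv]
  have O: "X \<in> Obj C" "Y \<in> Obj C" using assms(1) Dom.Hom_Obj by auto
  have 1: "g \<cdot>\<^bsub>C\<^esub> f = Idn C X"
    by (rule faithful[of _ X X]) (use assms O m in \<open>auto simp: Hom_iff\<close>)
  have 2: "f \<cdot>\<^bsub>C\<^esub> g = Idn C Y"
    by (rule faithful[of _ Y Y]) (use assms O m in \<open>auto simp: Hom_iff\<close>)
  show ?thesis using assms 1 2 by (simp add: mutually_inverse_def)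
qed

lemma reflect_iso:
  assumes "f \<in> Hom C X Y" "is_iso D (FA F f)"
  shows "is_iso C f"
proof -
  have O: "X \<in> Obj C" "Y \<in> Obj C" using assms(1) Dom.Hom_Obj by auto
  obtain g' where g': "mutually_inverse D (FO F X) (FO F Y) (FA F f) g'"
    using assms is_iso_iff Hom by metis
  then obtain g where "g \<in> Hom C Y X" "FA F g = g'"
    using full[of g' Y X] O by (auto simp: mutually_inverse_def)
  then show ?thesis using reflect_mutually_inverse[of f X Y g] g' assms(1)
    by (auto intro: mutually_inverse_imp_is_iso)
qed

lemma reflect_isomorphic:
  assumes "isomorphic D (FO F X) (FO F Y)" "X \<in> Obj C" "Y \<in> Obj C"
  shows "isomorphic C X Y"
proof -
  obtain h where h: "h \<in> Hom D (FO F X) (FO F Y)" "is_iso D h"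
    using assms(1) by (auto simp: isomorphic_def)
  obtain f where "f \<in> Hom C X Y" "FA F f = h"
    using full[OF h(1) assms(2,3)] by blast
  then show ?thesis unfolding isomorphic_def using reflect_iso h(2) by blast
qed

end

lemma ff_functorI:
  "functor_between C D F \<Longrightarrow> fully_faithful C D F \<Longrightarrow> ff_functor C D F"
  by (simp add: ff_functor_def ff_functor_axioms_def)

lemma fully_faithful_comp:
  assumes "ff_functor C D F" "ff_functor D E G"
  shows "fully_faithful C E (comp_funct G F)"
proof -
  interpret F: ff_functor C D F by fact
  interpret G: ff_functor D E G by fact
  have "bij_betw (FA G \<circ> FA F) (Hom C X Y) (Hom E (FO G (FO F X)) (FO G (FO F Y)))"
    if "X \<in> Obj C" "Y \<in> Obj C" for X Y
    using F.fully_faithful G.fully_faithful that bij_betw_trans F.Obj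
    unfolding fully_faithful_def by blast
  then show ?thesis by (simp add: fully_faithful_def comp_funct_def)
qed

lemma nat_isoD:
  assumes "nat_iso C D F G \<theta>"
  shows "X \<in> Obj C \<Longrightarrow> \<theta> X \<in> Arr D" "X \<in> Obj C \<Longrightarrow> Src D (\<theta> X) = FO F X"
    "X \<in> Obj C \<Longrightarrow> Tgt D (\<theta> X) = FO G X"
    "f \<in> Arr C \<Longrightarrow> \<theta> (Tgt C f) \<cdot>\<^bsub>D\<^esub> FA F f = FA G f \<cdot>\<^bsub>D\<^esub> \<theta> (Src C f)"
  using assms by (auto simp: nat_iso_def Hom_iff)

lemma nat_iso_inverse:
  assumes "nat_iso C D F G \<theta>"
  obtains \<psi> where "\<And>X. X \<in> Obj C \<Longrightarrow> mutually_inverse D (FO F X) (FO G X) (\<theta> X) (\<psi> X)"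
proof -
  have "\<forall>X \<in> Obj C. \<exists>g. mutually_inverse D (FO F X) (FO G X) (\<theta> X) g"
    using assms is_iso_iff unfolding nat_iso_def by metis
  then show thesis using that by metis
qed

lemma nat_isoI:
  assumes "\<And>X. X \<in> Obj C \<Longrightarrow> mutually_inverse D (FO F X) (FO G X) (\<theta> X) (\<psi> X)"
    and "\<And>f. f \<in> Arr C \<Longrightarrow> \<theta> (Tgt C f) \<cdot>\<^bsub>D\<^esub> FA F f = FA G f \<cdot>\<^bsub>D\<^esub> \<theta> (Src C f)"
  shows "nat_iso C D F G \<theta>"
  unfolding nat_iso_def using assms mutually_inverse_def mutually_inverse_imp_is_iso by metis

lemma nat_iso_isomorphic: "nat_iso C D F G \<theta> \<Longrightarrow> X \<in> Obj C \<Longrightarrow> isomorphic D (FO F X) (FO G X)"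
  by (auto simp: nat_iso_def isomorphic_def)

lemma nat_iso_refl:
  assumes "functor_between C D F"
  shows "nat_iso C D F F (\<lambda>X. Idn D (FO F X))"
proof -
  interpret functor_between C D F by fact
  show ?thesis by (rule nat_isoI) (auto intro: Cod.mutually_inverse_refl)
qed

lemma nat_iso_sym:
  assumes "functor_between C D F" "functor_between C D G" "nat_iso C D F G \<theta>"
    and inv: "\<And>X. X \<in> Obj C \<Longrightarrow> mutually_inverse D (FO F X) (FO G X) (\<theta> X) (\<psi> X)"
  shows "nat_iso C D G F \<psi>"
proof (rule nat_isoI)
  interpret F: functor_between C D F by fact
  interpret G: functor_between C D G by fact
  note nat = nat_isoD[OF assms(3)]
  show "mutually_inverse D (FO G X) (FO F X) (\<psi> X) (\<theta> X)" if "X \<in> Obj C" for X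
    using inv[OF that] by (rule mutually_inverse_sym)
  fix f assume f: "f \<in> Arr C"
  then have O: "Src C f \<in> Obj C" "Tgt C f \<in> Obj C" by auto
  note mS = inv[OF O(1)] and mT = inv[OF O(2)]
  note mSD = mutually_inverseD[OF mS] and mTD = mutually_inverseD[OF mT]
  show "\<psi> (Tgt C f) \<cdot>\<^bsub>D\<^esub> FA G f = FA F f \<cdot>\<^bsub>D\<^esub> \<psi> (Src C f)"
  proof (rule F.Cod.iso_epic[OF mS])
    have "\<psi> (Tgt C f) \<cdot>\<^bsub>D\<^esub> (FA G f \<cdot>\<^bsub>D\<^esub> \<theta> (Src C f)) = FA F f"
      using nat(4)[OF f, symmetric] F.Cod.inverse_cancel(1)[OF mT] f by simp
    then show "(\<psi> (Tgt C f) \<cdot>\<^bsub>D\<^esub> FA G f) \<cdot>\<^bsub>D\<^esub> \<theta> (Src C f) = (FA F f \<cdot>\<^bsub>D\<^esub> \<psi> (Src C f)) \<cdot>\<^bsub>D\<^esub> \<theta> (Src C f)"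
      using f mSD mTD by simp
  qed (use f mSD mTD in auto)
qed

lemma nat_iso_trans:
  assumes "functor_between C D F" "functor_between C D G" "functor_between C D H"
    and "nat_iso C D F G \<theta>" "nat_iso C D G H \<phi>"
  shows "nat_iso C D F H (\<lambda>X. \<phi> X \<cdot>\<^bsub>D\<^esub> \<theta> X)"
proof -
  interpret F: functor_between C D F by fact
  interpret G: functor_between C D G by fact
  interpret H: functor_between C D H by fact
  obtain \<theta>' where t: "\<And>X. X \<in> Obj C \<Longrightarrow> mutually_inverse D (FO F X) (FO G X) (\<theta> X) (\<theta>' X)"
    using nat_iso_inverse assms(4) by blast
  obtain \<phi>' where p: "\<And>X. X \<in> Obj C \<Longrightarrow> mutually_inverse D (FO G X) (FO H X) (\<phi> X) (\<phi>' X)"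
    using nat_iso_inverse assms(5) by blast
  note t' = nat_isoD[OF assms(4)] and p' = nat_isoD[OF assms(5)]
  show ?thesis
  proof (rule nat_isoI)
    show "mutually_inverse D (FO F X) (FO H X) (\<phi> X \<cdot>\<^bsub>D\<^esub> \<theta> X) (\<theta>' X \<cdot>\<^bsub>D\<^esub> \<phi>' X)" if "X \<in> Obj C" for X
      using F.Cod.mutually_inverse_Cmp[OF t[OF that] p[OF that]] .
    fix f assume f: "f \<in> Arr C"
    have "\<phi> (Tgt C f) \<cdot>\<^bsub>D\<^esub> (FA G f \<cdot>\<^bsub>D\<^esub> \<theta> (Src C f)) = (\<phi> (Tgt C f) \<cdot>\<^bsub>D\<^esub> FA G f) \<cdot>\<^bsub>D\<^esub> \<theta> (Src C f)"
      using f t'(1-3) p'(1-3) by simp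
    also have "\<dots> = (FA H f \<cdot>\<^bsub>D\<^esub> \<phi> (Src C f)) \<cdot>\<^bsub>D\<^esub> \<theta> (Src C f)" using f p' by simp
    finally show "(\<phi> (Tgt C f) \<cdot>\<^bsub>D\<^esub> \<theta> (Tgt C f)) \<cdot>\<^bsub>D\<^esub> FA F f = FA H f \<cdot>\<^bsub>D\<^esub> (\<phi> (Src C f) \<cdot>\<^bsub>D\<^esub> \<theta> (Src C f))"
      using f t' p'(1-3) by simp
  qed
qed

lemma nat_iso_whisker_right:
  assumes "functor_between B C H" "nat_iso C D F G \<theta>"
  shows "nat_iso B D (comp_funct F H) (comp_funct G H) (\<lambda>X. \<theta> (FO H X))"
proof -
  interpret H: functor_between B C H by fact
  obtain \<psi> where p: "\<And>X. X \<in> Obj C \<Longrightarrow> mutually_inverse D (FO F X) (FO G X) (\<theta> X) (\<psi> X)"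
    using nat_iso_inverse assms(2) by blast
  show ?thesis
  proof (rule nat_isoI)
    show "mutually_inverse D (FO (comp_funct F H) X) (FO (comp_funct G H) X) (\<theta> (FO H X)) (\<psi> (FO H X))"
      if "X \<in> Obj B" for X using p that by simp
    show "\<theta> (FO H (Tgt B f)) \<cdot>\<^bsub>D\<^esub> FA (comp_funct F H) f = FA (comp_funct G H) f \<cdot>\<^bsub>D\<^esub> \<theta> (FO H (Src B f))"
      if "f \<in> Arr B" for f using nat_isoD(4)[OF assms(2), of "FA H f"] that by simp
  qed
qed

lemma nat_iso_whisker_left:
  assumes "functor_between C D F" "functor_between C D G" "functor_between D E H"
    and "nat_iso C D F G \<theta>"
  shows "nat_iso C E (comp_funct H F) (comp_funct H G) (\<lambda>X. FA H (\<theta> X))"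
proof -
  interpret F: functor_between C D F by fact
  interpret G: functor_between C D G by fact
  interpret H: functor_between D E H by fact
  obtain \<psi> where p: "\<And>X. X \<in> Obj C \<Longrightarrow> mutually_inverse D (FO F X) (FO G X) (\<theta> X) (\<psi> X)"
    using nat_iso_inverse assms(4) by blast
  note n = nat_isoD[OF assms(4)]
  show ?thesis
  proof (rule nat_isoI)
    show "mutually_inverse E (FO (comp_funct H F) X) (FO (comp_funct H G) X) (FA H (\<theta> X)) (FA H (\<psi> X))"
      if "X \<in> Obj C" for X using H.mutually_inverse[OF p] that by simp
    fix f assume f: "f \<in> Arr C"
    then show "FA H (\<theta> (Tgt C f)) \<cdot>\<^bsub>E\<^esub> FA (comp_funct H F) f = FA (comp_funct H G) f \<cdot>\<^bsub>E\<^esub> FA H (\<theta> (Src C f))"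
      using n H.Cmp[of "FA F f" "\<theta> (Tgt C f)"] H.Cmp[of "\<theta> (Src C f)" "FA G f"] by simp
  qed
qed

text \<open>Postcomposition with a fully faithful functor reflects natural isomorphisms.\<close>

lemma ff_reflect_nat_iso:
  assumes "ff_functor C D F" "functor_between B C H" "functor_between B C H'"
    and "nat_iso B D (comp_funct F H) (comp_funct F H') \<theta>"
  obtains \<epsilon> where "nat_iso B C H H' \<epsilon>" "\<And>X. X \<in> Obj B \<Longrightarrow> FA F (\<epsilon> X) = \<theta> X"
proof -
  interpret F: ff_functor C D F by fact
  interpret H: functor_between B C H by fact
  interpret H': functor_between B C H' by fact
  note n = nat_isoD[OF assms(4), simplified]
  have "\<exists>e. e \<in> Hom C (FO H X) (FO H' X) \<and> FA F e = \<theta> X" if "X \<in> Obj B" for X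
    using F.full[of "\<theta> X" "FO H X" "FO H' X"] n that unfolding Hom_iff by (metis H.Obj H'.Obj)
  then obtain \<epsilon> where e: "\<And>X. X \<in> Obj B \<Longrightarrow> \<epsilon> X \<in> Hom C (FO H X) (FO H' X) \<and> FA F (\<epsilon> X) = \<theta> X"
    by metis
  have "nat_iso B C H H' \<epsilon>" unfolding nat_iso_def
  proof (intro conjI ballI)
    fix X assume X: "X \<in> Obj B"
    show "\<epsilon> X \<in> Hom C (FO H X) (FO H' X)" using e X by blast
    have "is_iso D (\<theta> X)" using assms(4) X by (auto simp: nat_iso_def)
    then show "is_iso C (\<epsilon> X)" using e[OF X] F.reflect_iso by metis
  next
    fix f assume f: "f \<in> Arr B"
    have O: "Src B f \<in> Obj B" "Tgt B f \<in> Obj B" using f by auto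
    note e1 = e[OF O(1)] and e2 = e[OF O(2)]
    show "\<epsilon> (Tgt B f) \<cdot>\<^bsub>C\<^esub> FA H f = FA H' f \<cdot>\<^bsub>C\<^esub> \<epsilon> (Src B f)"
    proof (rule F.faithful)
      show "\<epsilon> (Tgt B f) \<cdot>\<^bsub>C\<^esub> FA H f \<in> Hom C (FO H (Src B f)) (FO H' (Tgt B f))"
        "FA H' f \<cdot>\<^bsub>C\<^esub> \<epsilon> (Src B f) \<in> Hom C (FO H (Src B f)) (FO H' (Tgt B f))"
        using e1 e2 f by (auto simp: Hom_iff)
      show "FA F (\<epsilon> (Tgt B f) \<cdot>\<^bsub>C\<^esub> FA H f) = FA F (FA H' f \<cdot>\<^bsub>C\<^esub> \<epsilon> (Src B f))"
        using e1 e2 f n(4)[OF f] by (auto simp: Hom_iff)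
    qed
  qed
  then show thesis using that e by blast
qed

text \<open>
  A functor whose values lie in the essential image of a fully faithful functor \<open>F\<close> factors
  through \<open>F\<close> up to natural isomorphism.
\<close>

lemma lift_functor:
  assumes "ff_functor A T F" "functor_between S T G"
    and ess: "\<And>X. X \<in> Obj S \<Longrightarrow> \<exists>Y \<in> Obj A. isomorphic T (FO F Y) (FO G X)"
  obtains H \<phi> where "functor_between S A (H :: ('o, 'm, 'p, 'n) funct)" "nat_iso S T (comp_funct F H) G \<phi>"
proof -
  interpret F: ff_functor A T F by fact
  interpret G: functor_between S T G by fact
  have "\<forall>X\<in>Obj S. \<exists>Y f g. Y \<in> Obj A \<and> mutually_inverse T (FO F Y) (FO G X) f g"
    using ess unfolding isomorphic_iff by metis
  then obtain h \<phi> \<psi> where h: "\<And>X. X \<in> Obj S \<Longrightarrow> h X \<in> Obj A"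
    and p: "\<And>X. X \<in> Obj S \<Longrightarrow> mutually_inverse T (FO F (h X)) (FO G X) (\<phi> X) (\<psi> X)"
    by metis
  note pD = mutually_inverseD[OF p] and pc = F.Cod.inverse_cancel[OF p]
  have "\<exists>m. m \<in> Hom A (h (Src S f)) (h (Tgt S f)) \<and> FA F m = \<psi> (Tgt S f) \<cdot>\<^bsub>T\<^esub> (FA G f \<cdot>\<^bsub>T\<^esub> \<phi> (Src S f))"
    if f: "f \<in> Arr S" for f
  proof -
    have "\<psi> (Tgt S f) \<cdot>\<^bsub>T\<^esub> (FA G f \<cdot>\<^bsub>T\<^esub> \<phi> (Src S f)) \<in> Hom T (FO F (h (Src S f))) (FO F (h (Tgt S f)))"
      using f pD by (auto simp: Hom_iff)
    then show ?thesis using F.full h f by (metis G.Dom.Src_Obj G.Dom.Tgt_Obj)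
  qed
  then obtain m where m: "\<And>f. f \<in> Arr S \<Longrightarrow> m f \<in> Hom A (h (Src S f)) (h (Tgt S f))"
    and Fm: "\<And>f. f \<in> Arr S \<Longrightarrow> FA F (m f) = \<psi> (Tgt S f) \<cdot>\<^bsub>T\<^esub> (FA G f \<cdot>\<^bsub>T\<^esub> \<phi> (Src S f))"
    by metis
  have mD: "m f \<in> Arr A" "Src A (m f) = h (Src S f)" "Tgt A (m f) = h (Tgt S f)" if "f \<in> Arr S" for f
    using m[OF that] by (auto simp: Hom_iff)
  define H :: "('o, 'm, 'p, 'n) funct" where "H = \<lparr>FO = h, FA = m\<rparr>"
  have H: "cat_functor S A H"
    unfolding cat_functor_def H_def funct.simps
  proof (intro conjI ballI impI)
    fix X assume X: "X \<in> Obj S"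
    show "h X \<in> Obj A" using h X .
    show "m (Idn S X) = Idn A (h X)"
      by (rule F.faithful[of _ "h X" "h X"]) (use X h mD Fm pD in \<open>auto simp: Hom_iff\<close>)
  next
    fix f assume "f \<in> Arr S" then show "m f \<in> Hom A (h (Src S f)) (h (Tgt S f))" using m by blast
  next
    fix f g assume fg: "f \<in> Arr S" "g \<in> Arr S" "Src S g = Tgt S f"
    show "m (g \<cdot>\<^bsub>S\<^esub> f) = m g \<cdot>\<^bsub>A\<^esub> m f"
      by (rule F.faithful[of _ "h (Src S f)" "h (Tgt S g)"])
        (use fg mD Fm pD pc in \<open>auto simp: Hom_iff\<close>)
  qed
  have "nat_iso S T (comp_funct F H) G \<phi>"
    by (rule nat_isoI[of _ _ _ _ _ \<psi>]) (use p pD Fm pc in \<open>auto simp: H_def\<close>)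
  then show thesis using that H functor_betweenI[OF G.Dom.category_axioms F.Dom.category_axioms] by blast
qed

text \<open>A functor is essentially surjective if every object is isomorphic to a value of the functor.\<close>

definition ess_surj ::
  "('o, 'm, 'y) cat_scheme \<Rightarrow> ('p, 'n, 'z) cat_scheme \<Rightarrow> ('o, 'm, 'p, 'n, 'f) funct_scheme \<Rightarrow> bool"
where
  "ess_surj C D F \<longleftrightarrow> (\<forall>Y \<in> Obj D. \<exists>X \<in> Obj C. isomorphic D (FO F X) Y)"

text \<open>A functor with a left inverse up to natural isomorphism is faithful.\<close>

lemma left_inverse_faithful:
  assumes "functor_between C D F" "functor_between D C G"
    and "nat_iso C C (comp_funct G F) id_funct \<theta>"
    and "f \<in> Hom C X Y" "f' \<in> Hom C X Y" "FA F f = FA F f'"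
  shows "f = f'"
proof -
  interpret F: functor_between C D F by fact
  interpret G: functor_between D C G by fact
  note n = nat_isoD[OF assms(3), simplified]
  obtain \<psi> where p: "\<And>X. X \<in> Obj C \<Longrightarrow> mutually_inverse C (FO G (FO F X)) X (\<theta> X) (\<psi> X)"
    using nat_iso_inverse[OF assms(3)] by auto
  have X: "X \<in> Obj C" using assms(4) F.Dom.Hom_Obj by blast
  have "f \<cdot>\<^bsub>C\<^esub> \<theta> X = f' \<cdot>\<^bsub>C\<^esub> \<theta> X" using n(4)[of f] n(4)[of f'] assms(4-6) by (auto simp: Hom_iff)
  then show ?thesis
    using F.Dom.iso_epic[OF p[OF X]] assms(4,5) by (auto simp: Hom_iff)
qed

text \<open>The quasi-inverse of a fully faithful and essentially surjective functor is the lift of the identity.\<close>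

lemma equivalence_iff:
  fixes C :: "('o, 'm, 'y) cat_scheme" and D :: "('p, 'n, 'z) cat_scheme"
  assumes C: "category C" and D: "category D"
  shows "equivalence C D F \<longleftrightarrow> cat_functor C D F \<and> fully_faithful C D F \<and> ess_surj C D F"
proof
  assume "equivalence C D F"
  then obtain G :: "('p, 'n, 'o, 'm) funct" and \<theta> \<phi> where F: "cat_functor C D F" and G: "cat_functor D C G"
    and GF: "nat_iso C C (comp_funct G F) id_funct \<theta>"
    and FG: "nat_iso D D (comp_funct F G) id_funct \<phi>"
    unfolding equivalence_def by blast
  have F': "functor_between C D F" and G': "functor_between D C G"
    using C D F G functor_betweenI by auto
  interpret F: functor_between C D F by fact
  interpret G: functor_between D C G by fact
  have "ess_surj C D F"
    using nat_iso_isomorphic[OF FG] unfolding ess_surj_def by (auto intro!: bexI[OF _ G.Obj])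
  moreover have "fully_faithful C D F" unfolding fully_faithful_def bij_betw_def
  proof (intro conjI ballI)
    fix X Y assume X: "X \<in> Obj C" and Y: "Y \<in> Obj C"
    show "inj_on (FA F) (Hom C X Y)"
      using left_inverse_faithful[OF F' G' GF] by (meson inj_onI)
    show "FA F ` Hom C X Y = Hom D (FO F X) (FO F Y)"
    proof
      show "FA F ` Hom C X Y \<subseteq> Hom D (FO F X) (FO F Y)" using F.Hom by blast
      show "Hom D (FO F X) (FO F Y) \<subseteq> FA F ` Hom C X Y"
      proof
        fix h assume h: "h \<in> Hom D (FO F X) (FO F Y)"
        note n = nat_isoD[OF GF, simplified]
        obtain \<psi> where p: "\<And>X. X \<in> Obj C \<Longrightarrow> mutually_inverse C (FO G (FO F X)) X (\<theta> X) (\<psi> X)"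
          using nat_iso_inverse[OF GF] by auto
        note pX = p[OF X] and pY = p[OF Y]
        note pXD = mutually_inverseD[OF pX] and pYD = mutually_inverseD[OF pY]
        define f where "f = \<theta> Y \<cdot>\<^bsub>C\<^esub> (FA G h \<cdot>\<^bsub>C\<^esub> \<psi> X)"
        have f: "f \<in> Hom C X Y" using h pXD pYD by (auto simp: f_def Hom_iff)
        have "\<theta> Y \<cdot>\<^bsub>C\<^esub> FA G (FA F f) = f \<cdot>\<^bsub>C\<^esub> \<theta> X" using n(4)[of f] f by (auto simp: Hom_iff)
        also have "\<dots> = \<theta> Y \<cdot>\<^bsub>C\<^esub> FA G h" using h pXD pYD by (simp add: f_def Hom_iff)
        finally have "FA G (FA F f) = FA G h"
          using F.Dom.iso_monic[OF pY] f h by (auto simp: Hom_iff)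
        then have "FA F f = h"
          using left_inverse_faithful[OF G' F' FG] F.Hom[OF f] h by blast
        then show "h \<in> FA F ` Hom C X Y" using f by blast
      qed
    qed
  qed
  ultimately show "cat_functor C D F \<and> fully_faithful C D F \<and> ess_surj C D F" using F by blast
next
  assume a: "cat_functor C D F \<and> fully_faithful C D F \<and> ess_surj C D F"
  have F': "ff_functor C D F" using a C D ff_functorI functor_betweenI by blast
  interpret F: ff_functor C D F by fact
  have idD: "functor_between D D id_funct" and idC: "functor_between C C id_funct"
    using C D functor_betweenI cat_functor_id by blast+
  have ess: "\<exists>X\<in>Obj C. isomorphic D (FO F X) (FO id_funct Y)" if "Y \<in> Obj D" for Y
    using a that by (auto simp: ess_surj_def)
  obtain H :: "('p, 'n, 'o, 'm) funct" and \<phi>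
    where H: "functor_between D C H" and FH: "nat_iso D D (comp_funct F H) id_funct \<phi>"
    by (rule lift_functor[OF F' idD ess])
  have "nat_iso C D (comp_funct F (comp_funct H F)) (comp_funct F id_funct) (\<lambda>X. \<phi> (FO F X))"
    using nat_iso_whisker_right[OF F.functor_between_axioms FH] by (simp add: nat_iso_def)
  then obtain \<epsilon> where "nat_iso C C (comp_funct H F) id_funct \<epsilon>"
    by (rule ff_reflect_nat_iso[OF F' functor_between_comp[OF F.functor_between_axioms H] idC])
  then show "equivalence C D F"
    using FH a functor_between.cat_functor[OF H] unfolding equivalence_def by metis
qed

lemma ess_surj_comp:
  assumes "functor_between D E G" "ess_surj C D F" "ess_surj D E G"
  shows "ess_surj C E (comp_funct G F)"
  unfolding ess_surj_def
proof
  interpret G: functor_between D E G by fact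
  fix Z assume "Z \<in> Obj E"
  then obtain Y where "Y \<in> Obj D" "isomorphic E (FO G Y) Z" using assms by (auto simp: ess_surj_def)
  moreover from \<open>Y \<in> Obj D\<close> obtain X where "X \<in> Obj C" "isomorphic D (FO F X) Y"
    using assms by (auto simp: ess_surj_def)
  ultimately show "\<exists>X \<in> Obj C. isomorphic E (FO (comp_funct G F) X) Z"
    using G.Cod.isomorphic_trans G.isomorphic by fastforce
qed

lemma equivalence_comp:
  assumes "category C" "category D" "category E" "equivalence C D F" "equivalence D E G"
  shows "equivalence C E (comp_funct G F)"
proof -
  have "ff_functor C D F" "ff_functor D E G" "ess_surj C D F" "ess_surj D E G"
    using assms by (auto simp: equivalence_iff intro!: ff_functorI functor_betweenI)
  then show ?thesis
    using assms fully_faithful_comp ess_surj_comp cat_functor_comp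
    by (metis equivalence_iff ff_functor_def)
qed

section \<open>Linear and triangulated categories\<close>

context linear_category
begin

lemma Hom_abelian_group: "X \<in> Obj C \<Longrightarrow> Y \<in> Obj C \<Longrightarrow> abelian_group (hom_module C X Y)"
  using Hom_module unfolding module_def by blast

lemma hom_module_simps [simp]:
  "carrier (hom_module C X Y) = Hom C X Y" "add (hom_module C X Y) = AddA C"
  "zero (hom_module C X Y) = ZeroA C X Y" "smult (hom_module C X Y) = SmulA C"
  by (simp_all add: hom_module_def)

lemma AddA_closed: "f \<in> Hom C X Y \<Longrightarrow> g \<in> Hom C X Y \<Longrightarrow> AddA C f g \<in> Hom C X Y"
  using abelian_group.axioms(1)[OF Hom_abelian_group] abelian_monoid.a_closed Hom_Obj
  by (metis hom_module_simps(1,2))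

lemma ZeroA_closed: "X \<in> Obj C \<Longrightarrow> Y \<in> Obj C \<Longrightarrow> ZeroA C X Y \<in> Hom C X Y"
  using abelian_group.axioms(1)[OF Hom_abelian_group] abelian_monoid.zero_closed
  by (metis hom_module_simps(1,3))

lemma ZeroA_Arr [simp]:
  assumes "X \<in> Obj C" "Y \<in> Obj C"
  shows "ZeroA C X Y \<in> Arr C" "Src C (ZeroA C X Y) = X" "Tgt C (ZeroA C X Y) = Y"
  using ZeroA_closed[OF assms] by (simp_all add: Hom_iff)

lemma SmulA_closed: "a \<in> carrier K \<Longrightarrow> f \<in> Hom C X Y \<Longrightarrow> SmulA C a f \<in> Hom C X Y"
  using module.smult_closed[OF Hom_module] Hom_Obj by (metis hom_module_simps(1,4))

lemma neg_closed: "f \<in> Hom C X Y \<Longrightarrow> (\<ominus>\<^bsub>hom_module C X Y\<^esub> f) \<in> Hom C X Y"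
  using abelian_group.a_inv_closed[OF Hom_abelian_group] Hom_Obj by (metis hom_module_simps(1))

lemma AddA_zero: "f \<in> Hom C X Y \<Longrightarrow> AddA C f (ZeroA C X Y) = f"
  using abelian_group.axioms(1)[OF Hom_abelian_group] abelian_monoid.r_zero Hom_Obj
  by (metis hom_module_simps(1,2,3))

lemma AddA_commute: "f \<in> Hom C X Y \<Longrightarrow> g \<in> Hom C X Y \<Longrightarrow> AddA C f g = AddA C g f"
  using abelian_group.axioms(1)[OF Hom_abelian_group] abelian_monoid.a_comm Hom_Obj
  by (metis hom_module_simps(1,2))

lemma AddA_assoc:
  "f \<in> Hom C X Y \<Longrightarrow> g \<in> Hom C X Y \<Longrightarrow> h \<in> Hom C X Y \<Longrightarrow>
   AddA C (AddA C f g) h = AddA C f (AddA C g h)"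
  using abelian_group.axioms(1)[OF Hom_abelian_group] abelian_monoid.a_assoc Hom_Obj
  by (metis hom_module_simps(1,2))

lemma AddA_neg: "f \<in> Hom C X Y \<Longrightarrow> AddA C f (\<ominus>\<^bsub>hom_module C X Y\<^esub> f) = ZeroA C X Y"
  using abelian_group.r_neg[OF Hom_abelian_group] Hom_Obj by (metis hom_module_simps(1,2,3))

lemma AddA_cancel:
  assumes "f \<in> Hom C X Y" "g \<in> Hom C X Y" "AddA C f g = g"
  shows "f = ZeroA C X Y"
proof -
  let ?n = "\<ominus>\<^bsub>hom_module C X Y\<^esub> g"
  have n: "?n \<in> Hom C X Y" using neg_closed assms(2) .
  have "f = AddA C f (AddA C g ?n)" using assms AddA_neg AddA_zero by simp
  also have "\<dots> = AddA C (AddA C f g) ?n" using AddA_assoc[OF assms(1,2) n] by simp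
  also have "\<dots> = ZeroA C X Y" using assms AddA_neg by simp
  finally show ?thesis .
qed

lemma Cmp_zero:
  assumes "g \<in> Hom C Y Z" "X \<in> Obj C"
  shows "g \<cdot> ZeroA C X Y = ZeroA C X Z"
proof -
  let ?z = "ZeroA C X Y"
  have z: "?z \<in> Hom C X Y" using ZeroA_closed assms Hom_Obj by blast
  have "AddA C (g \<cdot> ?z) (g \<cdot> ?z) = g \<cdot> ?z"
    using Cmp_add_right[OF z z assms(1)] AddA_zero[OF z] by simp
  then show ?thesis using AddA_cancel Cmp_closed[OF z assms(1)] by blast
qed

lemma zero_Cmp:
  assumes "f \<in> Hom C X Y" "Z \<in> Obj C"
  shows "ZeroA C Y Z \<cdot> f = ZeroA C X Z"
proof -
  let ?z = "ZeroA C Y Z"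
  have z: "?z \<in> Hom C Y Z" using ZeroA_closed assms Hom_Obj by blast
  have "AddA C (?z \<cdot> f) (?z \<cdot> f) = ?z \<cdot> f"
    using Cmp_add_left[OF assms(1) z z] AddA_zero[OF z] by simp
  then show ?thesis using AddA_cancel Cmp_closed[OF assms(1) z] by blast
qed

lemma zero_objectD:
  assumes "zero_object C Z"
  shows "Z \<in> Obj C" "f \<in> Hom C X Z \<Longrightarrow> f = ZeroA C X Z" "f \<in> Hom C Z X \<Longrightarrow> f = ZeroA C Z X"
  using assms ZeroA_closed Hom_Obj unfolding zero_object_def by metis+

lemma zero_object_iff: "zero_object C Z \<longleftrightarrow> Z \<in> Obj C \<and> Idn C Z = ZeroA C Z Z"
proof
  assume "zero_object C Z"
  then show "Z \<in> Obj C \<and> Idn C Z = ZeroA C Z Z" using zero_objectD Idn_closed by metis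
next
  assume Z: "Z \<in> Obj C \<and> Idn C Z = ZeroA C Z Z"
  have "f = ZeroA C X Z" if "f \<in> Hom C X Z" for f X
    using that Z Idn_Cmp zero_Cmp by metis
  moreover have "f = ZeroA C Z X" if "f \<in> Hom C Z X" for f X
    using that Z Cmp_Idn Cmp_zero by metis
  ultimately show "zero_object C Z" unfolding zero_object_def using Z ZeroA_closed by metis
qed

end

lemma additive_functor_zero:
  assumes "linear_category K C" "linear_category L D" "additive_functor C D F" "X \<in> Obj C" "Y \<in> Obj C"
  shows "FA F (ZeroA C X Y) = ZeroA D (FO F X) (FO F Y)"
proof -
  interpret C: linear_category K C by fact
  interpret D: linear_category L D by fact
  interpret F: functor_between C D F
    using assms(3) by unfold_locales (simp add: additive_functor_def)
  let ?z = "ZeroA C X Y"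
  have z: "?z \<in> Hom C X Y" using assms C.ZeroA_closed by blast
  have "AddA D (FA F ?z) (FA F ?z) = FA F ?z"
    using assms z C.AddA_zero[OF z] unfolding additive_functor_def by metis
  then show ?thesis using D.AddA_cancel F.Hom[OF z] by blast
qed

lemma additive_functor_zero_object:
  assumes "linear_category K C" "linear_category L D" "additive_functor C D F" "zero_object C Z"
  shows "zero_object D (FO F Z)"
proof -
  interpret C: linear_category K C by fact
  interpret D: linear_category L D by fact
  interpret F: functor_between C D F
    using assms(3) by unfold_locales (simp add: additive_functor_def)
  show ?thesis
    using assms(4) additive_functor_zero[OF assms(1-3), of Z Z] F.Idn[of Z] F.Obj[of Z]
    by (simp add: C.zero_object_iff D.zero_object_iff)
qed

text \<open>
  The part of the structure that a category needs in order to be the domain or codomain of an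
  exact functor.  Unlike the axioms of a triangulated category it passes to full triangulated
  subcategories for trivial reasons.
\<close>

locale linear_shift_category = category C
  for K :: "('k, 'x) ring_scheme" and C :: "('o, 'm, 'k, 'z) tricat_scheme" (structure) +
  assumes Shift_functor: "cat_functor C C (Shift C)"
    and AddA_Hom: "f \<in> Hom C X Y \<Longrightarrow> g \<in> Hom C X Y \<Longrightarrow> AddA C f g \<in> Hom C X Y"
    and SmulA_Hom: "a \<in> carrier K \<Longrightarrow> f \<in> Hom C X Y \<Longrightarrow> SmulA C a f \<in> Hom C X Y"

sublocale linear_shift_category \<subseteq> Sh: functor_between C C "Shift C"
  using Shift_functor by unfold_locales

lemma dist_triangleD:
  assumes "dist_triangle C X Y Z u v w"
  shows "u \<in> Arr C" "Src C u = X" "Tgt C u = Y" "v \<in> Arr C" "Src C v = Y" "Tgt C v = Z"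
    "w \<in> Arr C" "Src C w = Z" "Tgt C w = ShO C X"
  using assms by (auto simp: dist_triangle_def triangle_def Hom_iff)

sublocale linear_triangulated_category \<subseteq> linear_shift_category K C
  using Shift_linear AddA_closed SmulA_closed
  by unfold_locales (auto simp: linear_functor_def additive_functor_def)

sublocale linear_triangulated_category \<subseteq> Sh: ff_functor C C "Shift C"
  using Shift_equivalence equivalence_iff[OF category_axioms category_axioms]
  by unfold_locales blast

context linear_triangulated_category
begin

lemma Shift_ess_surj: "X \<in> Obj C \<Longrightarrow> \<exists>Y \<in> Obj C. isomorphic C (ShO C Y) X"
  using Shift_equivalence equivalence_iff[OF category_axioms category_axioms]
  unfolding ess_surj_def by blast

lemma Shift_additive: "additive_functor C C (Shift C)"
  using Shift_linear by (simp add: linear_functor_def)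

lemma Shift_zero_object: "zero_object C Z \<Longrightarrow> zero_object C (ShO C Z)"
  using additive_functor_zero_object[OF linear_category_axioms linear_category_axioms Shift_additive] .

lemma dist_triangle_Obj: "dist_triangle C X Y Z u v w \<Longrightarrow> X \<in> Obj C \<and> Y \<in> Obj C \<and> Z \<in> Obj C"
  using dist_triangleD Src_Obj Tgt_Obj by metis

lemma rotate:
  "dist_triangle C X Y Z u v w \<Longrightarrow>
   dist_triangle C Y Z (ShO C X) v w (\<ominus>\<^bsub>hom_module C (ShO C X) (ShO C Y)\<^esub> ShA C u)"
  using TR2 by (auto simp: dist_triangle_def)

text \<open>
  The third arrow of a distinguished triangle is a weak cokernel of the second one: compare the
  rotated triangle with \<open>0 \<rightarrow> W \<rightarrow> W \<rightarrow> 0[1]\<close>.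
\<close>

lemma weak_cokernel:
  assumes d: "dist_triangle C X Y Z u v w" and g: "g \<in> Hom C Z W" and gv: "g \<cdot> v = ZeroA C Y W"
  obtains h where "h \<in> Hom C (ShO C X) W" "g = h \<cdot> w"
proof -
  have O: "X \<in> Obj C" "Y \<in> Obj C" "Z \<in> Obj C" "W \<in> Obj C"
    using dist_triangle_Obj[OF d] Hom_Obj[OF g] by auto
  obtain O' where O': "zero_object C O'" using ex_zero_object by blast
  note z = zero_objectD[OF O'] and z1 = zero_objectD[OF Shift_zero_object[OF O']]
  let ?s = "ZeroA C O' W" and ?t = "ZeroA C W (ShO C O')"
  have s: "?s \<in> Hom C O' W" and t: "?t \<in> Hom C W (ShO C O')"
    using ZeroA_closed z(1) z1(1) O by auto
  have tri: "triangle C O' W W ?s (Idn C W) ?t"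
    using s t Idn_closed O by (simp add: triangle_def)
  have "(\<ominus>\<^bsub>hom_module C (ShO C O') (ShO C W)\<^esub> ShA C ?s) = ZeroA C (ShO C O') (ShO C W)"
    using z1(3) neg_closed Sh.Hom[OF s] by blast
  then have "dist_triangle C O' W W ?s (Idn C W) ?t"
    using TR2[OF tri] TR1_Idn[OF O(4) Shift_zero_object[OF O']] by simp
  moreover have "g \<cdot> v = ?s \<cdot> ZeroA C Y O'"
    using gv Cmp_zero[OF s O(2)] by simp
  ultimately obtain h where "h \<in> Hom C (ShO C X) W" "h \<cdot> w = Idn C W \<cdot> g"
    using TR3[OF rotate[OF d] _ ZeroA_closed[OF O(2) z(1)] g] by blast
  then show thesis using that Idn_Cmp[OF g] by metis
qed

text \<open>
  An endomorphism \<open>e\<close> of the third object that is compatible with the identities of the other two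
  is unipotent: \<open>g = e - 1\<close> factors through \<open>w\<close> and is killed by it, so \<open>g g = 0\<close> and
  \<open>1 - g\<close> is inverse to \<open>e\<close>.
\<close>

lemma unipotent_is_iso:
  assumes d: "dist_triangle C X Y Z u v w" and e: "e \<in> Hom C Z Z"
    and ev: "e \<cdot> v = v" and we: "w \<cdot> e = w"
  shows "is_iso C e"
proof -
  have O: "X \<in> Obj C" "Y \<in> Obj C" "Z \<in> Obj C" using dist_triangle_Obj[OF d] by auto
  have uvw: "v \<in> Hom C Y Z" "w \<in> Hom C Z (ShO C X)"
    using d by (auto simp: dist_triangle_def triangle_def)
  let ?I = "Idn C Z" and ?O = "ZeroA C Z Z"
  have I: "?I \<in> Hom C Z Z" using Idn_closed O by simp
  note neg = neg_closed AddA_neg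
  define g where "g = AddA C e (\<ominus>\<^bsub>hom_module C Z Z\<^esub> ?I)"
  have g: "g \<in> Hom C Z Z" using AddA_closed e I neg by (simp add: g_def)
  have gI: "AddA C g ?I = e"
    using AddA_assoc[OF e neg(1)[OF I] I] AddA_commute[OF neg(1)[OF I] I] neg(2)[OF I] AddA_zero[OF e]
    by (simp add: g_def)
  define n where "n = (\<ominus>\<^bsub>hom_module C Z Z\<^esub> g)"
  have n: "n \<in> Hom C Z Z" "AddA C g n = ?O" using neg g by (auto simp: n_def)
  have "AddA C (g \<cdot> v) v = v"
    using Cmp_add_left[OF uvw(1) g I] gI ev Idn_Cmp[OF uvw(1)] by simp
  then have "g \<cdot> v = ZeroA C Y Z" using AddA_cancel Cmp_closed[OF uvw(1) g] uvw(1) by blast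
  then obtain h where h: "h \<in> Hom C (ShO C X) Z" "g = h \<cdot> w" using weak_cokernel[OF d g] by blast
  have "AddA C (w \<cdot> g) w = w"
    using Cmp_add_right[OF g I uvw(2)] gI we Cmp_Idn[OF uvw(2)] by simp
  then have wg: "w \<cdot> g = ZeroA C Z (ShO C X)" using AddA_cancel Cmp_closed[OF g uvw(2)] uvw(2) by blast
  have gg: "g \<cdot> g = ?O"
    using Cmp_assoc[OF g uvw(2) h(1)] wg h Cmp_zero[OF h(1) O(3)] by simp
  have "AddA C (g \<cdot> n) (g \<cdot> g) = g \<cdot> g"
    using Cmp_add_right[OF g n(1) g] n(2) Cmp_zero[OF g O(3)] gg
      AddA_commute[OF Cmp_closed[OF g g] Cmp_closed[OF n(1) g]] by simp
  then have gn: "g \<cdot> n = ?O" using AddA_cancel Cmp_closed g n by blast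
  have "AddA C (n \<cdot> g) (g \<cdot> g) = g \<cdot> g"
    using Cmp_add_left[OF g g n(1)] n(2) zero_Cmp[OF g O(3)] gg
      AddA_commute[OF Cmp_closed[OF g g] Cmp_closed[OF g n(1)]] by simp
  then have ng: "n \<cdot> g = ?O" using AddA_cancel Cmp_closed g n by blast
  define i where "i = AddA C n ?I"
  have i: "i \<in> Hom C Z Z" using AddA_closed n I by (simp add: i_def)
  have gni: "AddA C g i = ?I"
    using AddA_assoc[OF g n(1) I] n(2) AddA_commute[OF ZeroA_closed[OF O(3) O(3)] I] AddA_zero[OF I]
    by (simp add: i_def)
  have gi: "g \<cdot> i = g"
    using Cmp_add_right[OF n(1) I g] gn Cmp_Idn[OF g] AddA_commute[OF ZeroA_closed[OF O(3) O(3)] g]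
      AddA_zero[OF g] by (simp add: i_def)
  have ig: "i \<cdot> g = g"
    using Cmp_add_left[OF g n(1) I] ng Idn_Cmp[OF g] AddA_commute[OF ZeroA_closed[OF O(3) O(3)] g]
      AddA_zero[OF g] by (simp add: i_def)
  have "e \<cdot> i = ?I"
    using Cmp_add_left[OF i g I] gI gi Idn_Cmp[OF i] gni by simp
  moreover have "i \<cdot> e = ?I"
    using Cmp_add_right[OF g I i] gI ig Cmp_Idn[OF i] gni by simp
  ultimately show ?thesis using is_iso_if_left_right[OF e i i] by blast
qed

text \<open>The five lemma for triangles, obtained by comparing \<open>c\<close> with a map in the other direction.\<close>

lemma triangle_five:
  assumes d: "dist_triangle C X Y Z u v w" and d': "dist_triangle C X' Y' Z' u' v' w'"
    and a: "mutually_inverse C X X' a a'" and b: "mutually_inverse C Y Y' b b'"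
    and c: "c \<in> Hom C Z Z'"
    and sq: "b \<cdot> u = u' \<cdot> a" "c \<cdot> v = v' \<cdot> b" "ShA C a \<cdot> w = w' \<cdot> c"
  shows "is_iso C c"
proof -
  note D = dist_triangleD[OF d] and D' = dist_triangleD[OF d']
  note aD = mutually_inverseD[OF a] and bD = mutually_inverseD[OF b]
  note sa = Sh.mutually_inverse[OF a]
  note saD = mutually_inverseD[OF sa]
  have cD: "c \<in> Arr C" "Src C c = Z" "Tgt C c = Z'" using c by (auto simp: Hom_iff)
  have "u \<cdot> a' = b' \<cdot> ((b \<cdot> u) \<cdot> a')"
    using D aD bD inverse_cancel[OF b] by simp
  also have "\<dots> = b' \<cdot> ((u' \<cdot> a) \<cdot> a')" using sq by simp
  also have "\<dots> = b' \<cdot> u'" using D' aD bD by simp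
  finally have "b' \<cdot> u' = u \<cdot> a'" by simp
  then obtain h where h: "h \<in> Hom C Z' Z" "h \<cdot> v' = v \<cdot> b'" "ShA C a' \<cdot> w' = w \<cdot> h"
    using TR3[OF d' d, of a' b'] aD bD by (auto simp: Hom_iff)
  have hD: "h \<in> Arr C" "Src C h = Z'" "Tgt C h = Z" using h by (auto simp: Hom_iff)
  have "is_iso C (h \<cdot> c)"
  proof (rule unipotent_is_iso[OF d])
    show "h \<cdot> c \<in> Hom C Z Z" using Cmp_closed c h by blast
    have "(h \<cdot> c) \<cdot> v = (h \<cdot> v') \<cdot> b" using sq(2) hD cD D D' bD by simp
    then show "(h \<cdot> c) \<cdot> v = v" using h(2) D bD by simp
    have "w \<cdot> (h \<cdot> c) = (w \<cdot> h) \<cdot> c" using hD cD D by simp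
    also have "\<dots> = ShA C a' \<cdot> (w' \<cdot> c)" using h(3)[symmetric] D' cD saD by simp
    also have "\<dots> = w" using sq(3)[symmetric] D inverse_cancel[OF sa] by simp
    finally show "w \<cdot> (h \<cdot> c) = w" .
  qed
  then obtain l where l: "mutually_inverse C Z Z (h \<cdot> c) l"
    using is_iso_iff[of "h \<cdot> c" C Z Z] Cmp_closed[OF c h(1)] by blast
  have "is_iso C (c \<cdot> h)"
  proof (rule unipotent_is_iso[OF d'])
    show "c \<cdot> h \<in> Hom C Z' Z'" using Cmp_closed c h by blast
    have "(c \<cdot> h) \<cdot> v' = (c \<cdot> v) \<cdot> b'" using h(2) hD cD D D' bD by simp
    then show "(c \<cdot> h) \<cdot> v' = v'" using sq(2) D' bD by simp
    have "w' \<cdot> (c \<cdot> h) = (w' \<cdot> c) \<cdot> h" using hD cD D' by simp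
    also have "\<dots> = ShA C a \<cdot> (w \<cdot> h)" using sq(3)[symmetric] D hD saD by simp
    also have "\<dots> = w'" using h(3)[symmetric] D' inverse_cancel[OF sa] by simp
    finally show "w' \<cdot> (c \<cdot> h) = w'" .
  qed
  then obtain r where r: "mutually_inverse C Z' Z' (c \<cdot> h) r"
    using is_iso_iff[of "c \<cdot> h" C Z' Z'] Cmp_closed[OF h(1) c] by blast
  note lD = mutually_inverseD[OF l] and rD = mutually_inverseD[OF r]
  show ?thesis
  proof (rule is_iso_if_left_right[OF c])
    show "l \<cdot> h \<in> Hom C Z' Z" "h \<cdot> r \<in> Hom C Z' Z" using lD(4-6) rD(4-6) hD by (auto simp: Hom_iff)
    show "(l \<cdot> h) \<cdot> c = Idn C Z" using lD(4-7) hD cD by simp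
    show "c \<cdot> (h \<cdot> r) = Idn C Z'" using rD(4-6,8) hD cD by simp
  qed
qed

lemma zero_object_in_subcat:
  assumes B: "triangulated_subcat C B" and Z: "zero_object C Z"
  shows "Z \<in> B"
proof -
  obtain X where X: "X \<in> B" "X \<in> Obj C" using B by (auto simp: triangulated_subcat_def)
  have "ShO C X \<in> B" using B X by (auto simp: triangulated_subcat_def)
  then show ?thesis
    using rotate[OF TR1_Idn[OF X(2) Z]] B X unfolding triangulated_subcat_def by blast
qed

text \<open>
  A triangulated subcategory is closed under isomorphism: \<open>X \<cong> Y\<close> makes \<open>Y\<close> an extension of a zero
  object by \<open>X\<close>.
\<close>

lemma subcat_iso_closed:
  assumes B: "triangulated_subcat C B" and X: "X \<in> B" and iso: "isomorphic C X Y"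
  shows "Y \<in> B"
proof -
  obtain f where f: "f \<in> Hom C X Y" "is_iso C f" using iso by (auto simp: isomorphic_def)
  have O: "X \<in> Obj C" "Y \<in> Obj C" using Hom_Obj[OF f(1)] by auto
  obtain Z where Z: "zero_object C Z" using ex_zero_object by blast
  have ZO: "Z \<in> Obj C" using zero_objectD[OF Z] by blast
  have I: "is_iso C (Idn C X)" "is_iso C (Idn C Z)"
    using mutually_inverse_imp_is_iso mutually_inverse_refl O ZO by metis+
  have "dist_triangle C X Y Z f (ZeroA C Y Z) (ZeroA C Z (ShO C X))"
  proof (rule Dist_iso[OF TR1_Idn[OF O(1) Z]])
    show "triangle C X Y Z f (ZeroA C Y Z) (ZeroA C Z (ShO C X))"
      using f ZeroA_closed O ZO Sh.Obj by (simp add: triangle_def)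
    show "Idn C X \<in> Hom C X X" "f \<in> Hom C X Y" "Idn C Z \<in> Hom C Z Z"
      using Idn_closed O ZO f by auto
    show "f \<cdot> Idn C X = f \<cdot> Idn C X" by simp
    show "Idn C Z \<cdot> ZeroA C X Z = ZeroA C Y Z \<cdot> f"
      using zero_Cmp[OF f(1) ZO] O ZO by simp
    show "ShA C (Idn C X) \<cdot> ZeroA C Z (ShO C X) = ZeroA C Z (ShO C X) \<cdot> Idn C Z"
      using O ZO by simp
  qed (use I f in auto)
  then show ?thesis
    using B X zero_object_in_subcat[OF B Z] unfolding triangulated_subcat_def by blast
qed

lemma subcat_cone_closed:
  assumes "triangulated_subcat C B" "dist_triangle C X Y Z u v w" "X \<in> B" "Y \<in> B"
  shows "Z \<in> B"
  using rotate[OF assms(2)] assms unfolding triangulated_subcat_def by blast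

end

lemma triangulated_subcat_Obj: "triangulated_subcat C B \<Longrightarrow> X \<in> B \<Longrightarrow> X \<in> Obj C"
  by (auto simp: triangulated_subcat_def)

lemma triangulated_subcat_whole:
  assumes "linear_triangulated_category K C"
  shows "triangulated_subcat C (Obj C)"
proof -
  interpret linear_triangulated_category K C by fact
  show ?thesis
    using ex_zero_object zero_objectD dist_triangle_Obj unfolding triangulated_subcat_def
    by (auto 0 3)
qed

lemma full_subcat_simps [simp]:
  "Obj (full_subcat C B) = B" "Src (full_subcat C B) = Src C" "Tgt (full_subcat C B) = Tgt C"
  "Idn (full_subcat C B) = Idn C" "Cmp (full_subcat C B) = Cmp C" "ZeroA (full_subcat C B) = ZeroA C"
  "AddA (full_subcat C B) = AddA C" "SmulA (full_subcat C B) = SmulA C"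
  "Shift (full_subcat C B) = Shift C"
  "f \<in> Arr (full_subcat C B) \<longleftrightarrow> f \<in> Arr C \<and> Src C f \<in> B \<and> Tgt C f \<in> B"
  by (simp_all add: full_subcat_def)

lemma Hom_full_subcat [simp]: "X \<in> B \<Longrightarrow> Y \<in> B \<Longrightarrow> Hom (full_subcat C B) X Y = Hom C X Y"
  by (auto simp: Hom_iff)

lemma mutually_inverse_full_subcat [simp]:
  "X \<in> B \<Longrightarrow> Y \<in> B \<Longrightarrow> mutually_inverse (full_subcat C B) X Y f g \<longleftrightarrow> mutually_inverse C X Y f g"
  by (simp add: mutually_inverse_def)

lemma isomorphic_full_subcat [simp]:
  "X \<in> B \<Longrightarrow> Y \<in> B \<Longrightarrow> isomorphic (full_subcat C B) X Y \<longleftrightarrow> isomorphic C X Y"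
  by (simp add: isomorphic_iff)

lemma dist_triangle_full_subcat:
  "dist_triangle (full_subcat C B) X Y Z u v w \<longleftrightarrow>
     dist_triangle C X Y Z u v w \<and> X \<in> B \<and> Y \<in> B \<and> Z \<in> B \<and> ShO C X \<in> B"
  by (auto simp: dist_triangle_def triangle_def Hom_iff full_subcat_def)

lemma category_full_subcat:
  assumes "category C" "B \<subseteq> Obj C"
  shows "category (full_subcat C B)"
proof -
  interpret category C by fact
  show ?thesis
    by unfold_locales (use assms(2) in \<open>auto simp: Hom_iff subset_iff\<close>)
qed

lemma linear_shift_category_full_subcat:
  assumes "linear_shift_category K C" "triangulated_subcat C B"
  shows "linear_shift_category K (full_subcat C B)"
proof -
  interpret linear_shift_category K C by fact
  have B: "B \<subseteq> Obj C" and sh: "\<And>X. X \<in> B \<Longrightarrow> ShO C X \<in> B"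
    using assms(2) by (auto simp: triangulated_subcat_def)
  interpret full: category "full_subcat C B" using category_full_subcat[OF category_axioms B] .
  show ?thesis
  proof
    show "cat_functor (full_subcat C B) (full_subcat C B) (Shift (full_subcat C B))"
      using B sh by (auto simp: cat_functor_def Hom_iff subset_iff)
    show "AddA (full_subcat C B) f g \<in> Hom (full_subcat C B) X Y"
      if "f \<in> Hom (full_subcat C B) X Y" "g \<in> Hom (full_subcat C B) X Y" for f g X Y
      using AddA_Hom[of f X Y g] that by (auto simp: Hom_iff)
    show "SmulA (full_subcat C B) a f \<in> Hom (full_subcat C B) X Y"
      if "a \<in> carrier K" "f \<in> Hom (full_subcat C B) X Y" for a f X Y
      using SmulA_Hom[of a f X Y] that by (auto simp: Hom_iff)
  qed
qed

section \<open>Exact functors and graded natural isomorphisms\<close>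

text \<open>
  An exact functor between categories with a shift.  Linearity is a separate hypothesis, since
  auto-equivalences are only required to be exact; \<open>K\<close> enters only through the
  linear structure of the two categories.
\<close>

locale exact_between = Dom: linear_shift_category K C + Cod: linear_shift_category K D
  for K :: "('k, 'x) ring_scheme" and C :: "('o, 'm, 'k, 'y) tricat_scheme"
    and D :: "('p, 'n, 'k, 'z) tricat_scheme" and F :: "('o, 'm, 'p, 'n) gfunct" +
  assumes exact: "exact_functor C D F"

sublocale exact_between \<subseteq> functor_between C D F
  using exact by unfold_locales (simp add: exact_functor_def additive_functor_def)

lemma exact_betweenI:
  "linear_shift_category K C \<Longrightarrow> linear_shift_category K D \<Longrightarrow> exact_functor C D F \<Longrightarrow>
   exact_between K C D F"
  by (simp add: exact_between_def exact_between_axioms_def)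

context exact_between
begin

lemma additive: "additive_functor C D F"
  using exact by (simp add: exact_functor_def)

lemma nat_iso_Eta: "nat_iso C D (comp_funct F (Shift C)) (comp_funct (Shift D) F) (Eta F)"
  using exact by (simp add: exact_functor_def)

lemma dist:
  "dist_triangle C X Y Z u v w \<Longrightarrow>
   dist_triangle D (FO F X) (FO F Y) (FO F Z) (FA F u) (FA F v) (Eta F X \<cdot>\<^bsub>D\<^esub> FA F w)"
  using exact by (simp add: exact_functor_def)

lemma Eta_Arr [simp]:
  assumes "X \<in> Obj C"
  shows "Eta F X \<in> Arr D" "Src D (Eta F X) = FO F (ShO C X)" "Tgt D (Eta F X) = ShO D (FO F X)"
  using nat_isoD[OF nat_iso_Eta] assms by auto

lemma Eta_natural:
  "f \<in> Arr C \<Longrightarrow> Eta F (Tgt C f) \<cdot>\<^bsub>D\<^esub> FA F (ShA C f) = ShA D (FA F f) \<cdot>\<^bsub>D\<^esub> Eta F (Src C f)"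
  using nat_isoD(4)[OF nat_iso_Eta] by simp

lemma Eta_inverse:
  assumes "X \<in> Obj C"
  obtains h where "mutually_inverse D (FO F (ShO C X)) (ShO D (FO F X)) (Eta F X) h"
  using nat_iso_inverse[OF nat_iso_Eta] assms by (metis comp_funct_simps(1))

lemma Shift_isomorphic: "X \<in> Obj C \<Longrightarrow> isomorphic D (FO F (ShO C X)) (ShO D (FO F X))"
  using Eta_inverse unfolding isomorphic_iff by metis

end

lemma comp_gfunct_simps [simp]:
  "FO (comp_gfunct E G F) X = FO G (FO F X)" "FA (comp_gfunct E G F) f = FA G (FA F f)"
  "Eta (comp_gfunct E G F) X = Eta G (FO F X) \<cdot>\<^bsub>E\<^esub> FA G (Eta F X)"
  by (simp_all add: comp_gfunct_def)

lemma id_gfunct_simps [simp]: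
  "FO (id_gfunct C) X = X" "FA (id_gfunct C) f = f" "Eta (id_gfunct C) X = Idn C (ShO C X)"
  by (simp_all add: id_gfunct_def)

lemma additive_functor_comp:
  assumes "additive_functor C D F" "additive_functor D E G" "functor_between C D F" "functor_between D E G"
  shows "additive_functor C E (comp_gfunct E G F)"
proof -
  interpret F: functor_between C D F by fact
  have "cat_functor C E (comp_gfunct E G F)"
    using cat_functor_comp[OF assms(3,4)] by (simp add: cat_functor_def)
  moreover have "FA G (FA F (AddA C f g)) = AddA E (FA G (FA F f)) (FA G (FA F g))"
    if "X \<in> Obj C" "Y \<in> Obj C" "f \<in> Hom C X Y" "g \<in> Hom C X Y" for X Y f g
  proof -
    have "FA F (AddA C f g) = AddA D (FA F f) (FA F g)"
      using assms(1) that by (auto simp: additive_functor_def)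
    then show ?thesis
      using assms(2) F.Hom[OF that(3)] F.Hom[OF that(4)] F.Obj that(1,2)
      unfolding additive_functor_def by metis
  qed
  ultimately show ?thesis by (simp add: additive_functor_def)
qed

lemma linear_functor_comp:
  assumes "linear_functor K C D F" "linear_functor K D E G" "functor_between C D F" "functor_between D E G"
  shows "linear_functor K C E (comp_gfunct E G F)"
proof -
  interpret F: functor_between C D F by fact
  show ?thesis
    using assms additive_functor_comp[of C D F E G] by (simp add: linear_functor_def)
qed

lemma exact_between_comp:
  assumes "exact_between K C D F" "exact_between K D E G"
  shows "exact_between K C E (comp_gfunct E G F)"
proof -
  interpret F: exact_between K C D F by fact
  interpret G: exact_between K D E G by fact
  let ?GF = "comp_gfunct E G F"
  note FG = F.functor_between_axioms G.functor_between_axioms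
  note fc = functor_between_comp
  note ShC = F.Dom.Sh.functor_between_axioms and ShD = F.Cod.Sh.functor_between_axioms
    and ShE = G.Cod.Sh.functor_between_axioms
  have 1: "nat_iso C E (comp_funct G (comp_funct F (Shift C))) (comp_funct G (comp_funct (Shift D) F))
      (\<lambda>X. FA G (Eta F X))"
    by (rule nat_iso_whisker_left[OF fc[OF ShC FG(1)] fc[OF FG(1) ShD] FG(2) F.nat_iso_Eta])
  have 2: "nat_iso C E (comp_funct G (comp_funct (Shift D) F)) (comp_funct (Shift E) (comp_funct G F))
      (\<lambda>X. Eta G (FO F X))"
    using nat_iso_whisker_right[OF FG(1) G.nat_iso_Eta] by (simp add: comp_funct_assoc)
  have "nat_iso C E (comp_funct G (comp_funct F (Shift C))) (comp_funct (Shift E) (comp_funct G F))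
      (\<lambda>X. Eta G (FO F X) \<cdot>\<^bsub>E\<^esub> FA G (Eta F X))"
    by (rule nat_iso_trans[OF fc[OF fc[OF ShC FG(1)] FG(2)] fc[OF fc[OF FG(1) ShD] FG(2)]
      fc[OF fc[OF FG] ShE] 1 2])
  then have eta: "nat_iso C E (comp_funct ?GF (Shift C)) (comp_funct (Shift E) ?GF) (Eta ?GF)"
    by (simp add: nat_iso_def)
  have "dist_triangle E (FO ?GF X) (FO ?GF Y) (FO ?GF Z) (FA ?GF u) (FA ?GF v) (Eta ?GF X \<cdot>\<^bsub>E\<^esub> FA ?GF w)"
    if d: "dist_triangle C X Y Z u v w" for X Y Z u v w
  proof -
    note D = dist_triangleD[OF d]
    have "X \<in> Obj C" using D F.Dom.Src_Obj by blast
    then show ?thesis using G.dist[OF F.dist[OF d]] D by simp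
  qed
  then have "exact_functor C E ?GF"
    using eta additive_functor_comp[OF F.additive G.additive FG] by (simp add: exact_functor_def)
  then show ?thesis
    using exact_betweenI[OF F.Dom.linear_shift_category_axioms G.Cod.linear_shift_category_axioms] by blast
qed

text \<open>The inclusion of a full triangulated subcategory is the restriction of the identity functor.\<close>

lemma exact_between_inclusion:
  assumes "linear_shift_category K C" "triangulated_subcat C B"
  shows "exact_between K (full_subcat C B) C (id_gfunct C)"
proof -
  interpret linear_shift_category K C by fact
  have B: "B \<subseteq> Obj C" and sh: "\<And>X. X \<in> B \<Longrightarrow> ShO C X \<in> B"
    using assms(2) by (auto simp: triangulated_subcat_def)
  interpret full: linear_shift_category K "full_subcat C B"
    using linear_shift_category_full_subcat[OF assms] .
  have "nat_iso (full_subcat C B) C (comp_funct (id_gfunct C) (Shift (full_subcat C B)))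
      (comp_funct (Shift C) (id_gfunct C)) (Eta (id_gfunct C))"
    by (rule nat_isoI[of _ _ _ _ _ "\<lambda>X. Idn C (ShO C X)"])
      (use B mutually_inverse_refl Sh.Obj in \<open>auto simp: subset_iff\<close>)
  moreover have "additive_functor (full_subcat C B) C (id_gfunct C)"
    using B by (auto simp: additive_functor_def cat_functor_def Hom_iff)
  moreover have "dist_triangle C X Y Z u v (Idn C (ShO C X) \<cdot>\<^bsub>C\<^esub> w)"
    if "dist_triangle (full_subcat C B) X Y Z u v w" for X Y Z u v w
    using that dist_triangleD[of C X Y Z u v w] by (simp add: dist_triangle_full_subcat)
  ultimately have "exact_functor (full_subcat C B) C (id_gfunct C)"
    by (simp add: exact_functor_def)
  then show ?thesis
    using exact_betweenI full.linear_shift_category_axioms linear_shift_category_axioms by blast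
qed

lemma linear_functor_inclusion:
  assumes "exact_between K (full_subcat C B) C (id_gfunct C)"
  shows "linear_functor K (full_subcat C B) C (id_gfunct C)"
  using exact_between.additive[OF assms] by (simp add: linear_functor_def)

text \<open>An exact functor with values in a triangulated subcategory is exact as a functor to it.\<close>

lemma exact_between_corestrict:
  assumes H: "exact_between K S C H" and B: "triangulated_subcat C B"
    and HB: "\<And>X. X \<in> Obj S \<Longrightarrow> FO H X \<in> B"
  shows "exact_between K S (full_subcat C B) H"
proof -
  interpret H: exact_between K S C H by fact
  have BO: "B \<subseteq> Obj C" and sh: "\<And>X. X \<in> B \<Longrightarrow> ShO C X \<in> B"
    using B by (auto simp: triangulated_subcat_def)
  interpret full: linear_shift_category K "full_subcat C B"
    using linear_shift_category_full_subcat[OF H.Cod.linear_shift_category_axioms B] .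
  obtain h where h: "\<And>X. X \<in> Obj S \<Longrightarrow> mutually_inverse C (FO H (ShO S X)) (ShO C (FO H X)) (Eta H X) (h X)"
    using nat_iso_inverse[OF H.nat_iso_Eta] by auto
  have "nat_iso S (full_subcat C B) (comp_funct H (Shift S)) (comp_funct (Shift (full_subcat C B)) H) (Eta H)"
    by (rule nat_isoI[of _ _ _ _ _ h]) (use h HB sh H.Eta_natural in auto)
  moreover have "additive_functor S (full_subcat C B) H"
    using H.additive HB by (auto simp: additive_functor_def cat_functor_def Hom_iff)
  moreover have "dist_triangle (full_subcat C B) (FO H X) (FO H Y) (FO H Z) (FA H u) (FA H v) (Eta H X \<cdot>\<^bsub>C\<^esub> FA H w)"
    if d: "dist_triangle S X Y Z u v w" for X Y Z u v w
    using dist_triangleD[OF d] H.dist[OF d] HB sh H.Dom.Src_Obj H.Dom.Tgt_Obj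
    unfolding dist_triangle_full_subcat by metis
  ultimately have "exact_functor S (full_subcat C B) H" by (simp add: exact_functor_def)
  then show ?thesis
    using exact_betweenI full.linear_shift_category_axioms H.Dom.linear_shift_category_axioms by blast
qed

lemma graded_iso_nat_iso: "graded_iso C D F G \<Longrightarrow> \<exists>\<theta>. nat_iso C D F G \<theta>"
  by (auto simp: graded_iso_def)

lemma graded_iso_eqI:
  assumes "exact_between K C D F"
    and "\<And>X. X \<in> Obj C \<Longrightarrow> FO F X = FO G X" "\<And>f. f \<in> Arr C \<Longrightarrow> FA F f = FA G f"
    and "\<And>X. X \<in> Obj C \<Longrightarrow> Eta F X = Eta G X"
  shows "graded_iso C D F G"
proof -
  interpret F: exact_between K C D F by fact
  have "nat_iso C D F G (\<lambda>X. Idn D (FO F X))"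
    using nat_iso_refl[OF F.functor_between_axioms] assms by (simp add: nat_iso_def)
  moreover have "Eta G X \<cdot>\<^bsub>D\<^esub> Idn D (FO F (ShO C X)) = ShA D (Idn D (FO F X)) \<cdot>\<^bsub>D\<^esub> Eta F X"
    if "X \<in> Obj C" for X using that assms(4)[OF that, symmetric] by simp
  ultimately show ?thesis unfolding graded_iso_def by blast
qed

lemma graded_iso_refl: "exact_between K C D F \<Longrightarrow> graded_iso C D F F"
  by (rule graded_iso_eqI) auto

lemma graded_iso_sym:
  assumes "exact_between K C D F" "exact_between K C D G" "graded_iso C D F G"
  shows "graded_iso C D G F"
proof -
  interpret F: exact_between K C D F by fact
  interpret G: exact_between K C D G by fact
  obtain \<theta> where n: "nat_iso C D F G \<theta>"
    and e: "\<And>X. X \<in> Obj C \<Longrightarrow> Eta G X \<cdot>\<^bsub>D\<^esub> \<theta> (ShO C X) = ShA D (\<theta> X) \<cdot>\<^bsub>D\<^esub> Eta F X"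
    using assms by (auto simp: graded_iso_def)
  obtain \<psi> where p: "\<And>X. X \<in> Obj C \<Longrightarrow> mutually_inverse D (FO F X) (FO G X) (\<theta> X) (\<psi> X)"
    using nat_iso_inverse[OF n] by auto
  have n': "nat_iso C D G F \<psi>"
    using nat_iso_sym[OF F.functor_between_axioms G.functor_between_axioms n p] .
  have "Eta F X \<cdot>\<^bsub>D\<^esub> \<psi> (ShO C X) = ShA D (\<psi> X) \<cdot>\<^bsub>D\<^esub> Eta G X" if X: "X \<in> Obj C" for X
  proof -
    have X1: "ShO C X \<in> Obj C" using X by simp
    note pD = mutually_inverseD[OF p[OF X]] and p1D = mutually_inverseD[OF p[OF X1]]
    note sp = F.Cod.Sh.mutually_inverse[OF p[OF X]]
    note spD = mutually_inverseD[OF sp]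
    have "Eta F X \<cdot>\<^bsub>D\<^esub> \<psi> (ShO C X) = ShA D (\<psi> X) \<cdot>\<^bsub>D\<^esub> ((ShA D (\<theta> X) \<cdot>\<^bsub>D\<^esub> Eta F X) \<cdot>\<^bsub>D\<^esub> \<psi> (ShO C X))"
      using F.Cod.inverse_cancel(1)[OF sp] X p1D spD by simp
    also have "\<dots> = ShA D (\<psi> X) \<cdot>\<^bsub>D\<^esub> ((Eta G X \<cdot>\<^bsub>D\<^esub> \<theta> (ShO C X)) \<cdot>\<^bsub>D\<^esub> \<psi> (ShO C X))"
      using e[OF X] by simp
    also have "\<dots> = ShA D (\<psi> X) \<cdot>\<^bsub>D\<^esub> Eta G X" using X p1D by simp
    finally show ?thesis .
  qed
  then show ?thesis using n' unfolding graded_iso_def by blast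
qed

lemma graded_iso_trans:
  assumes "exact_between K C D F" "exact_between K C D G" "exact_between K C D H"
    and "graded_iso C D F G" "graded_iso C D G H"
  shows "graded_iso C D F H"
proof -
  interpret F: exact_between K C D F by fact
  interpret G: exact_between K C D G by fact
  interpret H: exact_between K C D H by fact
  obtain \<theta> where n: "nat_iso C D F G \<theta>"
    and e: "\<And>X. X \<in> Obj C \<Longrightarrow> Eta G X \<cdot>\<^bsub>D\<^esub> \<theta> (ShO C X) = ShA D (\<theta> X) \<cdot>\<^bsub>D\<^esub> Eta F X"
    using assms(4) by (auto simp: graded_iso_def)
  obtain \<phi> where n': "nat_iso C D G H \<phi>"
    and e': "\<And>X. X \<in> Obj C \<Longrightarrow> Eta H X \<cdot>\<^bsub>D\<^esub> \<phi> (ShO C X) = ShA D (\<phi> X) \<cdot>\<^bsub>D\<^esub> Eta G X"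
    using assms(5) by (auto simp: graded_iso_def)
  note nD = nat_isoD(1-3)[OF n] nat_isoD(1-3)[OF n']
  have "Eta H X \<cdot>\<^bsub>D\<^esub> (\<phi> (ShO C X) \<cdot>\<^bsub>D\<^esub> \<theta> (ShO C X)) = ShA D (\<phi> X \<cdot>\<^bsub>D\<^esub> \<theta> X) \<cdot>\<^bsub>D\<^esub> Eta F X"
    if X: "X \<in> Obj C" for X
  proof -
    have "Eta H X \<cdot>\<^bsub>D\<^esub> (\<phi> (ShO C X) \<cdot>\<^bsub>D\<^esub> \<theta> (ShO C X)) = (Eta H X \<cdot>\<^bsub>D\<^esub> \<phi> (ShO C X)) \<cdot>\<^bsub>D\<^esub> \<theta> (ShO C X)"
      using X nD by simp
    also have "\<dots> = ShA D (\<phi> X) \<cdot>\<^bsub>D\<^esub> (Eta G X \<cdot>\<^bsub>D\<^esub> \<theta> (ShO C X))" using e'[OF X] X nD by simp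
    also have "\<dots> = ShA D (\<phi> X \<cdot>\<^bsub>D\<^esub> \<theta> X) \<cdot>\<^bsub>D\<^esub> Eta F X" using e[OF X] X nD by simp
    finally show ?thesis .
  qed
  then show ?thesis
    using nat_iso_trans[OF F.functor_between_axioms G.functor_between_axioms H.functor_between_axioms n n']
    unfolding graded_iso_def by blast
qed

lemma graded_iso_comp_left:
  assumes "exact_between K C D F" "exact_between K C D G" "exact_between K D E H" "graded_iso C D F G"
  shows "graded_iso C E (comp_gfunct E H F) (comp_gfunct E H G)"
proof -
  interpret F: exact_between K C D F by fact
  interpret G: exact_between K C D G by fact
  interpret H: exact_between K D E H by fact
  obtain \<theta> where n: "nat_iso C D F G \<theta>"
    and e: "\<And>X. X \<in> Obj C \<Longrightarrow> Eta G X \<cdot>\<^bsub>D\<^esub> \<theta> (ShO C X) = ShA D (\<theta> X) \<cdot>\<^bsub>D\<^esub> Eta F X"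
    using assms(4) by (auto simp: graded_iso_def)
  note nD = nat_isoD(1-3)[OF n]
  have "Eta (comp_gfunct E H G) X \<cdot>\<^bsub>E\<^esub> FA H (\<theta> (ShO C X))
      = ShA E (FA H (\<theta> X)) \<cdot>\<^bsub>E\<^esub> Eta (comp_gfunct E H F) X" if X: "X \<in> Obj C" for X
  proof -
    have "Eta (comp_gfunct E H G) X \<cdot>\<^bsub>E\<^esub> FA H (\<theta> (ShO C X))
        = Eta H (FO G X) \<cdot>\<^bsub>E\<^esub> FA H (Eta G X \<cdot>\<^bsub>D\<^esub> \<theta> (ShO C X))" using X nD by simp
    also have "\<dots> = (Eta H (FO G X) \<cdot>\<^bsub>E\<^esub> FA H (ShA D (\<theta> X))) \<cdot>\<^bsub>E\<^esub> FA H (Eta F X)"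
      using e[OF X] X nD by simp
    also have "\<dots> = ShA E (FA H (\<theta> X)) \<cdot>\<^bsub>E\<^esub> Eta (comp_gfunct E H F) X"
      using H.Eta_natural[of "\<theta> X"] X nD by simp
    finally show ?thesis .
  qed
  moreover have "nat_iso C E (comp_gfunct E H F) (comp_gfunct E H G) (\<lambda>X. FA H (\<theta> X))"
    using nat_iso_whisker_left[OF F.functor_between_axioms G.functor_between_axioms H.functor_between_axioms n]
    by (simp add: nat_iso_def)
  ultimately show ?thesis unfolding graded_iso_def by blast
qed

lemma graded_iso_comp_right:
  assumes "exact_between K B C H" "exact_between K C D F" "exact_between K C D G" "graded_iso C D F G"
  shows "graded_iso B D (comp_gfunct D F H) (comp_gfunct D G H)"
proof -
  interpret F: exact_between K C D F by fact
  interpret G: exact_between K C D G by fact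
  interpret H: exact_between K B C H by fact
  obtain \<theta> where n: "nat_iso C D F G \<theta>"
    and e: "\<And>X. X \<in> Obj C \<Longrightarrow> Eta G X \<cdot>\<^bsub>D\<^esub> \<theta> (ShO C X) = ShA D (\<theta> X) \<cdot>\<^bsub>D\<^esub> Eta F X"
    using assms(4) by (auto simp: graded_iso_def)
  note nD = nat_isoD(1-3)[OF n]
  have "Eta (comp_gfunct D G H) X \<cdot>\<^bsub>D\<^esub> \<theta> (FO H (ShO B X))
      = ShA D (\<theta> (FO H X)) \<cdot>\<^bsub>D\<^esub> Eta (comp_gfunct D F H) X" if X: "X \<in> Obj B" for X
  proof -
    have "Eta (comp_gfunct D G H) X \<cdot>\<^bsub>D\<^esub> \<theta> (FO H (ShO B X))
        = Eta G (FO H X) \<cdot>\<^bsub>D\<^esub> (\<theta> (ShO C (FO H X)) \<cdot>\<^bsub>D\<^esub> FA F (Eta H X))"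
      using X nD nat_isoD(4)[OF n, of "Eta H X"] by simp
    also have "\<dots> = (Eta G (FO H X) \<cdot>\<^bsub>D\<^esub> \<theta> (ShO C (FO H X))) \<cdot>\<^bsub>D\<^esub> FA F (Eta H X)"
      using X nD by simp
    also have "\<dots> = ShA D (\<theta> (FO H X)) \<cdot>\<^bsub>D\<^esub> Eta (comp_gfunct D F H) X"
      using e[of "FO H X"] X nD by simp
    finally show ?thesis .
  qed
  moreover have "nat_iso B D (comp_gfunct D F H) (comp_gfunct D G H) (\<lambda>X. \<theta> (FO H X))"
    using nat_iso_whisker_right[OF H.functor_between_axioms n] by (simp add: nat_iso_def)
  ultimately show ?thesis unfolding graded_iso_def by auto
qed

text \<open>Additivity and linearity are invariant under natural isomorphism.\<close>

lemma additive_nat_iso: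
  assumes "functor_between C D F" "functor_between C D G" "linear_shift_category K C" "linear_category L D"
    and "nat_iso C D F G \<theta>" "additive_functor C D F"
  shows "additive_functor C D G"
proof -
  interpret F: functor_between C D F by fact
  interpret G: functor_between C D G by fact
  interpret C: linear_shift_category K C by fact
  interpret D: linear_category L D by fact
  obtain \<psi> where p: "\<And>X. X \<in> Obj C \<Longrightarrow> mutually_inverse D (FO F X) (FO G X) (\<theta> X) (\<psi> X)"
    using nat_iso_inverse[OF assms(5)] by auto
  note n = nat_isoD[OF assms(5)]
  have "FA G (AddA C f g) = AddA D (FA G f) (FA G g)"
    if O: "X \<in> Obj C" "Y \<in> Obj C" and f: "f \<in> Hom C X Y" and g: "g \<in> Hom C X Y" for X Y f g
  proof (rule F.Cod.iso_epic[OF p[OF O(1)]])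
    have fg: "AddA C f g \<in> Hom C X Y" using C.AddA_Hom f g .
    have Gs: "AddA D (FA G f) (FA G g) \<in> Hom D (FO G X) (FO G Y)"
      using D.AddA_closed G.Hom f g by blast
    have tX: "\<theta> X \<in> Hom D (FO F X) (FO G X)" and tY: "\<theta> Y \<in> Hom D (FO F Y) (FO G Y)"
      using n O by (auto simp: Hom_iff)
    have "FA G (AddA C f g) \<cdot>\<^bsub>D\<^esub> \<theta> X = \<theta> Y \<cdot>\<^bsub>D\<^esub> FA F (AddA C f g)"
      using n(4)[of "AddA C f g"] fg by (simp add: Hom_iff)
    also have "\<dots> = \<theta> Y \<cdot>\<^bsub>D\<^esub> AddA D (FA F f) (FA F g)"
      using assms(6) O f g by (simp add: additive_functor_def)
    also have "\<dots> = AddA D (FA G f \<cdot>\<^bsub>D\<^esub> \<theta> X) (FA G g \<cdot>\<^bsub>D\<^esub> \<theta> X)"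
      using D.Cmp_add_right[OF F.Hom[OF f] F.Hom[OF g] tY] n(4)[of f] n(4)[of g] f g
      by (simp add: Hom_iff)
    also have "\<dots> = AddA D (FA G f) (FA G g) \<cdot>\<^bsub>D\<^esub> \<theta> X"
      using D.Cmp_add_left[OF tX G.Hom[OF f] G.Hom[OF g]] by simp
    finally show "FA G (AddA C f g) \<cdot>\<^bsub>D\<^esub> \<theta> X = AddA D (FA G f) (FA G g) \<cdot>\<^bsub>D\<^esub> \<theta> X" .
    show "FA G (AddA C f g) \<in> Arr D" "Src D (FA G (AddA C f g)) = FO G X"
      using G.Hom[OF fg] by (auto simp: Hom_iff)
    show "AddA D (FA G f) (FA G g) \<in> Arr D" "Src D (AddA D (FA G f) (FA G g)) = FO G X"
      using Gs by (auto simp: Hom_iff)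
  qed
  then show ?thesis using G.cat_functor by (simp add: additive_functor_def)
qed

lemma linear_nat_iso:
  assumes "functor_between C D F" "functor_between C D G" "linear_shift_category K C" "linear_category K D"
    and "nat_iso C D F G \<theta>" "linear_functor K C D F"
  shows "linear_functor K C D G"
proof -
  interpret F: functor_between C D F by fact
  interpret G: functor_between C D G by fact
  interpret C: linear_shift_category K C by fact
  interpret D: linear_category K D by fact
  obtain \<psi> where p: "\<And>X. X \<in> Obj C \<Longrightarrow> mutually_inverse D (FO F X) (FO G X) (\<theta> X) (\<psi> X)"
    using nat_iso_inverse[OF assms(5)] by auto
  note n = nat_isoD[OF assms(5)]
  have "FA G (SmulA C a f) = SmulA D a (FA G f)" if a: "a \<in> carrier K" and f: "f \<in> Arr C" for a f
  proof -
    define X Y where "X = Src C f" and "Y = Tgt C f"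
    have fH: "f \<in> Hom C X Y" and O: "X \<in> Obj C" "Y \<in> Obj C" using f by (auto simp: X_def Y_def Hom_iff)
    have af: "SmulA C a f \<in> Hom C X Y" using C.SmulA_Hom a fH .
    have Gs: "SmulA D a (FA G f) \<in> Hom D (FO G X) (FO G Y)"
      using D.SmulA_closed G.Hom fH a by blast
    have tX: "\<theta> X \<in> Hom D (FO F X) (FO G X)" and tY: "\<theta> Y \<in> Hom D (FO F Y) (FO G Y)"
      using n O by (auto simp: Hom_iff)
    have "FA G (SmulA C a f) \<cdot>\<^bsub>D\<^esub> \<theta> X = \<theta> Y \<cdot>\<^bsub>D\<^esub> FA F (SmulA C a f)"
      using n(4)[of "SmulA C a f"] af by (simp add: Hom_iff)
    also have "\<dots> = \<theta> Y \<cdot>\<^bsub>D\<^esub> SmulA D a (FA F f)"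
      using assms(6) a f by (simp add: linear_functor_def)
    also have "\<dots> = SmulA D a (FA G f \<cdot>\<^bsub>D\<^esub> \<theta> X)"
      using D.Cmp_smul_right[OF a F.Hom[OF fH] tY] n(4)[of f] fH by (simp add: Hom_iff)
    also have "\<dots> = SmulA D a (FA G f) \<cdot>\<^bsub>D\<^esub> \<theta> X"
      using D.Cmp_smul_left[OF a tX G.Hom[OF fH]] by simp
    finally have "FA G (SmulA C a f) \<cdot>\<^bsub>D\<^esub> \<theta> X = SmulA D a (FA G f) \<cdot>\<^bsub>D\<^esub> \<theta> X" .
    then show ?thesis
      using F.Cod.iso_epic[OF p[OF O(1)]] Gs G.Hom[OF af] by (simp add: Hom_iff)
  qed
  moreover have "additive_functor C D G"
    using additive_nat_iso[OF assms(1-5)] assms(6) by (simp add: linear_functor_def)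
  ultimately show ?thesis by (simp add: linear_functor_def)
qed

text \<open>Postcomposition with a fully faithful additive or linear functor reflects these properties.\<close>

lemma additive_reflect:
  assumes "ff_functor C D F" "functor_between S C H" "linear_shift_category K S" "linear_shift_category K C"
    and "additive_functor C D F" "additive_functor S D (comp_funct F H)"
  shows "additive_functor S C H"
proof -
  interpret F: ff_functor C D F by fact
  interpret H: functor_between S C H by fact
  interpret S: linear_shift_category K S by fact
  interpret C: linear_shift_category K C by fact
  have "FA H (AddA S f g) = AddA C (FA H f) (FA H g)"
    if O: "X \<in> Obj S" "Y \<in> Obj S" and f: "f \<in> Hom S X Y" and g: "g \<in> Hom S X Y" for X Y f g
  proof (rule F.faithful)
    show "FA H (AddA S f g) \<in> Hom C (FO H X) (FO H Y)" using H.Hom S.AddA_Hom f g by blast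
    show "AddA C (FA H f) (FA H g) \<in> Hom C (FO H X) (FO H Y)" using H.Hom C.AddA_Hom f g by blast
    have "FA F (FA H (AddA S f g)) = AddA D (FA F (FA H f)) (FA F (FA H g))"
      using assms(6) O f g by (simp add: additive_functor_def)
    also have "\<dots> = FA F (AddA C (FA H f) (FA H g))"
      using assms(5) H.Hom[OF f] H.Hom[OF g] H.Obj O unfolding additive_functor_def by metis
    finally show "FA F (FA H (AddA S f g)) = FA F (AddA C (FA H f) (FA H g))" .
  qed
  then show ?thesis using H.cat_functor by (simp add: additive_functor_def)
qed

lemma linear_reflect:
  assumes "ff_functor C D F" "functor_between S C H" "linear_shift_category K S" "linear_shift_category K C"
    and "linear_functor K C D F" "linear_functor K S D (comp_funct F H)"
  shows "linear_functor K S C H"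
proof -
  interpret F: ff_functor C D F by fact
  interpret H: functor_between S C H by fact
  interpret S: linear_shift_category K S by fact
  interpret C: linear_shift_category K C by fact
  have "FA H (SmulA S a f) = SmulA C a (FA H f)" if a: "a \<in> carrier K" and f: "f \<in> Arr S" for a f
  proof (rule F.faithful)
    have fH: "f \<in> Hom S (Src S f) (Tgt S f)" using f by (simp add: Hom_iff)
    show "FA H (SmulA S a f) \<in> Hom C (FO H (Src S f)) (FO H (Tgt S f))"
      using H.Hom S.SmulA_Hom fH a by blast
    show "SmulA C a (FA H f) \<in> Hom C (FO H (Src S f)) (FO H (Tgt S f))"
      using H.Hom C.SmulA_Hom fH a by blast
    show "FA F (FA H (SmulA S a f)) = FA F (SmulA C a (FA H f))"
      using assms(5,6) a f by (simp add: linear_functor_def)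
  qed
  moreover have "additive_functor S C H"
    using additive_reflect[OF assms(1-4)] assms(5,6) by (simp add: linear_functor_def)
  ultimately show ?thesis by (simp add: linear_functor_def)
qed

section \<open>Lifting along fully faithful exact functors\<close>

text \<open>An exact functor between triangulated categories, and a fully faithful one.\<close>

locale exact_triangulated = A: linear_triangulated_category K A + T: linear_triangulated_category K T
  for K :: "('k, 'x) ring_scheme" and A :: "('o, 'm, 'k, 'y) tricat_scheme"
    and T :: "('p, 'n, 'k, 'z) tricat_scheme" and F :: "('o, 'm, 'p, 'n) gfunct" +
  assumes exact: "exact_functor A T F"

sublocale exact_triangulated \<subseteq> exact_between K A T F
  using exact by unfold_locales

locale ff_exact = exact_triangulated K A T F
  for K :: "('k, 'x) ring_scheme" and A :: "('o, 'm, 'k, 'y) tricat_scheme"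
    and T :: "('p, 'n, 'k, 'z) tricat_scheme" and F :: "('o, 'm, 'p, 'n) gfunct" +
  assumes fully_faithful: "fully_faithful A T F"

sublocale ff_exact \<subseteq> ff_functor A T F
  using fully_faithful by unfold_locales

lemma ff_exactI:
  assumes "linear_triangulated_category K A" "linear_triangulated_category K T"
    "exact_functor A T F" "fully_faithful A T F"
  shows "ff_exact K A T F"
  using assms by (simp add: ff_exact_def exact_triangulated_def exact_triangulated_axioms_def ff_exact_axioms_def)

context ff_exact
begin

text \<open>
  A triangle is distinguished if its image is: complete \<open>u\<close> to a distinguished triangle and
  compare the images by the five lemma.
\<close>

lemma reflect_dist:
  assumes t: "triangle A X Y Z u v w"
    and d: "dist_triangle T (FO F X) (FO F Y) (FO F Z) (FA F u) (FA F v) (Eta F X \<cdot>\<^bsub>T\<^esub> FA F w)"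
  shows "dist_triangle A X Y Z u v w"
proof -
  have uvw: "u \<in> Hom A X Y" "v \<in> Hom A Y Z" "w \<in> Hom A Z (ShO A X)" using t by (auto simp: triangle_def)
  then have O: "X \<in> Obj A" "Y \<in> Obj A" "Z \<in> Obj A" using A.Hom_Obj by blast+
  obtain Z' v' w' where d0: "dist_triangle A X Y Z' u v' w'" using A.TR1_ex[OF uvw(1)] by blast
  note d1 = dist[OF d0] and D0 = dist_triangleD[OF d0]
  have O': "Z' \<in> Obj A" using A.dist_triangle_Obj[OF d0] by blast
  note I = T.mutually_inverse_refl[OF Obj[OF O(1)]] T.mutually_inverse_refl[OF Obj[OF O(2)]]
  have sq: "Idn T (FO F Y) \<cdot>\<^bsub>T\<^esub> FA F u = FA F u \<cdot>\<^bsub>T\<^esub> Idn T (FO F X)"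
    using uvw by (simp add: Hom_iff)
  obtain c where c: "c \<in> Hom T (FO F Z') (FO F Z)" "c \<cdot>\<^bsub>T\<^esub> FA F v' = FA F v \<cdot>\<^bsub>T\<^esub> Idn T (FO F Y)"
    "ShA T (Idn T (FO F X)) \<cdot>\<^bsub>T\<^esub> (Eta F X \<cdot>\<^bsub>T\<^esub> FA F w') = (Eta F X \<cdot>\<^bsub>T\<^esub> FA F w) \<cdot>\<^bsub>T\<^esub> c"
    using T.TR3[OF d1 d _ _ sq] T.Idn_closed O by auto
  have ci: "is_iso T c" by (rule T.triangle_five[OF d1 d I c(1) sq c(2,3)])
  obtain c' where c': "c' \<in> Hom A Z' Z" "FA F c' = c" using full[OF c(1) O' O(3)] by blast
  have c'D: "c' \<in> Arr A" "Src A c' = Z'" "Tgt A c' = Z" using c' by (auto simp: Hom_iff)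
  have c'i: "is_iso A c'" using reflect_iso[OF c'(1)] c'(2) ci by simp
  obtain h where h: "mutually_inverse T (FO F (ShO A X)) (ShO T (FO F X)) (Eta F X) h"
    using Eta_inverse[OF O(1)] by blast
  show ?thesis
  proof (rule A.Dist_iso[OF d0 t _ _ c'(1) _ _ c'i])
    show "Idn A X \<in> Hom A X X" "Idn A Y \<in> Hom A Y Y" using A.Idn_closed O by auto
    show "is_iso A (Idn A X)" "is_iso A (Idn A Y)"
      using mutually_inverse_imp_is_iso A.mutually_inverse_refl O by metis+
    show "Idn A Y \<cdot>\<^bsub>A\<^esub> u = u \<cdot>\<^bsub>A\<^esub> Idn A X" using uvw by (simp add: Hom_iff)
    show "c' \<cdot>\<^bsub>A\<^esub> v' = v \<cdot>\<^bsub>A\<^esub> Idn A Y"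
      by (rule faithful[of _ Y Z]) (use c c' c'D D0 uvw in \<open>auto simp: Hom_iff\<close>)
    have "Eta F X \<cdot>\<^bsub>T\<^esub> FA F w' = Eta F X \<cdot>\<^bsub>T\<^esub> (FA F w \<cdot>\<^bsub>T\<^esub> c)"
      using c(1,3) uvw D0 O by (simp add: Hom_iff)
    then have "FA F w' = FA F w \<cdot>\<^bsub>T\<^esub> c"
      using T.iso_monic[OF h] c(1) uvw D0 by (simp add: Hom_iff)
    then have "w' = w \<cdot>\<^bsub>A\<^esub> c'"
      by (intro faithful[of _ Z' "ShO A X"]) (use c' c'D D0 uvw in \<open>auto simp: Hom_iff\<close>)
    then show "ShA A (Idn A X) \<cdot>\<^bsub>A\<^esub> w' = w \<cdot>\<^bsub>A\<^esub> c'" using D0 O by simp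
  qed
qed

text \<open>
  The lift of \<open>G\<close> through \<open>F\<close> is again exact.  Its shift isomorphism is the preimage under \<open>F\<close> of
  \<open>F H (X[1]) \<cong> G (X[1]) \<cong> (G X)[1] \<cong> (F H X)[1] \<cong> F ((H X)[1])\<close>.
\<close>

lemma lift_exact:
  fixes S :: "('s, 'a, 'k, 'w) tricat_scheme"
  assumes G: "exact_between K S T G"
    and ess: "\<And>X. X \<in> Obj S \<Longrightarrow> \<exists>Y \<in> Obj A. isomorphic T (FO F Y) (FO G X)"
  obtains H where "exact_between K S A H" "graded_iso S T (comp_gfunct T F H) G"
proof -
  interpret G: exact_between K S T G by fact
  obtain H :: "('s, 'a, 'o, 'm) funct" and \<phi> where H: "functor_between S A H"
    and n: "nat_iso S T (comp_funct F H) G \<phi>"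
    by (rule lift_functor[OF ff_functor_axioms G.functor_between_axioms ess])
  interpret H: functor_between S A H by fact
  note F' = functor_between_axioms and G' = G.functor_between_axioms
  note fc = functor_between_comp and FH = functor_between_comp[OF H F']
  note ShS = G.Dom.Sh.functor_between_axioms and ShA = A.Sh.functor_between_axioms
    and ShT = T.Sh.functor_between_axioms
  obtain \<psi> where p: "\<And>X. X \<in> Obj S \<Longrightarrow> mutually_inverse T (FO F (FO H X)) (FO G X) (\<phi> X) (\<psi> X)"
    using nat_iso_inverse[OF n] by auto
  have n': "nat_iso S T G (comp_funct F H) \<psi>"
    by (rule nat_iso_sym[OF FH G' n]) (use p in simp)
  obtain \<eta> where q: "\<And>X. X \<in> Obj A \<Longrightarrow> mutually_inverse T (FO F (ShO A X)) (ShO T (FO F X)) (Eta F X) (\<eta> X)"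
    using nat_iso_inverse[OF nat_iso_Eta] by auto
  have \<eta>: "nat_iso A T (comp_funct (Shift T) F) (comp_funct F (Shift A)) \<eta>"
    by (rule nat_iso_sym[OF fc[OF ShA F'] fc[OF F' ShT] nat_iso_Eta]) (use q in simp)
  define t where "t = (\<lambda>X. \<eta> (FO H X) \<cdot>\<^bsub>T\<^esub> (FA (Shift T) (\<psi> X) \<cdot>\<^bsub>T\<^esub> (Eta G X \<cdot>\<^bsub>T\<^esub> \<phi> (ShO S X))))"
  have 1: "nat_iso S T (comp_funct (comp_funct F H) (Shift S)) (comp_funct G (Shift S)) (\<lambda>X. \<phi> (ShO S X))"
    by (rule nat_iso_whisker_right[OF ShS n])
  have 2: "nat_iso S T (comp_funct (comp_funct F H) (Shift S)) (comp_funct (Shift T) G)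
      (\<lambda>X. Eta G X \<cdot>\<^bsub>T\<^esub> \<phi> (ShO S X))"
    by (rule nat_iso_trans[OF fc[OF ShS FH] fc[OF ShS G'] fc[OF G' ShT] 1 G.nat_iso_Eta])
  have 3: "nat_iso S T (comp_funct (Shift T) G) (comp_funct (Shift T) (comp_funct F H)) (\<lambda>X. FA (Shift T) (\<psi> X))"
    by (rule nat_iso_whisker_left[OF G' FH ShT n'])
  have 4: "nat_iso S T (comp_funct (comp_funct F H) (Shift S)) (comp_funct (Shift T) (comp_funct F H))
      (\<lambda>X. FA (Shift T) (\<psi> X) \<cdot>\<^bsub>T\<^esub> (Eta G X \<cdot>\<^bsub>T\<^esub> \<phi> (ShO S X)))"
    by (rule nat_iso_trans[OF fc[OF ShS FH] fc[OF G' ShT] fc[OF FH ShT] 2 3])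
  have 5: "nat_iso S T (comp_funct (Shift T) (comp_funct F H)) (comp_funct F (comp_funct (Shift A) H))
      (\<lambda>X. \<eta> (FO H X))"
    using nat_iso_whisker_right[OF H \<eta>] by (simp add: comp_funct_assoc)
  have "nat_iso S T (comp_funct F (comp_funct H (Shift S))) (comp_funct F (comp_funct (Shift A) H)) t"
    using nat_iso_trans[OF fc[OF ShS FH] fc[OF FH ShT] fc[OF fc[OF H ShA] F'] 4 5]
    unfolding t_def comp_funct_assoc .
  then obtain \<epsilon> where \<epsilon>: "nat_iso S A (comp_funct H (Shift S)) (comp_funct (Shift A) H) \<epsilon>"
    and F\<epsilon>: "\<And>X. X \<in> Obj S \<Longrightarrow> FA F (\<epsilon> X) = t X"
    by (rule ff_reflect_nat_iso[OF ff_functor_axioms fc[OF ShS H] fc[OF H ShA]]) blast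
  note \<epsilon>D = nat_isoD[OF \<epsilon>, simplified]
  define H' :: "('s, 'a, 'o, 'm) gfunct" where "H' = \<lparr>FO = FO H, FA = FA H, Eta = \<epsilon>\<rparr>"
  have H's [simp]: "FO H' = FO H" "FA H' = FA H" "Eta H' = \<epsilon>" by (simp_all add: H'_def)
  have key: "Eta G X \<cdot>\<^bsub>T\<^esub> \<phi> (ShO S X) = FA (Shift T) (\<phi> X) \<cdot>\<^bsub>T\<^esub> (Eta F (FO H X) \<cdot>\<^bsub>T\<^esub> FA F (\<epsilon> X))"
    if X: "X \<in> Obj S" for X
  proof -
    have X1: "ShO S X \<in> Obj S" and HX: "FO H X \<in> Obj A" using X by auto
    note pD = mutually_inverseD[OF p[OF X]] mutually_inverseD[OF p[OF X1]]
    note qD = mutually_inverseD[OF q[OF HX]]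
    note sp = T.Sh.mutually_inverse[OF p[OF X]]
    note spD = mutually_inverseD[OF sp]
    show ?thesis
      unfolding F\<epsilon>[OF X] t_def
      using X pD qD spD T.inverse_cancel[OF q[OF HX]] T.inverse_cancel[OF sp] by simp
  qed
  have eta: "nat_iso S A (comp_funct H' (Shift S)) (comp_funct (Shift A) H') (Eta H')"
    using \<epsilon> by (simp add: nat_iso_def)
  have "additive_functor S T (comp_funct F H)"
    by (rule additive_nat_iso[OF G' FH G.Dom.linear_shift_category_axioms T.linear_category_axioms n' G.additive])
  then have "additive_functor S A H"
    by (rule additive_reflect[OF ff_functor_axioms H G.Dom.linear_shift_category_axioms
      A.linear_shift_category_axioms additive])
  then have add: "additive_functor S A H'" by (simp add: additive_functor_def cat_functor_def)
  have "dist_triangle A (FO H X) (FO H Y) (FO H Z) (FA H u) (FA H v) (\<epsilon> X \<cdot>\<^bsub>A\<^esub> FA H w)"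
    if d: "dist_triangle S X Y Z u v w" for X Y Z u v w
  proof (rule reflect_dist)
    note D = dist_triangleD[OF d]
    have O: "X \<in> Obj S" "Y \<in> Obj S" "Z \<in> Obj S" using D G.Dom.Src_Obj G.Dom.Tgt_Obj by blast+
    show "triangle A (FO H X) (FO H Y) (FO H Z) (FA H u) (FA H v) (\<epsilon> X \<cdot>\<^bsub>A\<^esub> FA H w)"
      using D O \<epsilon>D by (simp add: triangle_def Hom_iff)
    note pX = p[OF O(1)] and pY = p[OF O(2)] and pZ = p[OF O(3)]
    note pXD = mutually_inverseD[OF pX] and pYD = mutually_inverseD[OF pY] and pZD = mutually_inverseD[OF pZ]
    note sp = T.Sh.mutually_inverse[OF pX]
    note spD = mutually_inverseD[OF sp]
    have p1: "mutually_inverse T (FO F (FO H (ShO S X))) (FO G (ShO S X)) (\<phi> (ShO S X)) (\<psi> (ShO S X))"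
      using p O by simp
    note p1D = mutually_inverseD[OF p1]
    have nat: "\<psi> (Tgt S f) \<cdot>\<^bsub>T\<^esub> FA G f = FA F (FA H f) \<cdot>\<^bsub>T\<^esub> \<psi> (Src S f)" if "f \<in> Arr S" for f
      using nat_isoD(4)[OF n' that] by simp
    show "dist_triangle T (FO F (FO H X)) (FO F (FO H Y)) (FO F (FO H Z)) (FA F (FA H u)) (FA F (FA H v))
      (Eta F (FO H X) \<cdot>\<^bsub>T\<^esub> FA F (\<epsilon> X \<cdot>\<^bsub>A\<^esub> FA H w))"
    proof (rule T.Dist_iso[OF G.dist[OF d]])
      show "triangle T (FO F (FO H X)) (FO F (FO H Y)) (FO F (FO H Z)) (FA F (FA H u)) (FA F (FA H v))
        (Eta F (FO H X) \<cdot>\<^bsub>T\<^esub> FA F (\<epsilon> X \<cdot>\<^bsub>A\<^esub> FA H w))"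
        using D O \<epsilon>D by (simp add: triangle_def Hom_iff)
      show "\<psi> X \<in> Hom T (FO G X) (FO F (FO H X))" "\<psi> Y \<in> Hom T (FO G Y) (FO F (FO H Y))"
        "\<psi> Z \<in> Hom T (FO G Z) (FO F (FO H Z))" using pXD pYD pZD by (auto simp: Hom_iff)
      show "is_iso T (\<psi> X)" "is_iso T (\<psi> Y)" "is_iso T (\<psi> Z)"
        using mutually_inverse_imp_is_iso mutually_inverse_sym pX pY pZ by metis+
      show "\<psi> Y \<cdot>\<^bsub>T\<^esub> FA G u = FA F (FA H u) \<cdot>\<^bsub>T\<^esub> \<psi> X" "\<psi> Z \<cdot>\<^bsub>T\<^esub> FA G v = FA F (FA H v) \<cdot>\<^bsub>T\<^esub> \<psi> Y"
        using nat[of u] nat[of v] D by auto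
      have "FA (Shift T) (\<psi> X) \<cdot>\<^bsub>T\<^esub> (Eta G X \<cdot>\<^bsub>T\<^esub> FA G w)
          = FA (Shift T) (\<psi> X) \<cdot>\<^bsub>T\<^esub> (Eta G X \<cdot>\<^bsub>T\<^esub> (\<phi> (ShO S X) \<cdot>\<^bsub>T\<^esub> (\<psi> (ShO S X) \<cdot>\<^bsub>T\<^esub> FA G w)))"
        using T.inverse_cancel(2)[OF p1] D by simp
      also have "\<dots> = FA (Shift T) (\<psi> X) \<cdot>\<^bsub>T\<^esub> ((Eta G X \<cdot>\<^bsub>T\<^esub> \<phi> (ShO S X)) \<cdot>\<^bsub>T\<^esub> (FA F (FA H w) \<cdot>\<^bsub>T\<^esub> \<psi> Z))"
        using nat[of w] D O p1D pZD by simp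
      also have "\<dots> = FA (Shift T) (\<psi> X) \<cdot>\<^bsub>T\<^esub> ((FA (Shift T) (\<phi> X) \<cdot>\<^bsub>T\<^esub> (Eta F (FO H X) \<cdot>\<^bsub>T\<^esub> FA F (\<epsilon> X)))
          \<cdot>\<^bsub>T\<^esub> (FA F (FA H w) \<cdot>\<^bsub>T\<^esub> \<psi> Z))" using key[OF O(1)] by simp
      also have "\<dots> = (Eta F (FO H X) \<cdot>\<^bsub>T\<^esub> FA F (\<epsilon> X \<cdot>\<^bsub>A\<^esub> FA H w)) \<cdot>\<^bsub>T\<^esub> \<psi> Z"
        using D O \<epsilon>D(1-3) spD pZD T.inverse_cancel[OF sp] by simp
      finally show "FA (Shift T) (\<psi> X) \<cdot>\<^bsub>T\<^esub> (Eta G X \<cdot>\<^bsub>T\<^esub> FA G w)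
          = (Eta F (FO H X) \<cdot>\<^bsub>T\<^esub> FA F (\<epsilon> X \<cdot>\<^bsub>A\<^esub> FA H w)) \<cdot>\<^bsub>T\<^esub> \<psi> Z" .
    qed
  qed
  then have "exact_functor S A H'" using eta add by (simp add: exact_functor_def)
  then have H'e: "exact_between K S A H'"
    using exact_betweenI G.Dom.linear_shift_category_axioms A.linear_shift_category_axioms by blast
  have "nat_iso S T (comp_gfunct T F H') G \<phi>" using n by (simp add: nat_iso_def)
  then have "graded_iso S T (comp_gfunct T F H') G"
    using key unfolding graded_iso_def by auto
  then show thesis using that H'e by blast
qed

text \<open>The lift of a linear functor through a linear fully faithful functor is linear.\<close>

lemma lift_linear:
  assumes "exact_between K S A H" "exact_between K S T G" "linear_functor K A T F" "linear_functor K S T G"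
    and "graded_iso S T (comp_gfunct T F H) G"
  shows "linear_functor K S A H"
proof -
  interpret H: exact_between K S A H by fact
  interpret G: exact_between K S T G by fact
  interpret FH: exact_between K S T "comp_gfunct T F H"
    using exact_between_comp[OF assms(1) exact_between_axioms] .
  note lin = linear_nat_iso[OF _ _ H.Dom.linear_shift_category_axioms T.linear_category_axioms]
  obtain \<theta> where "nat_iso S T G (comp_gfunct T F H) \<theta>"
    using graded_iso_nat_iso[OF graded_iso_sym[OF FH.exact_between_axioms assms(2,5)]] by blast
  then have "linear_functor K S T (comp_gfunct T F H)"
    using lin[OF G.functor_between_axioms FH.functor_between_axioms] assms(4) by blast
  then have "linear_functor K S T (comp_funct F H)"
    by (simp add: linear_functor_def additive_functor_def cat_functor_def)
  then show ?thesis
    using linear_reflect[OF ff_functor_axioms H.functor_between_axioms H.Dom.linear_shift_category_axioms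
      A.linear_shift_category_axioms assms(3)] by blast
qed

text \<open>The lift of a fully faithful functor is fully faithful.\<close>

lemma lift_fully_faithful:
  assumes "functor_between S A H" "nat_iso S T (comp_gfunct T F H) G \<theta>" "ff_functor S T G"
  shows "fully_faithful S A H"
proof -
  interpret H: functor_between S A H by fact
  interpret G: ff_functor S T G by fact
  obtain \<psi> where p: "\<And>X. X \<in> Obj S \<Longrightarrow> mutually_inverse T (FO F (FO H X)) (FO G X) (\<theta> X) (\<psi> X)"
    using nat_iso_inverse[OF assms(2)] by auto
  note n = nat_isoD(4)[OF assms(2), simplified]
  have "inj_on (FA H) (Hom S X Y)" and "FA H ` Hom S X Y = Hom A (FO H X) (FO H Y)"
    if O: "X \<in> Obj S" "Y \<in> Obj S" for X Y
  proof -
    note pX = p[OF O(1)] and pY = p[OF O(2)]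
    note pXD = mutually_inverseD[OF pX] and pYD = mutually_inverseD[OF pY]
    show "inj_on (FA H) (Hom S X Y)"
    proof (rule inj_onI)
      fix f g assume f: "f \<in> Hom S X Y" and g: "g \<in> Hom S X Y" and eq: "FA H f = FA H g"
      have "FA G f \<cdot>\<^bsub>T\<^esub> \<theta> X = FA G g \<cdot>\<^bsub>T\<^esub> \<theta> X"
        using n[of f] n[of g] f g eq by (simp add: Hom_iff)
      then have "FA G f = FA G g" using T.iso_epic[OF pX] f g by (simp add: Hom_iff)
      then show "f = g" using G.faithful f g by blast
    qed
    have "k \<in> FA H ` Hom S X Y" if k: "k \<in> Hom A (FO H X) (FO H Y)" for k
    proof -
      let ?g = "\<theta> Y \<cdot>\<^bsub>T\<^esub> (FA F k \<cdot>\<^bsub>T\<^esub> \<psi> X)"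
      have "?g \<in> Hom T (FO G X) (FO G Y)" using k pXD pYD by (auto simp: Hom_iff)
      then obtain f where f: "f \<in> Hom S X Y" "FA G f = ?g" using G.full O by blast
      have "\<theta> Y \<cdot>\<^bsub>T\<^esub> FA F (FA H f) = ?g \<cdot>\<^bsub>T\<^esub> \<theta> X" using n[of f] f by (simp add: Hom_iff)
      also have "\<dots> = \<theta> Y \<cdot>\<^bsub>T\<^esub> FA F k" using k pXD pYD by (simp add: Hom_iff)
      finally have "FA F (FA H f) = FA F k"
        using T.iso_monic[OF pY] H.Hom[OF f(1)] k by (simp add: Hom_iff)
      then have "FA H f = k" using faithful H.Hom[OF f(1)] k by blast
      then show ?thesis using f(1) by blast
    qed
    then show "FA H ` Hom S X Y = Hom A (FO H X) (FO H Y)" using H.Hom by blast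
  qed
  then show ?thesis unfolding fully_faithful_def bij_betw_def by blast
qed

end

section \<open>Images of triangulated subcategories\<close>

lemma image_subcat_nat_iso:
  assumes "category D" "nat_iso C D F G \<theta>" "B \<subseteq> Obj C"
  shows "image_subcat C D F B = image_subcat C D G B"
proof -
  interpret D: category D by fact
  have "isomorphic D (FO F X) (FO G X)" if "X \<in> B" for X
    using nat_iso_isomorphic[OF assms(2)] that assms(3) by blast
  then show ?thesis
    unfolding image_subcat_def using D.isomorphic_trans D.isomorphic_sym by blast
qed

lemma image_subcat_comp:
  assumes "functor_between C D F" "functor_between D E G" "B \<subseteq> Obj C"
  shows "image_subcat C E (comp_gfunct E G F) B = image_subcat D E G (image_subcat C D F B)"
proof -
  interpret F: functor_between C D F by fact
  interpret G: functor_between D E G by fact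
  have "Z \<in> image_subcat D E G (image_subcat C D F B)"
    if "Z \<in> Obj E" "X \<in> B" "isomorphic E (FO G (FO F X)) Z" for X Z
  proof -
    have "FO F X \<in> image_subcat C D F B"
      using that(2) assms(3) F.Cod.isomorphic_refl F.Obj unfolding image_subcat_def by blast
    then show ?thesis using that unfolding image_subcat_def by blast
  qed
  moreover have "\<exists>X\<in>B. isomorphic E (FO G (FO F X)) Z"
    if "Y \<in> image_subcat C D F B" "isomorphic E (FO G Y) Z" for Y Z
    using that G.isomorphic G.Cod.isomorphic_trans unfolding image_subcat_def by blast
  ultimately show ?thesis by (fastforce simp: image_subcat_def)
qed

lemma image_subcat_mono: "B \<subseteq> B' \<Longrightarrow> image_subcat C D F B \<subseteq> image_subcat C D F B'"
  by (auto simp: image_subcat_def)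

context linear_triangulated_category
begin

lemma image_subcat_id:
  assumes "triangulated_subcat C B"
  shows "image_subcat C C (id_gfunct C) B = B"
  using assms subcat_iso_closed isomorphic_refl triangulated_subcat_Obj
  by (fastforce simp: image_subcat_def)

end

text \<open>Preimages of triangulated subcategories under exact functors are triangulated.\<close>

lemma (in exact_triangulated) preimage_triangulated:
  assumes D: "triangulated_subcat T D"
  shows "triangulated_subcat A {X \<in> Obj A. FO F X \<in> D}"
  unfolding triangulated_subcat_def
proof (intro conjI ballI impI allI)
  obtain Z where Z: "zero_object A Z" using A.ex_zero_object by blast
  have "zero_object T (FO F Z)"
    using additive_functor_zero_object[OF A.linear_category_axioms T.linear_category_axioms additive Z] .
  then have "FO F Z \<in> D" using T.zero_object_in_subcat[OF D] by blast
  then show "{X \<in> Obj A. FO F X \<in> D} \<noteq> {}" using A.zero_objectD(1)[OF Z] by blast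
  show "{X \<in> Obj A. FO F X \<in> D} \<subseteq> Obj A" by blast
next
  fix X assume X: "X \<in> {X \<in> Obj A. FO F X \<in> D}"
  then have "ShO T (FO F X) \<in> D" using D by (auto simp: triangulated_subcat_def)
  then show "ShO A X \<in> {X \<in> Obj A. FO F X \<in> D}"
    using X T.subcat_iso_closed[OF D] T.isomorphic_sym[OF Shift_isomorphic] by auto
next
  fix X Y assume X: "X \<in> {X \<in> Obj A. FO F X \<in> D}" and Y: "Y \<in> Obj A"
    and iso: "isomorphic A (ShO A Y) X"
  have "isomorphic T (ShO T (FO F Y)) (FO F X)"
    using T.isomorphic_trans[OF T.isomorphic_sym[OF Shift_isomorphic[OF Y]] isomorphic[OF iso]] .
  then show "Y \<in> {X \<in> Obj A. FO F X \<in> D}"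
    using D X Y Obj[OF Y] unfolding triangulated_subcat_def by blast
next
  fix X Y Z u v w assume d: "dist_triangle A X Y Z u v w"
    and "X \<in> {X \<in> Obj A. FO F X \<in> D}" "Z \<in> {X \<in> Obj A. FO F X \<in> D}"
  then show "Y \<in> {X \<in> Obj A. FO F X \<in> D}"
    using D dist[OF d] A.dist_triangle_Obj[OF d] unfolding triangulated_subcat_def by blast
qed

context ff_exact
begin

text \<open>
  If the shift of an object is isomorphic to a value of \<open>F\<close> on the triangulated subcategory \<open>B\<close>,
  then so is the object itself.
\<close>

lemma image_unshift:
  assumes B: "triangulated_subcat A B" and V: "V \<in> B" and Y: "Y \<in> Obj T"
    and iso: "isomorphic T (ShO T Y) (FO F V)"
  shows "Y \<in> image_subcat A T F B"
proof -
  have VO: "V \<in> Obj A" using triangulated_subcat_Obj[OF B V] .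
  obtain W where W: "W \<in> Obj A" "isomorphic A (ShO A W) V" using A.Shift_ess_surj[OF VO] by blast
  then have WB: "W \<in> B" using B V unfolding triangulated_subcat_def by blast
  have "isomorphic T (ShO T (FO F W)) (FO F V)"
    using T.isomorphic_trans[OF T.isomorphic_sym[OF Shift_isomorphic[OF W(1)]] isomorphic[OF W(2)]] .
  then have "isomorphic T (ShO T (FO F W)) (ShO T Y)"
    using iso T.isomorphic_trans T.isomorphic_sym by blast
  then have "isomorphic T (FO F W) Y"
    using T.Sh.reflect_isomorphic Obj[OF W(1)] Y by blast
  then show ?thesis using WB Y by (auto simp: image_subcat_def)
qed

text \<open>
  For an extension of \<open>Z\<close> by \<open>X\<close> with \<open>X \<cong> F X'\<close> and \<open>Z \<cong> F Z'\<close>, the arrow \<open>Z \<rightarrow> X[1]\<close> comes from an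
  arrow \<open>Z' \<rightarrow> X'[1]\<close>, and the shifted extension is isomorphic to the image of the cone of the latter.
\<close>

lemma image_triangulated:
  assumes B: "triangulated_subcat A B"
  shows "triangulated_subcat T (image_subcat A T F B)"
proof -
  let ?D = "image_subcat A T F B"
  have BO: "B \<subseteq> Obj A" and Bsh: "\<And>X. X \<in> B \<Longrightarrow> ShO A X \<in> B" and ne: "B \<noteq> {}"
    using B by (auto simp: triangulated_subcat_def)
  have DE: "\<exists>X' \<in> B. isomorphic T (FO F X') X" if "X \<in> ?D" for X
    using that by (auto simp: image_subcat_def)
  have DI: "Y \<in> ?D" if "X \<in> B" "isomorphic T (FO F X) Y" for X Y
    using that T.isomorphic_Obj[OF that(2)] by (auto simp: image_subcat_def)
  show ?thesis unfolding triangulated_subcat_def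
  proof (intro conjI ballI impI allI)
    obtain X where "X \<in> B" using ne by blast
    then have "FO F X \<in> ?D" using DI[of X] T.isomorphic_refl Obj BO by blast
    then show "?D \<noteq> {}" by blast
    show "?D \<subseteq> Obj T" by (auto simp: image_subcat_def)
  next
    fix X assume "X \<in> ?D"
    then obtain X' where X': "X' \<in> B" "isomorphic T (FO F X') X" using DE by blast
    then have "isomorphic T (FO F (ShO A X')) (ShO T X)"
      using T.isomorphic_trans[OF Shift_isomorphic T.Sh.isomorphic[OF X'(2)]] BO by blast
    then show "ShO T X \<in> ?D" using DI Bsh X'(1) by blast
  next
    fix X Y assume "X \<in> ?D" and Y: "Y \<in> Obj T" and iso: "isomorphic T (ShO T Y) X"
    then obtain X' where X': "X' \<in> B" "isomorphic T (FO F X') X" using DE by blast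
    have "isomorphic T (ShO T Y) (FO F X')"
      using T.isomorphic_trans[OF iso T.isomorphic_sym[OF X'(2)]] .
    then show "Y \<in> ?D" using image_unshift[OF B X'(1) Y] by blast
  next
    fix X Y Z u v w assume d: "dist_triangle T X Y Z u v w" and X: "X \<in> ?D" and Z: "Z \<in> ?D"
    have Y: "Y \<in> Obj T" using T.dist_triangle_Obj[OF d] by blast
    note D = dist_triangleD[OF d]
    obtain X' i i' where X': "X' \<in> B" and i: "mutually_inverse T (FO F X') X i i'"
      using DE[OF X] unfolding isomorphic_iff by blast
    obtain Z' j j' where Z': "Z' \<in> B" and j: "mutually_inverse T (FO F Z') Z j j'"
      using DE[OF Z] unfolding isomorphic_iff by blast
    have O': "X' \<in> Obj A" "Z' \<in> Obj A" using X' Z' BO by auto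
    obtain h where h: "mutually_inverse T (FO F (ShO A X')) (ShO T (FO F X')) (Eta F X') h"
      using Eta_inverse[OF O'(1)] by blast
    define b b' where "b = h \<cdot>\<^bsub>T\<^esub> ShA T i'" and "b' = ShA T i \<cdot>\<^bsub>T\<^esub> Eta F X'"
    have b: "mutually_inverse T (ShO T X) (FO F (ShO A X')) b b'"
      unfolding b_def b'_def
      by (rule T.mutually_inverse_Cmp[OF mutually_inverse_sym[OF T.Sh.mutually_inverse[OF i]]
            mutually_inverse_sym[OF h]])
    note iD = mutually_inverseD[OF i] and jD = mutually_inverseD[OF j] and bD = mutually_inverseD[OF b]
    have "b \<cdot>\<^bsub>T\<^esub> (w \<cdot>\<^bsub>T\<^esub> j) \<in> Hom T (FO F Z') (FO F (ShO A X'))"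
      using bD jD D by (auto simp: Hom_iff)
    then obtain w' where w': "w' \<in> Hom A Z' (ShO A X')" "FA F w' = b \<cdot>\<^bsub>T\<^esub> (w \<cdot>\<^bsub>T\<^esub> j)"
      using full O' A.Sh.Obj by blast
    obtain V v' t' where d': "dist_triangle A Z' (ShO A X') V w' v' t'" using A.TR1_ex[OF w'(1)] by blast
    have V: "V \<in> B" using A.subcat_cone_closed[OF B d' Z' Bsh[OF X']] .
    obtain r s where r: "dist_triangle T Z (ShO T X) (ShO T Y) w r s"
      using T.rotate[OF T.rotate[OF d]] by blast
    have sq: "b \<cdot>\<^bsub>T\<^esub> w = FA F w' \<cdot>\<^bsub>T\<^esub> j'" using w'(2) bD jD D by simp
    have jH: "j' \<in> Hom T Z (FO F Z')" and bH: "b \<in> Hom T (ShO T X) (FO F (ShO A X'))"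
      using bD jD by (auto simp: Hom_iff)
    obtain c where c: "c \<in> Hom T (ShO T Y) (FO F V)" "c \<cdot>\<^bsub>T\<^esub> r = FA F v' \<cdot>\<^bsub>T\<^esub> b"
      "ShA T j' \<cdot>\<^bsub>T\<^esub> s = (Eta F Z' \<cdot>\<^bsub>T\<^esub> FA F t') \<cdot>\<^bsub>T\<^esub> c"
      using T.TR3[OF r dist[OF d'] jH bH sq] by blast
    have "is_iso T c" by (rule T.triangle_five[OF r dist[OF d'] mutually_inverse_sym[OF j] b c(1) sq c(2,3)])
    then have "isomorphic T (ShO T Y) (FO F V)" using c(1) by (auto simp: isomorphic_def)
    then show "Y \<in> ?D" using image_unshift[OF B V Y] by blast
  qed
qed

lemma image_subcat_reflect_subset:
  assumes "triangulated_subcat A B1" "triangulated_subcat A B2"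
    and sub: "image_subcat A T F B1 \<subseteq> image_subcat A T F B2"
  shows "B1 \<subseteq> B2"
proof
  fix X assume X: "X \<in> B1"
  then have XO: "X \<in> Obj A" using triangulated_subcat_Obj[OF assms(1)] by blast
  have "FO F X \<in> image_subcat A T F B1"
    using X Obj[OF XO] T.isomorphic_refl by (auto simp: image_subcat_def)
  then obtain Y where Y: "Y \<in> B2" "isomorphic T (FO F Y) (FO F X)" using sub by (auto simp: image_subcat_def)
  then have "isomorphic A Y X" using reflect_isomorphic XO triangulated_subcat_Obj[OF assms(2)] by blast
  then show "X \<in> B2" using A.subcat_iso_closed[OF assms(2) Y(1)] by blast
qed

text \<open>
  The lift through \<open>F\<close> of the inclusion of \<open>F(B)\<close> is an equivalence from \<open>F(B)\<close> to \<open>B\<close>.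
\<close>

lemma image_subcat_equivalent:
  assumes lin: "linear_functor K A T F" and B: "triangulated_subcat A B"
  obtains H where "exact_between K (full_subcat T (image_subcat A T F B)) (full_subcat A B) H"
    "linear_functor K (full_subcat T (image_subcat A T F B)) (full_subcat A B) H"
    "equivalence (full_subcat T (image_subcat A T F B)) (full_subcat A B) H"
proof -
  let ?D = "image_subcat A T F B"
  let ?S = "full_subcat T ?D"
  have D: "triangulated_subcat T ?D" using image_triangulated[OF B] .
  have BO: "B \<subseteq> Obj A" using B by (auto simp: triangulated_subcat_def)
  have inc: "exact_between K ?S T (id_gfunct T)"
    using exact_between_inclusion[OF T.linear_shift_category_axioms D] .
  interpret inc: exact_between K ?S T "id_gfunct T" by (fact inc)
  have ess: "\<exists>Y \<in> Obj A. isomorphic T (FO F Y) (FO (id_gfunct T) X)" if "X \<in> Obj ?S" for X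
    using that BO by (auto simp: image_subcat_def)
  obtain H where H: "exact_between K ?S A H" and g: "graded_iso ?S T (comp_gfunct T F H) (id_gfunct T)"
    using lift_exact[OF inc ess] by blast
  interpret H: exact_between K ?S A H by fact
  have linH: "linear_functor K ?S A H"
    using lift_linear[OF H inc lin linear_functor_inclusion[OF inc] g] .
  obtain \<theta> where n: "nat_iso ?S T (comp_gfunct T F H) (id_gfunct T) \<theta>"
    using graded_iso_nat_iso[OF g] by blast
  have FH: "isomorphic T (FO F (FO H X)) X" if "X \<in> ?D" for X
    using nat_iso_isomorphic[OF n, of X] that by simp
  have HB: "FO H X \<in> B" if X: "X \<in> ?D" for X
  proof -
    obtain Z where Z: "Z \<in> B" "isomorphic T (FO F Z) X" using X by (auto simp: image_subcat_def)
    then have "isomorphic T (FO F Z) (FO F (FO H X))"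
      using FH[OF X] T.isomorphic_trans T.isomorphic_sym by blast
    then have "isomorphic A Z (FO H X)" using reflect_isomorphic Z BO H.Obj[of X] X by auto
    then show ?thesis using A.subcat_iso_closed[OF B Z(1)] by blast
  qed
  have H': "exact_between K ?S (full_subcat A B) H"
    using exact_between_corestrict[OF H B] HB by simp
  interpret H': exact_between K ?S "full_subcat A B" H by fact
  have linH': "linear_functor K ?S (full_subcat A B) H"
    using linH H'.additive by (simp add: linear_functor_def)
  have "fully_faithful ?S T (id_gfunct T)" by (auto simp: fully_faithful_def bij_betw_def inj_on_def)
  then have "ff_functor ?S T (id_gfunct T)" using inc.functor_between_axioms ff_functorI by blast
  then have "fully_faithful ?S A H"
    using lift_fully_faithful[OF H.functor_between_axioms n] by blast
  then have "fully_faithful ?S (full_subcat A B) H" using HB by (simp add: fully_faithful_def)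
  moreover have "ess_surj ?S (full_subcat A B) H" unfolding ess_surj_def full_subcat_simps
  proof
    fix Y assume Y: "Y \<in> B"
    then have YO: "Y \<in> Obj A" using BO by blast
    have FY: "FO F Y \<in> ?D" using Y Obj[OF YO] T.isomorphic_refl by (auto simp: image_subcat_def)
    then have "isomorphic A (FO H (FO F Y)) Y"
      using reflect_isomorphic[OF FH[OF FY]] YO H.Obj[of "FO F Y"] by simp
    then show "\<exists>X\<in>?D. isomorphic (full_subcat A B) (FO H X) Y" using FY HB Y by auto
  qed
  ultimately have "equivalence ?S (full_subcat A B) H"
    using equivalence_iff[OF inc.Dom.category_axioms H'.Cod.category_axioms] H'.cat_functor by blast
  then show thesis using that H' linH' by blast
qed

end

lemma equivalence_comp_gfunct:
  assumes "category C" "category D" "category E" "equivalence C D F" "equivalence D E G"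
  shows "equivalence C E (comp_gfunct E G F)"
  using equivalence_comp[OF assms]
  by (simp add: equivalence_def comp_funct_def comp_gfunct_def cat_functor_def)

section \<open>The digraph of subcategories and induced maps\<close>

lemma wf_digraph_G: "wf_digraph (G_digraph K \<J> S)"
  by unfold_locales (auto simp: G_digraph_def)

lemma G_digraph_simps [simp]:
  "verts (G_digraph K \<J> S) = G_vertices K \<J> S"
  "tail (G_digraph K \<J> S) = fst" "head (G_digraph K \<J> S) = snd"
  by (simp_all add: G_digraph_def)

lemma G_verticesD: "B \<in> G_vertices K \<J> S \<Longrightarrow> triangulated_subcat S B"
  by (simp add: G_vertices_def)

lemma G_vertices_Obj: "B \<in> G_vertices K \<J> S \<Longrightarrow> B \<subseteq> Obj S"
  by (simp add: G_vertices_def triangulated_subcat_def)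

text \<open>A full subgraph is determined by its vertices.\<close>

lemma induced_subgraph_iff:
  "induced_subgraph B (G_digraph K \<J> S) \<longleftrightarrow>
     verts B \<subseteq> G_vertices K \<J> S \<and> B = G_digraph K \<J> S \<restriction> verts B"
proof
  assume "induced_subgraph B (G_digraph K \<J> S)"
  then show "verts B \<subseteq> G_vertices K \<J> S \<and> B = G_digraph K \<J> S \<restriction> verts B"
    by (auto simp: induced_subgraph_def subgraph_def compatible_def induce_subgraph_def
        intro!: pre_digraph.equality)
next
  assume "verts B \<subseteq> G_vertices K \<J> S \<and> B = G_digraph K \<J> S \<restriction> verts B"
  then show "induced_subgraph B (G_digraph K \<J> S)"
    using wf_digraph.induced_induce[OF wf_digraph_G] by (metis G_digraph_simps(1))
qed

text \<open>
  A fully faithful exact linear functor, together with the set \<open>\<J>\<close> of triangulated categories to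
  which the vertices of the digraphs are equivalent.
\<close>

locale linear_embedding = ff_exact K A T F
  for K :: "'k ring" and A :: "('o, 'm, 'k) tricat" and T :: "('p, 'n, 'k) tricat"
    and F :: "('o, 'm, 'p, 'n) gfunct" +
  fixes \<J> :: "('q, 'l, 'k) tricat set"
  assumes linear: "linear_functor K A T F"
    and \<J>: "\<And>J. J \<in> \<J> \<Longrightarrow> linear_triangulated_category K J"
begin

lemma vertex_image:
  assumes "B \<in> G_vertices K \<J> A"
  shows "image_subcat A T F B \<in> G_vertices K \<J> T"
proof -
  let ?D = "image_subcat A T F B"
  have B: "triangulated_subcat A B" using G_verticesD assms .
  obtain J E where J: "J \<in> \<J>" and E: "exact_functor (full_subcat A B) J E"
    "linear_functor K (full_subcat A B) J E" "equivalence (full_subcat A B) J E"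
    using assms by (auto simp: G_vertices_def linearly_exactly_equivalent_def)
  interpret J: linear_triangulated_category K J using \<J>[OF J] .
  have E': "exact_between K (full_subcat A B) J E"
    using exact_betweenI linear_shift_category_full_subcat[OF A.linear_shift_category_axioms B]
      J.linear_shift_category_axioms E(1) by blast
  interpret E: exact_between K "full_subcat A B" J E by fact
  obtain H where H: "exact_between K (full_subcat T ?D) (full_subcat A B) H"
    "linear_functor K (full_subcat T ?D) (full_subcat A B) H"
    "equivalence (full_subcat T ?D) (full_subcat A B) H"
    using image_subcat_equivalent[OF linear B] by blast
  interpret H: exact_between K "full_subcat T ?D" "full_subcat A B" H by fact
  let ?EH = "comp_gfunct J E H"
  have "exact_functor (full_subcat T ?D) J ?EH"
    using exact_between.exact[OF exact_between_comp[OF H(1) E']] .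
  moreover have "linear_functor K (full_subcat T ?D) J ?EH"
    using linear_functor_comp[OF H(2) E(2) H.functor_between_axioms E.functor_between_axioms] .
  moreover have "equivalence (full_subcat T ?D) J ?EH"
    using equivalence_comp_gfunct[OF H.Dom.category_axioms E.Dom.category_axioms J.category_axioms H(3) E(3)] .
  ultimately have "linearly_exactly_equivalent K (full_subcat T ?D) J"
    unfolding linearly_exactly_equivalent_def by blast
  then show ?thesis using J image_triangulated[OF B] by (auto simp: G_vertices_def)
qed

lemma vertex_image_inj: "inj_on (image_subcat A T F) (G_vertices K \<J> A)"
proof (rule inj_onI)
  fix B1 B2 assume B: "B1 \<in> G_vertices K \<J> A" "B2 \<in> G_vertices K \<J> A"
    and eq: "image_subcat A T F B1 = image_subcat A T F B2"
  note B' = B[THEN G_verticesD]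
  show "B1 = B2"
    using image_subcat_reflect_subset[OF B'] image_subcat_reflect_subset[OF B'(2,1)] eq by blast
qed

text \<open>Semiorthogonality of subcategories is preserved and reflected.\<close>

lemma Hom_image_zero_iff:
  assumes B: "triangulated_subcat A B1" "triangulated_subcat A B2"
  shows "(\<forall>Y1 \<in> image_subcat A T F B1. \<forall>Y2 \<in> image_subcat A T F B2. Hom T Y2 Y1 = {ZeroA T Y2 Y1})
     \<longleftrightarrow> (\<forall>X1 \<in> B1. \<forall>X2 \<in> B2. Hom A X2 X1 = {ZeroA A X2 X1})" (is "?L \<longleftrightarrow> ?R")
proof
  have zero: "FA F (ZeroA A X Y) = ZeroA T (FO F X) (FO F Y)" if "X \<in> Obj A" "Y \<in> Obj A" for X Y
    using additive_functor_zero[OF A.linear_category_axioms T.linear_category_axioms additive that] .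
  have O: "X \<in> Obj A" if "X \<in> B1 \<union> B2" for X
    using that triangulated_subcat_Obj[OF B(1)] triangulated_subcat_Obj[OF B(2)] by blast
  have I: "FO F X \<in> image_subcat A T F B" if "X \<in> B" "X \<in> Obj A" for X B
    using that Obj[OF that(2)] T.isomorphic_refl unfolding image_subcat_def by blast
  {
    assume L: ?L
    show ?R
    proof (intro ballI)
      fix X1 X2 assume X: "X1 \<in> B1" "X2 \<in> B2"
      have XO: "X1 \<in> Obj A" "X2 \<in> Obj A" using O X by auto
      have "f = ZeroA A X2 X1" if f: "f \<in> Hom A X2 X1" for f
      proof (rule faithful[OF f A.ZeroA_closed[OF XO(2,1)]])
        have "FA F f \<in> {ZeroA T (FO F X2) (FO F X1)}"
          using L Hom[OF f] I X XO by blast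
        then show "FA F f = FA F (ZeroA A X2 X1)" using zero XO by simp
      qed
      then show "Hom A X2 X1 = {ZeroA A X2 X1}" using A.ZeroA_closed[OF XO(2,1)] by blast
    qed
  next
    assume R: ?R
    show ?L
    proof (intro ballI)
      fix Y1 Y2 assume Y: "Y1 \<in> image_subcat A T F B1" "Y2 \<in> image_subcat A T F B2"
      obtain X1 i1 j1 where X1: "X1 \<in> B1" and m1: "mutually_inverse T (FO F X1) Y1 i1 j1"
        using Y(1) unfolding image_subcat_def isomorphic_iff by blast
      obtain X2 i2 j2 where X2: "X2 \<in> B2" and m2: "mutually_inverse T (FO F X2) Y2 i2 j2"
        using Y(2) unfolding image_subcat_def isomorphic_iff by blast
      note D1 = mutually_inverseD[OF m1] and D2 = mutually_inverseD[OF m2]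
      have XO: "X1 \<in> Obj A" "X2 \<in> Obj A" using O X1 X2 by auto
      have YO: "Y1 \<in> Obj T" "Y2 \<in> Obj T" using Y by (auto simp: image_subcat_def)
      have "f = ZeroA T Y2 Y1" if f: "f \<in> Hom T Y2 Y1" for f
      proof -
        have fD: "f \<in> Arr T" "Src T f = Y2" "Tgt T f = Y1" using f by (auto simp: Hom_iff)
        have "j1 \<cdot>\<^bsub>T\<^esub> (f \<cdot>\<^bsub>T\<^esub> i2) \<in> Hom T (FO F X2) (FO F X1)" using D1 D2 fD by (auto simp: Hom_iff)
        then obtain g where g: "g \<in> Hom A X2 X1" "FA F g = j1 \<cdot>\<^bsub>T\<^esub> (f \<cdot>\<^bsub>T\<^esub> i2)"
          using full XO by blast
        have "g = ZeroA A X2 X1" using R X1 X2 g(1) by blast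
        then have e: "j1 \<cdot>\<^bsub>T\<^esub> (f \<cdot>\<^bsub>T\<^esub> i2) = ZeroA T (FO F X2) (FO F X1)" using g(2) zero XO by simp
        have "f = i1 \<cdot>\<^bsub>T\<^esub> ((j1 \<cdot>\<^bsub>T\<^esub> (f \<cdot>\<^bsub>T\<^esub> i2)) \<cdot>\<^bsub>T\<^esub> j2)"
          using D1 D2 fD T.inverse_cancel[OF m1] T.inverse_cancel[OF m2] by simp
        also have "\<dots> = i1 \<cdot>\<^bsub>T\<^esub> ZeroA T Y2 (FO F X1)"
          using e T.zero_Cmp[of j2 Y2 "FO F X2" "FO F X1"] D2 XO by (simp add: Hom_iff)
        also have "\<dots> = ZeroA T Y2 Y1"
          using T.Cmp_zero[of i1 "FO F X1" Y1 Y2] D1 YO by (simp add: Hom_iff)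
        finally show ?thesis .
      qed
      then show "Hom T Y2 Y1 = {ZeroA T Y2 Y1}" using T.ZeroA_closed[OF YO(2,1)] by blast
    qed
  }
qed

lemma arc_image_iff:
  assumes B: "B1 \<in> G_vertices K \<J> A" "B2 \<in> G_vertices K \<J> A"
  shows "(image_subcat A T F B1, image_subcat A T F B2) \<in> arcs (G_digraph K \<J> T)
     \<longleftrightarrow> (B1, B2) \<in> arcs (G_digraph K \<J> A)"
proof -
  have "image_subcat A T F B1 = image_subcat A T F B2 \<longleftrightarrow> B1 = B2"
    using inj_on_eq_iff[OF vertex_image_inj B] .
  then show ?thesis
    using Hom_image_zero_iff[OF B[THEN G_verticesD]] vertex_image[OF B(1)] vertex_image[OF B(2)] B
    unfolding G_digraph_def pre_digraph.simps mem_Collect_eq case_prod_conv by simp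
qed

text \<open>The induced map sends full subgraphs to full subgraphs.\<close>

lemma app_iso_star:
  assumes V: "V \<subseteq> G_vertices K \<J> A"
  shows "app_iso (star A T F) (G_digraph K \<J> A \<restriction> V) = G_digraph K \<J> T \<restriction> (image_subcat A T F ` V)"
    (is "?L = ?R")
proof (rule pre_digraph.equality)
  let ?f = "image_subcat A T F"
  have L: "arcs ?L = map_prod ?f ?f ` {e \<in> arcs (G_digraph K \<J> A). fst e \<in> V \<and> snd e \<in> V}"
    by (simp add: star_def)
  have R: "arcs ?R = {e \<in> arcs (G_digraph K \<J> T). fst e \<in> ?f ` V \<and> snd e \<in> ?f ` V}" by simp
  have e: "(?f X, ?f Y) \<in> arcs (G_digraph K \<J> T) \<longleftrightarrow> (X, Y) \<in> arcs (G_digraph K \<J> A)"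
    if "X \<in> V" "Y \<in> V" for X Y using arc_image_iff that V by blast
  show "arcs ?L = arcs ?R"
  proof
    show "arcs ?L \<subseteq> arcs ?R" unfolding L R using e by auto
    show "arcs ?R \<subseteq> arcs ?L"
    proof
      fix p assume "p \<in> arcs ?R"
      then obtain X Y where "X \<in> V" "Y \<in> V" "p = (?f X, ?f Y)" "p \<in> arcs (G_digraph K \<J> T)"
        unfolding R by (cases p) auto
      then show "p \<in> arcs ?L" unfolding L using e by (auto intro!: image_eqI[of _ _ "(X, Y)"])
    qed
  qed
qed (simp_all add: star_def)

lemma Im_star_eq_app_iso: "Im_star K \<J> A T F = app_iso (star A T F) (G_digraph K \<J> A)"
proof -
  have "G_digraph K \<J> A \<restriction> G_vertices K \<J> A = G_digraph K \<J> A"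
    by (rule pre_digraph.equality) (auto simp: G_digraph_def)
  then show ?thesis using app_iso_star[of "G_vertices K \<J> A"] by (simp add: Im_star_def star_def)
qed

lemma verts_Im_star: "verts (Im_star K \<J> A T F) = image_subcat A T F ` G_vertices K \<J> A"
  by (simp add: Im_star_def star_def)

lemma Im_star_in_subgraphs: "Im_star K \<J> A T F \<in> subgraphs_iso_to K \<J> A T"
proof -
  have "inj_on (map_prod (image_subcat A T F) (image_subcat A T F)) (G_vertices K \<J> A \<times> G_vertices K \<J> A)"
    by (rule map_prod_inj_on[OF vertex_image_inj vertex_image_inj])
  moreover have "arcs (G_digraph K \<J> A) \<subseteq> G_vertices K \<J> A \<times> G_vertices K \<J> A"
    by (auto simp: G_digraph_def)
  ultimately have "pre_digraph.digraph_isomorphism (G_digraph K \<J> A) (star A T F)"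
    unfolding pre_digraph.digraph_isomorphism_def
    using wf_digraph_G vertex_image_inj inj_on_subset by (auto simp: star_def)
  then have "digraph_iso (G_digraph K \<J> A) (Im_star K \<J> A T F)"
    using Im_star_eq_app_iso unfolding digraph_iso_def by blast
  moreover have "induced_subgraph (Im_star K \<J> A T F) (G_digraph K \<J> T)"
    unfolding induced_subgraph_iff verts_Im_star using vertex_image by (auto simp: Im_star_def star_def)
  ultimately show ?thesis by (simp add: subgraphs_iso_to_def)
qed

end

lemma subgraphs_iso_toD:
  assumes "B \<in> subgraphs_iso_to K \<J> A T"
  shows "verts B \<subseteq> G_vertices K \<J> T" "B = G_digraph K \<J> T \<restriction> verts B"
  using assms unfolding subgraphs_iso_to_def induced_subgraph_iff by auto

section \<open>The group of auto-equivalences\<close>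

context linear_triangulated_category
begin

lemma autoequivalenceD:
  assumes "F \<in> autoequivalences C"
  shows "exact_between K C C F" "ff_exact K C C F" "ess_surj C C F" "equivalence C C F"
proof -
  have e: "exact_functor C C F" and q: "equivalence C C F" using assms by (auto simp: autoequivalences_def)
  then show "exact_between K C C F" "equivalence C C F"
    using exact_betweenI linear_shift_category_axioms by blast+
  have "fully_faithful C C F" "ess_surj C C F"
    using q equivalence_iff[OF category_axioms category_axioms] by blast+
  then show "ff_exact K C C F" "ess_surj C C F"
    using ff_exactI[OF linear_triangulated_category_axioms linear_triangulated_category_axioms e] by blast+
qed

lemma autoequivalenceI:
  assumes "exact_between K C C F" "fully_faithful C C F" "ess_surj C C F"
  shows "F \<in> autoequivalences C"
proof -
  interpret F: exact_between K C C F by fact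
  show ?thesis
    using assms equivalence_iff[OF category_axioms category_axioms] F.cat_functor F.exact
    by (auto simp: autoequivalences_def)
qed

lemma exact_between_id: "exact_between K C C (id_gfunct C)"
proof -
  have "nat_iso C C (comp_funct (id_gfunct C) (Shift C)) (comp_funct (Shift C) (id_gfunct C)) (Eta (id_gfunct C))"
    by (rule nat_isoI[of _ _ _ _ _ "\<lambda>X. Idn C (ShO C X)"]) (use mutually_inverse_refl Sh.Obj in auto)
  moreover have "additive_functor C C (id_gfunct C)"
    by (auto simp: additive_functor_def cat_functor_def Hom_iff)
  moreover have "dist_triangle C X Y Z u v (Idn C (ShO C X) \<cdot> w)" if "dist_triangle C X Y Z u v w" for X Y Z u v w
    using that dist_triangleD[of C X Y Z u v w] by simp
  ultimately have "exact_functor C C (id_gfunct C)" by (simp add: exact_functor_def)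
  then show ?thesis using exact_betweenI linear_shift_category_axioms by blast
qed

lemma linear_functor_id: "linear_functor K C C (id_gfunct C)"
  using exact_between.additive[OF exact_between_id] by (simp add: linear_functor_def)

lemma id_autoequivalence: "id_gfunct C \<in> autoequivalences C"
proof (rule autoequivalenceI[OF exact_between_id])
  show "fully_faithful C C (id_gfunct C)" by (auto simp: fully_faithful_def bij_betw_def inj_on_def)
  show "ess_surj C C (id_gfunct C)" using isomorphic_refl by (auto simp: ess_surj_def)
qed

lemma comp_autoequivalence:
  assumes "F \<in> autoequivalences C" "G \<in> autoequivalences C"
  shows "comp_gfunct C F G \<in> autoequivalences C"
proof -
  note F = autoequivalenceD[OF assms(1)] and G = autoequivalenceD[OF assms(2)]
  have "equivalence C C (comp_gfunct C F G)"
    using equivalence_comp_gfunct[OF category_axioms category_axioms category_axioms G(4) F(4)] .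
  moreover have "exact_functor C C (comp_gfunct C F G)"
    using exact_between.exact[OF exact_between_comp[OF G(1) F(1)]] .
  ultimately show ?thesis by (simp add: autoequivalences_def)
qed

lemma autoeq_rel_iff:
  "(F, G) \<in> autoeq_rel C \<longleftrightarrow> F \<in> autoequivalences C \<and> G \<in> autoequivalences C \<and> graded_iso C C F G"
  by (simp add: autoeq_rel_def)

lemma equiv_autoeq_rel: "equiv (autoequivalences C) (autoeq_rel C)"
proof (rule equivI)
  show "autoeq_rel C \<subseteq> autoequivalences C \<times> autoequivalences C" by (auto simp: autoeq_rel_def)
  show "refl_on (autoequivalences C) (autoeq_rel C)"
    using graded_iso_refl[OF autoequivalenceD(1)] by (auto simp: refl_on_def autoeq_rel_iff)
  show "sym (autoeq_rel C)"
    using graded_iso_sym[OF autoequivalenceD(1) autoequivalenceD(1)] by (auto simp: sym_def autoeq_rel_iff)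
  show "trans (autoeq_rel C)"
    using graded_iso_trans autoequivalenceD(1) unfolding trans_def autoeq_rel_iff by metis
qed

text \<open>The class of an auto-equivalence modulo graded natural isomorphism.\<close>

abbreviation autoeq_class :: "('o, 'm, 'o, 'm) gfunct \<Rightarrow> ('o, 'm, 'o, 'm) gfunct set" where
  "autoeq_class F \<equiv> autoeq_rel C `` {F}"

lemma autoeq_class_eq_iff:
  "F \<in> autoequivalences C \<Longrightarrow> G \<in> autoequivalences C \<Longrightarrow>
   autoeq_class F = autoeq_class G \<longleftrightarrow> graded_iso C C F G"
  using eq_equiv_class_iff[OF equiv_autoeq_rel] by (simp add: autoeq_rel_iff)

lemma autoeq_class_self: "F \<in> autoequivalences C \<Longrightarrow> F \<in> autoeq_class F"
  using equiv_class_self[OF equiv_autoeq_rel] .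

lemma graded_iso_comp:
  assumes "(F, F') \<in> autoeq_rel C" "(G, G') \<in> autoeq_rel C"
  shows "graded_iso C C (comp_gfunct C F G) (comp_gfunct C F' G')"
proof -
  have e: "exact_between K C C F" "exact_between K C C F'" "exact_between K C C G" "exact_between K C C G'"
    and i: "graded_iso C C F F'" "graded_iso C C G G'"
    using assms autoequivalenceD(1) by (auto simp: autoeq_rel_iff)
  note c = exact_between_comp
  show ?thesis
    by (rule graded_iso_trans[OF c[OF e(3,1)] c[OF e(3,2)] c[OF e(4,2)]
      graded_iso_comp_right[OF e(3,1,2) i(1)] graded_iso_comp_left[OF e(3,4,2) i(2)]])
qed

lemma mult_autoeq_class:
  assumes "F \<in> autoequivalences C" "G \<in> autoequivalences C"
  shows "mult (Aut C) (autoeq_class F) (autoeq_class G) = autoeq_class (comp_gfunct C F G)"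
proof -
  have "autoeq_class (comp_gfunct C F' G') = autoeq_class (comp_gfunct C F G)"
    if "F' \<in> autoeq_class F" "G' \<in> autoeq_class G" for F' G'
  proof -
    have r: "(F, F') \<in> autoeq_rel C" "(G, G') \<in> autoeq_rel C" using that by auto
    then have "F' \<in> autoequivalences C" "G' \<in> autoequivalences C" by (auto simp: autoeq_rel_iff)
    then show ?thesis
      using autoeq_class_eq_iff graded_iso_comp[OF r] comp_autoequivalence assms by metis
  qed
  then have "(\<Union>\<beta>\<in>autoeq_class F. \<Union>\<alpha>\<in>autoeq_class G. autoeq_class (comp_gfunct C \<beta> \<alpha>))
      = (\<Union>\<beta>\<in>autoeq_class F. \<Union>\<alpha>\<in>autoeq_class G. autoeq_class (comp_gfunct C F G))"
    by simp
  also have "\<dots> = autoeq_class (comp_gfunct C F G)"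
    using autoeq_class_self[OF assms(1)] autoeq_class_self[OF assms(2)] by blast
  finally show ?thesis by (simp add: Aut_def)
qed

text \<open>The lift of the identity through an auto-equivalence is a quasi-inverse of it.\<close>

lemma quasi_inverse:
  assumes F: "F \<in> autoequivalences C"
  obtains H where "H \<in> autoequivalences C" "graded_iso C C (comp_gfunct C F H) (id_gfunct C)"
    "linear_functor K C C F \<Longrightarrow> linear_functor K C C H"
proof -
  interpret F: ff_exact K C C F using autoequivalenceD(2)[OF F] .
  have ess: "\<exists>Y \<in> Obj C. isomorphic C (FO F Y) (FO (id_gfunct C) X)" if "X \<in> Obj C" for X
    using autoequivalenceD(3)[OF F] that by (simp add: ess_surj_def)
  obtain H where H: "exact_between K C C H" and g: "graded_iso C C (comp_gfunct C F H) (id_gfunct C)"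
    using F.lift_exact[OF exact_between_id ess] by blast
  interpret H: exact_between K C C H by fact
  obtain \<theta> where n: "nat_iso C C (comp_gfunct C F H) (id_gfunct C) \<theta>"
    using graded_iso_nat_iso[OF g] by blast
  interpret I: ff_exact K C C "id_gfunct C" using autoequivalenceD(2)[OF id_autoequivalence] .
  have "fully_faithful C C H"
    using F.lift_fully_faithful[OF H.functor_between_axioms n I.ff_functor_axioms] .
  moreover have "ess_surj C C H" unfolding ess_surj_def
  proof
    fix Y assume Y: "Y \<in> Obj C"
    have "isomorphic C (FO F (FO H (FO F Y))) (FO F Y)"
      using nat_iso_isomorphic[OF n, of "FO F Y"] Y by simp
    then have "isomorphic C (FO H (FO F Y)) Y" using F.reflect_isomorphic Y by simp
    then show "\<exists>X\<in>Obj C. isomorphic C (FO H X) Y" using F.Obj[OF Y] by blast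
  qed
  ultimately have "H \<in> autoequivalences C" using autoequivalenceI H by blast
  then show thesis using that g F.lift_linear[OF H exact_between_id _ linear_functor_id g] by blast
qed

lemma AutK_simps [simp]:
  "carrier (AutK K C) = {autoeq_class F | F. F \<in> autoequivalences C \<and> linear_functor K C C F}"
  "mult (AutK K C) = mult (Aut C)" "one (AutK K C) = autoeq_class (id_gfunct C)"
  by (simp_all add: AutK_def Aut_def)

lemma comp_linear:
  assumes "F \<in> autoequivalences C" "G \<in> autoequivalences C"
    and "linear_functor K C C F" "linear_functor K C C G"
  shows "linear_functor K C C (comp_gfunct C F G)"
proof -
  interpret F: exact_between K C C F using autoequivalenceD(1)[OF assms(1)] .
  interpret G: exact_between K C C G using autoequivalenceD(1)[OF assms(2)] .
  show ?thesis
    using linear_functor_comp[OF assms(4,3) G.functor_between_axioms F.functor_between_axioms] .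
qed

lemma comp_gfunct_assoc:
  assumes "F \<in> autoequivalences C" "G \<in> autoequivalences C" "H \<in> autoequivalences C"
  shows "graded_iso C C (comp_gfunct C (comp_gfunct C F G) H) (comp_gfunct C F (comp_gfunct C G H))"
proof -
  interpret F: exact_between K C C F using autoequivalenceD(1)[OF assms(1)] .
  interpret G: exact_between K C C G using autoequivalenceD(1)[OF assms(2)] .
  interpret H: exact_between K C C H using autoequivalenceD(1)[OF assms(3)] .
  have "exact_between K C C (comp_gfunct C (comp_gfunct C F G) H)"
    using exact_between_comp H.exact_between_axioms G.exact_between_axioms F.exact_between_axioms by blast
  then show ?thesis by (rule graded_iso_eqI) simp_all
qed

lemma comp_gfunct_id:
  assumes "F \<in> autoequivalences C"
  shows "graded_iso C C (comp_gfunct C (id_gfunct C) F) F" "graded_iso C C (comp_gfunct C F (id_gfunct C)) F"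
proof -
  interpret F: exact_between K C C F using autoequivalenceD(1)[OF assms(1)] .
  show "graded_iso C C (comp_gfunct C (id_gfunct C) F) F"
    by (rule graded_iso_eqI[OF exact_between_comp[OF F.exact_between_axioms exact_between_id]]) simp_all
  show "graded_iso C C (comp_gfunct C F (id_gfunct C)) F"
    by (rule graded_iso_eqI[OF exact_between_comp[OF exact_between_id F.exact_between_axioms]]) simp_all
qed

lemma group_AutK: "group (AutK K C)"
proof -
  let ?G = "AutK K C"
  note cl = comp_autoequivalence
  have m: "x \<otimes>\<^bsub>?G\<^esub> y \<in> carrier ?G" if xy: "x \<in> carrier ?G" "y \<in> carrier ?G" for x y
  proof -
    obtain F G where FG: "F \<in> autoequivalences C" "G \<in> autoequivalences C"
      "linear_functor K C C F" "linear_functor K C C G" "x = autoeq_class F" "y = autoeq_class G"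
      using xy by auto
    then have "x \<otimes>\<^bsub>?G\<^esub> y = autoeq_class (comp_gfunct C F G)" by (simp add: mult_autoeq_class)
    then show ?thesis using comp_linear[OF FG(1-4)] cl[OF FG(1,2)] by auto
  qed
  have one: "\<one>\<^bsub>?G\<^esub> \<in> carrier ?G" using id_autoequivalence linear_functor_id by auto
  have assoc: "x \<otimes>\<^bsub>?G\<^esub> y \<otimes>\<^bsub>?G\<^esub> z = x \<otimes>\<^bsub>?G\<^esub> (y \<otimes>\<^bsub>?G\<^esub> z)"
    if xyz: "x \<in> carrier ?G" "y \<in> carrier ?G" "z \<in> carrier ?G" for x y z
  proof -
    obtain F G H where "F \<in> autoequivalences C" "G \<in> autoequivalences C" "H \<in> autoequivalences C"
      "x = autoeq_class F" "y = autoeq_class G" "z = autoeq_class H" using xyz by auto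
    then show ?thesis using cl comp_gfunct_assoc by (simp add: mult_autoeq_class autoeq_class_eq_iff)
  qed
  have l_one: "\<one>\<^bsub>?G\<^esub> \<otimes>\<^bsub>?G\<^esub> x = x" and r_one: "x \<otimes>\<^bsub>?G\<^esub> \<one>\<^bsub>?G\<^esub> = x" if x: "x \<in> carrier ?G" for x
  proof -
    obtain F where F: "F \<in> autoequivalences C" "x = autoeq_class F" using x by auto
    note I = id_autoequivalence
    show "\<one>\<^bsub>?G\<^esub> \<otimes>\<^bsub>?G\<^esub> x = x"
      using autoeq_class_eq_iff[OF cl[OF I F(1)] F(1)] comp_gfunct_id(1)[OF F(1)] F
      by (simp add: mult_autoeq_class[OF I F(1)])
    show "x \<otimes>\<^bsub>?G\<^esub> \<one>\<^bsub>?G\<^esub> = x"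
      using autoeq_class_eq_iff[OF cl[OF F(1) I] F(1)] comp_gfunct_id(2)[OF F(1)] F
      by (simp add: mult_autoeq_class[OF F(1) I])
  qed
  have r_inv: "\<exists>y \<in> carrier ?G. x \<otimes>\<^bsub>?G\<^esub> y = \<one>\<^bsub>?G\<^esub>" if x: "x \<in> carrier ?G" for x
  proof -
    obtain F where F: "F \<in> autoequivalences C" "linear_functor K C C F" "x = autoeq_class F"
      using x by auto
    obtain H where H: "H \<in> autoequivalences C" "graded_iso C C (comp_gfunct C F H) (id_gfunct C)"
      "linear_functor K C C H" using quasi_inverse[OF F(1)] F(2) by blast
    then have "x \<otimes>\<^bsub>?G\<^esub> autoeq_class H = \<one>\<^bsub>?G\<^esub>"
      using F cl id_autoequivalence by (simp add: mult_autoeq_class autoeq_class_eq_iff)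
    then show ?thesis using H by auto
  qed
  show ?thesis
  proof (rule groupI[OF m one assoc l_one])
    fix x assume x: "x \<in> carrier ?G"
    obtain y where y: "y \<in> carrier ?G" "x \<otimes>\<^bsub>?G\<^esub> y = \<one>\<^bsub>?G\<^esub>" using r_inv[OF x] by blast
    obtain z where z: "z \<in> carrier ?G" "y \<otimes>\<^bsub>?G\<^esub> z = \<one>\<^bsub>?G\<^esub>" using r_inv[OF y(1)] by blast
    \<comment> \<open>A right inverse of a right inverse of \<open>x\<close> is \<open>x\<close> itself.\<close>
    have "x = z" using assoc[OF x y(1) z(1)] y z l_one r_one x by metis
    then show "\<exists>y \<in> carrier ?G. y \<otimes>\<^bsub>?G\<^esub> x = \<one>\<^bsub>?G\<^esub>" using y z by blast
  qed
qed

text \<open>Every functor in a class of \<open>AutK\<close> is linear.\<close>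

lemma AutK_member:
  assumes "b \<in> carrier (AutK K C)" "\<beta> \<in> b"
  shows "\<beta> \<in> autoequivalences C" "linear_functor K C C \<beta>" "b = autoeq_class \<beta>"
proof -
  obtain F where F: "F \<in> autoequivalences C" "linear_functor K C C F" "b = autoeq_class F"
    using assms(1) by auto
  then have r: "\<beta> \<in> autoequivalences C" "graded_iso C C F \<beta>" using assms(2) by (auto simp: autoeq_rel_iff)
  interpret F: exact_between K C C F using autoequivalenceD(1)[OF F(1)] .
  interpret \<beta>: exact_between K C C \<beta> using autoequivalenceD(1)[OF r(1)] .
  obtain \<theta> where "nat_iso C C F \<beta> \<theta>" using graded_iso_nat_iso[OF r(2)] by blast
  then show "linear_functor K C C \<beta>"
    using linear_nat_iso[OF F.functor_between_axioms \<beta>.functor_between_axioms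
      linear_shift_category_axioms linear_category_axioms] F(2) by blast
  show "\<beta> \<in> autoequivalences C" "b = autoeq_class \<beta>" using r F autoeq_class_eq_iff by auto
qed

end

section \<open>Fully faithful functors and their images\<close>

text \<open>
  Two triangulated categories, a set \<open>\<J>\<close> of triangulated categories whose copies in \<open>A\<close> generate
  \<open>A\<close>, and a group \<open>\<Gamma>\<close> of classes of linear auto-equivalences of \<open>T\<close>.
\<close>

locale subcategory_graphs = A: linear_triangulated_category K A + T: linear_triangulated_category K T
  for K :: "'k ring" and A :: "('o, 'm, 'k) tricat" and T :: "('p, 'n, 'k) tricat" +
  fixes \<J> :: "('q, 'l, 'k) tricat set" and \<Gamma> :: "('p, 'n, 'p, 'n) gfunct set set"
  assumes \<J>: "\<And>J. J \<in> \<J> \<Longrightarrow> linear_triangulated_category K J"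
    and \<Gamma>: "subgroup \<Gamma> (AutK K T)"
    and generated: "generated_subcat A (\<Union>(G_vertices K \<J> A)) = Obj A"
begin

lemma linear_embeddingI:
  "ff_exact K C D F \<Longrightarrow> linear_functor K C D F \<Longrightarrow> linear_embedding K C D F \<J>"
  using \<J> by (simp add: linear_embedding_def linear_embedding_axioms_def)

lemma \<Gamma>_member:
  assumes "b \<in> \<Gamma>" "\<beta> \<in> b"
  shows "\<beta> \<in> autoequivalences T" "linear_functor K T T \<beta>" "b = T.autoeq_class \<beta>"
  using T.AutK_member[of b \<beta>] subgroup.subset[OF \<Gamma>] assms by blast+

lemma \<Gamma>_exact: "b \<in> \<Gamma> \<Longrightarrow> \<beta> \<in> b \<Longrightarrow> exact_between K T T \<beta>"
  using T.autoequivalenceD(1) \<Gamma>_member(1) by blast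

lemma \<Gamma>_embedding: "b \<in> \<Gamma> \<Longrightarrow> \<beta> \<in> b \<Longrightarrow> linear_embedding K T T \<beta> \<J>"
  using linear_embeddingI T.autoequivalenceD(2) \<Gamma>_member by blast

lemma ff_functors_embedding: "F \<in> ff_functors K A T \<Longrightarrow> linear_embedding K A T F \<J>"
  using linear_embeddingI[OF
      ff_exactI[OF A.linear_triangulated_category_axioms T.linear_triangulated_category_axioms]]
  by (simp add: ff_functors_def)

lemma image_subcat_autoeq:
  assumes "(\<beta>, \<beta>') \<in> autoeq_rel T" "B \<in> G_vertices K \<J> T"
  shows "image_subcat T T \<beta> B = image_subcat T T \<beta>' B"
proof -
  obtain \<theta> where "nat_iso T T \<beta> \<beta>' \<theta>" using assms(1) graded_iso_nat_iso T.autoeq_rel_iff by blast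
  moreover have "B \<subseteq> Obj T" using G_vertices_Obj[OF assms(2)] .
  ultimately show ?thesis using image_subcat_nat_iso T.category_axioms by blast
qed

text \<open>
  Both sides of \<open>\<beta>\<^sub>*(B\<^sub>1) = B\<^sub>2\<close> are full subgraphs, so the equality can be tested on vertices.
\<close>

lemma subgraph_rel_iff:
  "(B1, B2) \<in> subgraph_rel K \<J> A T \<Gamma> \<longleftrightarrow>
     B1 \<in> subgraphs_iso_to K \<J> A T \<and> B2 \<in> subgraphs_iso_to K \<J> A T \<and>
     (\<exists>b \<in> \<Gamma>. \<exists>\<beta> \<in> b. image_subcat T T \<beta> ` verts B1 = verts B2)"
proof -
  have "app_iso (star T T \<beta>) B1 = B2 \<longleftrightarrow> image_subcat T T \<beta> ` verts B1 = verts B2"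
    if B: "B1 \<in> subgraphs_iso_to K \<J> A T" "B2 \<in> subgraphs_iso_to K \<J> A T" and b: "b \<in> \<Gamma>" "\<beta> \<in> b" for b \<beta>
  proof
    assume "app_iso (star T T \<beta>) B1 = B2"
    then show "image_subcat T T \<beta> ` verts B1 = verts B2" by (auto simp: star_def)
  next
    assume v: "image_subcat T T \<beta> ` verts B1 = verts B2"
    interpret linear_embedding K T T \<beta> \<J> using \<Gamma>_embedding[OF b] .
    note B1 = subgraphs_iso_toD[OF B(1)] and B2 = subgraphs_iso_toD[OF B(2)]
    have "app_iso (star T T \<beta>) B1 = app_iso (star T T \<beta>) (G_digraph K \<J> T \<restriction> verts B1)"
      using B1(2) by simp
    also have "\<dots> = G_digraph K \<J> T \<restriction> verts B2" using app_iso_star[OF B1(1)] v by simp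
    also have "\<dots> = B2" using B2(2) by simp
    finally show "app_iso (star T T \<beta>) B1 = B2" .
  qed
  then show ?thesis unfolding subgraph_rel_def by blast
qed

lemma \<Gamma>_id:
  obtains b where "b \<in> \<Gamma>" "id_gfunct T \<in> b"
  using that[of "T.autoeq_class (id_gfunct T)"] subgroup.one_closed[OF \<Gamma>]
    T.autoeq_class_self[OF T.id_autoequivalence] by simp

lemma \<Gamma>_comp:
  assumes "b \<in> \<Gamma>" "\<beta> \<in> b" "b' \<in> \<Gamma>" "\<beta>' \<in> b'"
  obtains c where "c \<in> \<Gamma>" "comp_gfunct T \<beta>' \<beta> \<in> c"
proof -
  note m = \<Gamma>_member[OF assms(1,2)] and m' = \<Gamma>_member[OF assms(3,4)]
  have "b' \<otimes>\<^bsub>AutK K T\<^esub> b \<in> \<Gamma>" using subgroup.m_closed[OF \<Gamma> assms(3,1)] .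
  then have "T.autoeq_class (comp_gfunct T \<beta>' \<beta>) \<in> \<Gamma>"
    using m(3) m'(3) T.mult_autoeq_class[OF m'(1) m(1)] by simp
  then show thesis
    using that T.autoeq_class_self[OF T.comp_autoequivalence[OF m'(1) m(1)]] by blast
qed

lemma \<Gamma>_inverse:
  assumes "b \<in> \<Gamma>" "\<beta> \<in> b"
  obtains b' \<beta>' where "b' \<in> \<Gamma>" "\<beta>' \<in> b'" "(comp_gfunct T \<beta>' \<beta>, id_gfunct T) \<in> autoeq_rel T"
proof -
  note m = \<Gamma>_member[OF assms]
  interpret G: group "AutK K T" using T.group_AutK .
  define b' where "b' = inv\<^bsub>AutK K T\<^esub> b"
  have b: "b \<in> carrier (AutK K T)" using subgroup.subset[OF \<Gamma>] assms(1) by blast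
  have b': "b' \<in> \<Gamma>" using subgroup.m_inv_closed[OF \<Gamma> assms(1)] by (simp add: b'_def)
  then have "b' \<in> carrier (AutK K T)" using subgroup.subset[OF \<Gamma>] by blast
  then obtain \<beta>' where \<beta>': "\<beta>' \<in> b'" using T.autoeq_class_self by auto
  note m' = \<Gamma>_member[OF b' \<beta>']
  have "b' \<otimes>\<^bsub>AutK K T\<^esub> b = \<one>\<^bsub>AutK K T\<^esub>" using G.l_inv[OF b] by (simp add: b'_def)
  then have "T.autoeq_class (comp_gfunct T \<beta>' \<beta>) = T.autoeq_class (id_gfunct T)"
    using m(3) m'(3) T.mult_autoeq_class[OF m'(1) m(1)] by simp
  then have "graded_iso T T (comp_gfunct T \<beta>' \<beta>) (id_gfunct T)"
    using T.autoeq_class_eq_iff T.comp_autoequivalence[OF m'(1) m(1)] T.id_autoequivalence by blast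
  then show thesis
    using that b' \<beta>' T.autoeq_rel_iff T.comp_autoequivalence[OF m'(1) m(1)] T.id_autoequivalence by blast
qed

lemma image_subcat_comp_vertices:
  assumes "exact_between K C T F" "exact_between K T T \<beta>" "V \<subseteq> G_vertices K \<J> C"
  shows "image_subcat C T (comp_gfunct T \<beta> F) ` V = image_subcat T T \<beta> ` image_subcat C T F ` V"
proof -
  interpret F: exact_between K C T F by fact
  interpret \<beta>: exact_between K T T \<beta> by fact
  have "B \<subseteq> Obj C" if "B \<in> V" for B
    using that assms(3) G_vertices_Obj by blast
  then have "image_subcat C T (comp_gfunct T \<beta> F) B = image_subcat T T \<beta> (image_subcat C T F B)" if "B \<in> V" for B
    using image_subcat_comp[OF F.functor_between_axioms \<beta>.functor_between_axioms] that by blast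
  then show ?thesis unfolding image_image by (rule image_cong[OF refl])
qed

lemma image_subcat_id_vertices:
  assumes "V \<subseteq> G_vertices K \<J> T"
  shows "image_subcat T T (id_gfunct T) ` V = V"
proof -
  have "image_subcat T T (id_gfunct T) B = B" if "B \<in> V" for B
    using T.image_subcat_id[OF G_verticesD] that assms by blast
  then show ?thesis by simp
qed

lemma equiv_subgraph_rel: "equiv (subgraphs_iso_to K \<J> A T) (subgraph_rel K \<J> A T \<Gamma>)"
proof (rule equivI)
  show "subgraph_rel K \<J> A T \<Gamma> \<subseteq> subgraphs_iso_to K \<J> A T \<times> subgraphs_iso_to K \<J> A T"
    by (auto simp: subgraph_rel_def)
  show "refl_on (subgraphs_iso_to K \<J> A T) (subgraph_rel K \<J> A T \<Gamma>)"
  proof (rule refl_onI)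
    fix B assume B: "B \<in> subgraphs_iso_to K \<J> A T"
    obtain b where "b \<in> \<Gamma>" "id_gfunct T \<in> b" by (rule \<Gamma>_id)
    then show "(B, B) \<in> subgraph_rel K \<J> A T \<Gamma>"
      using B image_subcat_id_vertices[OF subgraphs_iso_toD(1)[OF B]] unfolding subgraph_rel_iff by blast
  qed
  show "sym (subgraph_rel K \<J> A T \<Gamma>)"
  proof (rule symI)
    fix B1 B2 assume "(B1, B2) \<in> subgraph_rel K \<J> A T \<Gamma>"
    then obtain b \<beta> where B: "B1 \<in> subgraphs_iso_to K \<J> A T" "B2 \<in> subgraphs_iso_to K \<J> A T"
      and b: "b \<in> \<Gamma>" "\<beta> \<in> b" and v: "image_subcat T T \<beta> ` verts B1 = verts B2"
      unfolding subgraph_rel_iff by blast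
    obtain b' \<beta>' where b': "b' \<in> \<Gamma>" "\<beta>' \<in> b'"
      and r: "(comp_gfunct T \<beta>' \<beta>, id_gfunct T) \<in> autoeq_rel T" using \<Gamma>_inverse[OF b] by blast
    note V = subgraphs_iso_toD(1)[OF B(1)]
    have "image_subcat T T \<beta>' ` verts B2 = image_subcat T T (comp_gfunct T \<beta>' \<beta>) ` verts B1"
      using image_subcat_comp_vertices[OF \<Gamma>_exact[OF b] \<Gamma>_exact[OF b'] V] v by simp
    also have "\<dots> = image_subcat T T (id_gfunct T) ` verts B1"
      using image_subcat_autoeq[OF r] V by (intro image_cong) auto
    also have "\<dots> = verts B1" using image_subcat_id_vertices[OF V] .
    finally show "(B2, B1) \<in> subgraph_rel K \<J> A T \<Gamma>" using B b' unfolding subgraph_rel_iff by blast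
  qed
  show "trans (subgraph_rel K \<J> A T \<Gamma>)"
  proof (rule transI)
    fix B1 B2 B3
    assume r: "(B1, B2) \<in> subgraph_rel K \<J> A T \<Gamma>" and r': "(B2, B3) \<in> subgraph_rel K \<J> A T \<Gamma>"
    have B: "B1 \<in> subgraphs_iso_to K \<J> A T" "B3 \<in> subgraphs_iso_to K \<J> A T"
      using r r' unfolding subgraph_rel_iff by blast+
    obtain b \<beta> where b: "b \<in> \<Gamma>" "\<beta> \<in> b" and v: "image_subcat T T \<beta> ` verts B1 = verts B2"
      using r unfolding subgraph_rel_iff by blast
    obtain b' \<beta>' where b': "b' \<in> \<Gamma>" "\<beta>' \<in> b'" and v': "image_subcat T T \<beta>' ` verts B2 = verts B3"
      using r' unfolding subgraph_rel_iff by blast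
    obtain c where c: "c \<in> \<Gamma>" "comp_gfunct T \<beta>' \<beta> \<in> c" using \<Gamma>_comp[OF b b'] by blast
    have "image_subcat T T (comp_gfunct T \<beta>' \<beta>) ` verts B1 = verts B3"
      using image_subcat_comp_vertices[OF \<Gamma>_exact[OF b] \<Gamma>_exact[OF b'] subgraphs_iso_toD(1)[OF B(1)]] v v'
      by simp
    then show "(B1, B3) \<in> subgraph_rel K \<J> A T \<Gamma>" using B c unfolding subgraph_rel_iff by blast
  qed
qed

text \<open>A linear auto-equivalence of \<open>A\<close> permutes the vertices.\<close>

lemma autoequivalence_permutes_vertices:
  assumes \<alpha>: "\<alpha> \<in> autoequivalences A" and lin: "linear_functor K A A \<alpha>"
  shows "image_subcat A A \<alpha> ` G_vertices K \<J> A = G_vertices K \<J> A"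
proof
  interpret \<alpha>: linear_embedding K A A \<alpha> \<J> using linear_embeddingI[OF A.autoequivalenceD(2)[OF \<alpha>] lin] .
  show "image_subcat A A \<alpha> ` G_vertices K \<J> A \<subseteq> G_vertices K \<J> A" using \<alpha>.vertex_image by blast
  obtain \<gamma> where \<gamma>: "\<gamma> \<in> autoequivalences A" "linear_functor K A A \<gamma>"
    and g: "graded_iso A A (comp_gfunct A \<alpha> \<gamma>) (id_gfunct A)" using A.quasi_inverse[OF \<alpha>] lin by blast
  interpret \<gamma>: linear_embedding K A A \<gamma> \<J> using linear_embeddingI[OF A.autoequivalenceD(2)[OF \<gamma>(1)] \<gamma>(2)] .
  obtain \<theta> where n: "nat_iso A A (comp_gfunct A \<alpha> \<gamma>) (id_gfunct A) \<theta>" using graded_iso_nat_iso[OF g] by blast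
  show "G_vertices K \<J> A \<subseteq> image_subcat A A \<alpha> ` G_vertices K \<J> A"
  proof
    fix B assume B: "B \<in> G_vertices K \<J> A"
    have BO: "B \<subseteq> Obj A" using G_vertices_Obj[OF B] .
    have "image_subcat A A \<alpha> (image_subcat A A \<gamma> B) = image_subcat A A (comp_gfunct A \<alpha> \<gamma>) B"
      using image_subcat_comp[OF \<gamma>.functor_between_axioms \<alpha>.functor_between_axioms BO] by simp
    also have "\<dots> = image_subcat A A (id_gfunct A) B"
      using image_subcat_nat_iso[OF A.category_axioms n BO] .
    also have "\<dots> = B" using A.image_subcat_id[OF G_verticesD[OF B]] .
    finally show "B \<in> image_subcat A A \<alpha> ` G_vertices K \<J> A" using \<gamma>.vertex_image[OF B] by blast
  qed
qed

text \<open>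
  Since the vertices generate \<open>A\<close>, the essential image of an exact functor is controlled by its
  values on the vertices.
\<close>

lemma generated_essential_image:
  assumes "ff_exact K A T F" "exact_triangulated K A T G"
    and "\<And>B. B \<in> G_vertices K \<J> A \<Longrightarrow> image_subcat A T G B \<subseteq> image_subcat A T F (Obj A)"
    and X: "X \<in> Obj A"
  shows "\<exists>Y \<in> Obj A. isomorphic T (FO F Y) (FO G X)"
proof -
  interpret F: ff_exact K A T F by fact
  interpret G: exact_triangulated K A T G by fact
  let ?P = "{X \<in> Obj A. FO G X \<in> image_subcat A T F (Obj A)}"
  have P: "triangulated_subcat A ?P"
    using G.preimage_triangulated[OF F.image_triangulated]
      triangulated_subcat_whole[OF A.linear_triangulated_category_axioms] by blast
  have "\<Union>(G_vertices K \<J> A) \<subseteq> ?P"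
  proof
    fix Y assume "Y \<in> \<Union>(G_vertices K \<J> A)"
    then obtain B where B: "B \<in> G_vertices K \<J> A" "Y \<in> B" by blast
    have Y: "Y \<in> Obj A" using triangulated_subcat_Obj[OF G_verticesD[OF B(1)] B(2)] .
    have "FO G Y \<in> image_subcat A T G B"
      using B(2) T.isomorphic_refl G.Obj[OF Y] unfolding image_subcat_def by blast
    then show "Y \<in> ?P" using assms(3)[OF B(1)] Y by blast
  qed
  then have "generated_subcat A (\<Union>(G_vertices K \<J> A)) \<subseteq> ?P"
    using P unfolding generated_subcat_def by blast
  then have "FO G X \<in> image_subcat A T F (Obj A)" using generated X by blast
  then show ?thesis by (auto simp: image_subcat_def)
qed

text \<open>
  If \<open>F \<alpha> \<cong> \<beta> F'\<close>, then \<open>\<alpha>\<close> permutes the vertices of the digraph of \<open>A\<close>, and hence \<open>\<beta>\<^sub>*\<close> maps the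
  image of \<open>F'\<^sub>*\<close> to the image of \<open>F\<^sub>*\<close>.
\<close>

lemma C_rel_imp_subgraph_rel:
  assumes "(F, F') \<in> C_rel K A T \<Gamma>"
  shows "(Im_star K \<J> A T F', Im_star K \<J> A T F) \<in> subgraph_rel K \<J> A T \<Gamma>"
proof -
  let ?V = "G_vertices K \<J> A"
  obtain a \<alpha> b \<beta> where F: "F \<in> ff_functors K A T" and F': "F' \<in> ff_functors K A T"
    and a: "a \<in> carrier (Aut A)" "\<alpha> \<in> a" and b: "b \<in> \<Gamma>" "\<beta> \<in> b"
    and g: "graded_iso A T (comp_gfunct T F \<alpha>) (comp_gfunct T \<beta> F')"
    using assms by (auto simp: C_rel_def)
  interpret F: linear_embedding K A T F \<J> using ff_functors_embedding[OF F] .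
  interpret F': linear_embedding K A T F' \<J> using ff_functors_embedding[OF F'] .
  interpret \<beta>: linear_embedding K T T \<beta> \<J> using \<Gamma>_embedding[OF b] .
  have \<alpha>: "\<alpha> \<in> autoequivalences A"
    using a in_quotient_imp_subset[OF A.equiv_autoeq_rel] by (auto simp: Aut_def)
  interpret \<alpha>: ff_exact K A A \<alpha> using A.autoequivalenceD(2)[OF \<alpha>] .
  have \<beta>F': "exact_between K A T (comp_gfunct T \<beta> F')"
    using exact_between_comp[OF F'.exact_between_axioms \<beta>.exact_between_axioms] .
  \<comment> \<open>Although \<open>\<alpha>\<close> is not assumed to be linear, it is a lift of a linear functor.\<close>
  have "linear_functor K A T (comp_gfunct T \<beta> F')"
    using linear_functor_comp[OF F'.linear \<beta>.linear F'.functor_between_axioms \<beta>.functor_between_axioms] .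
  then have lin: "linear_functor K A A \<alpha>"
    using F.lift_linear[OF \<alpha>.exact_between_axioms \<beta>F' F.linear _ g] by blast
  obtain \<theta> where n: "nat_iso A T (comp_gfunct T F \<alpha>) (comp_gfunct T \<beta> F') \<theta>"
    using graded_iso_nat_iso[OF g] by blast
  note VO = G_vertices_Obj[of _ K \<J> A]
  have "image_subcat T T \<beta> ` image_subcat A T F' ` ?V = image_subcat A T (comp_gfunct T \<beta> F') ` ?V"
    using image_subcat_comp_vertices[OF F'.exact_between_axioms \<beta>.exact_between_axioms subset_refl] by simp
  also have "\<dots> = image_subcat A T (comp_gfunct T F \<alpha>) ` ?V"
    using image_subcat_nat_iso[OF T.category_axioms n] VO by (intro image_cong) auto
  also have "\<dots> = image_subcat A T F ` image_subcat A A \<alpha> ` ?V"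
    using image_subcat_comp[OF \<alpha>.functor_between_axioms F.functor_between_axioms] VO
    unfolding image_image by (intro image_cong) auto
  also have "\<dots> = image_subcat A T F ` ?V" using autoequivalence_permutes_vertices[OF \<alpha> lin] by simp
  finally show ?thesis
    unfolding subgraph_rel_iff F.verts_Im_star F'.verts_Im_star
    using F.Im_star_in_subgraphs F'.Im_star_in_subgraphs b by blast
qed

text \<open>
  Conversely, if \<open>\<beta>\<^sub>*\<close> maps the image of \<open>F'\<^sub>*\<close> to the image of \<open>F\<^sub>*\<close>, then \<open>F\<close> and \<open>\<beta> F'\<close> have the
  same essential image, and the lift \<open>\<alpha>\<close> of \<open>\<beta> F'\<close> through \<open>F\<close> is the required auto-equivalence.
\<close>

lemma subgraph_rel_imp_C_rel:
  assumes F: "F \<in> ff_functors K A T" and F': "F' \<in> ff_functors K A T"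
    and r: "(Im_star K \<J> A T F', Im_star K \<J> A T F) \<in> subgraph_rel K \<J> A T \<Gamma>"
  shows "(F, F') \<in> C_rel K A T \<Gamma>"
proof -
  let ?V = "G_vertices K \<J> A"
  interpret F: linear_embedding K A T F \<J> using ff_functors_embedding[OF F] .
  interpret F': linear_embedding K A T F' \<J> using ff_functors_embedding[OF F'] .
  obtain b \<beta> where b: "b \<in> \<Gamma>" "\<beta> \<in> b"
    and v: "image_subcat T T \<beta> ` image_subcat A T F' ` ?V = image_subcat A T F ` ?V"
    using r unfolding subgraph_rel_iff F.verts_Im_star F'.verts_Im_star
    by - (elim conjE bexE, rule that)
  interpret \<beta>: linear_embedding K T T \<beta> \<J> using \<Gamma>_embedding[OF b] .
  define G where "G = comp_gfunct T \<beta> F'"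
  have Ge: "exact_between K A T G"
    using exact_between_comp[OF F'.exact_between_axioms \<beta>.exact_between_axioms] by (simp add: G_def)
  have "fully_faithful A T G"
    using fully_faithful_comp[OF F'.ff_functor_axioms \<beta>.ff_functor_axioms]
    by (simp add: G_def fully_faithful_def comp_funct_def comp_gfunct_def)
  then interpret G: ff_exact K A T G
    using ff_exactI[OF A.linear_triangulated_category_axioms T.linear_triangulated_category_axioms]
      exact_between.exact[OF Ge] by blast
  have v': "image_subcat A T G ` ?V = image_subcat A T F ` ?V"
    using v image_subcat_comp_vertices[OF F'.exact_between_axioms \<beta>.exact_between_axioms subset_refl]
    by (simp add: G_def)
  have sub: "image_subcat A T H B \<subseteq> image_subcat A T H' (Obj A)"
    if eq: "image_subcat A T H ` ?V = image_subcat A T H' ` ?V" and B: "B \<in> ?V"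
    for H H' :: "('o, 'm, 'p, 'n) gfunct" and B
  proof -
    have "image_subcat A T H B \<in> image_subcat A T H' ` ?V" using eq B by blast
    then obtain B' where "B' \<in> ?V" "image_subcat A T H B = image_subcat A T H' B'" by blast
    moreover from this have "B' \<subseteq> Obj A" using G_vertices_Obj by blast
    ultimately show ?thesis using image_subcat_mono by metis
  qed
  have GF: "\<exists>Y \<in> Obj A. isomorphic T (FO F Y) (FO G X)" if "X \<in> Obj A" for X
    using generated_essential_image[OF F.ff_exact_axioms G.exact_triangulated_axioms sub[OF v'] that] .
  have FG: "\<exists>Y \<in> Obj A. isomorphic T (FO G Y) (FO F X)" if "X \<in> Obj A" for X
    using generated_essential_image[OF G.ff_exact_axioms F.exact_triangulated_axioms sub[OF v'[symmetric]] that] .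
  obtain \<alpha> where \<alpha>: "exact_between K A A \<alpha>" and g: "graded_iso A T (comp_gfunct T F \<alpha>) G"
    using F.lift_exact[OF Ge GF] by blast
  interpret \<alpha>: exact_between K A A \<alpha> by fact
  obtain \<theta> where n: "nat_iso A T (comp_gfunct T F \<alpha>) G \<theta>" using graded_iso_nat_iso[OF g] by blast
  have "fully_faithful A A \<alpha>"
    using F.lift_fully_faithful[OF \<alpha>.functor_between_axioms n G.ff_functor_axioms] .
  moreover have "ess_surj A A \<alpha>" unfolding ess_surj_def
  proof
    fix Y assume Y: "Y \<in> Obj A"
    obtain X where X: "X \<in> Obj A" "isomorphic T (FO G X) (FO F Y)" using FG[OF Y] by blast
    have "isomorphic T (FO F (FO \<alpha> X)) (FO F Y)"
      using T.isomorphic_trans[OF _ X(2)] nat_iso_isomorphic[OF n X(1)] by simp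
    then have "isomorphic A (FO \<alpha> X) Y" using F.reflect_isomorphic \<alpha>.Obj[OF X(1)] Y by blast
    then show "\<exists>X \<in> Obj A. isomorphic A (FO \<alpha> X) Y" using X(1) by blast
  qed
  ultimately have aut: "\<alpha> \<in> autoequivalences A" using A.autoequivalenceI[OF \<alpha>] by blast
  then have "A.autoeq_class \<alpha> \<in> carrier (Aut A)" by (simp add: Aut_def quotientI)
  then show ?thesis
    using F F' b g A.autoeq_class_self[OF aut] unfolding C_rel_def G_def by blast
qed

lemma C_rel_iff:
  "(F, F') \<in> C_rel K A T \<Gamma> \<longleftrightarrow> F \<in> ff_functors K A T \<and> F' \<in> ff_functors K A T \<and>
     (Im_star K \<J> A T F, Im_star K \<J> A T F') \<in> subgraph_rel K \<J> A T \<Gamma>"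
proof -
  have "sym (subgraph_rel K \<J> A T \<Gamma>)" using equiv_subgraph_rel by (simp add: equiv_def)
  then have s: "(Im_star K \<J> A T F, Im_star K \<J> A T F') \<in> subgraph_rel K \<J> A T \<Gamma> \<longleftrightarrow>
      (Im_star K \<J> A T F', Im_star K \<J> A T F) \<in> subgraph_rel K \<J> A T \<Gamma>"
    by (auto dest: symD)
  have "(F, F') \<in> C_rel K A T \<Gamma> \<Longrightarrow> F \<in> ff_functors K A T \<and> F' \<in> ff_functors K A T"
    by (auto simp: C_rel_def)
  then show ?thesis
    unfolding s using C_rel_imp_subgraph_rel[of F F'] subgraph_rel_imp_C_rel[of F F'] by blast
qed

lemma equiv_C_rel: "equiv (ff_functors K A T) (C_rel K A T \<Gamma>)"
proof (rule equivI)
  note e = equiv_subgraph_rel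
  have Im: "Im_star K \<J> A T F \<in> subgraphs_iso_to K \<J> A T" if "F \<in> ff_functors K A T" for F
    using linear_embedding.Im_star_in_subgraphs[OF ff_functors_embedding[OF that]] .
  show "C_rel K A T \<Gamma> \<subseteq> ff_functors K A T \<times> ff_functors K A T" by (auto simp: C_rel_def)
  show "refl_on (ff_functors K A T) (C_rel K A T \<Gamma>)"
    using Im e unfolding refl_on_def C_rel_iff equiv_def by blast
  show "sym (C_rel K A T \<Gamma>)"
    using e unfolding sym_def C_rel_iff equiv_def by blast
  show "trans (C_rel K A T \<Gamma>)"
    using e unfolding trans_def C_rel_iff equiv_def by blast
qed

lemma image_map_injective:
  "\<exists>\<Phi> \<in> C_set K A T \<Gamma> \<rightarrow> subgraphs_iso_to K \<J> A T // subgraph_rel K \<J> A T \<Gamma>.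
     inj_on \<Phi> (C_set K A T \<Gamma>) \<and>
     (\<forall>F \<in> ff_functors K A T.
        \<Phi> (C_rel K A T \<Gamma> `` {F}) = subgraph_rel K \<J> A T \<Gamma> `` {Im_star K \<J> A T F})"
proof -
  let ?r = "subgraph_rel K \<J> A T \<Gamma>"
  define \<Phi> where "\<Phi> c = (\<Union>F \<in> c. ?r `` {Im_star K \<J> A T F})" for c
  have Im: "Im_star K \<J> A T F \<in> subgraphs_iso_to K \<J> A T" if "F \<in> ff_functors K A T" for F
    using linear_embedding.Im_star_in_subgraphs[OF ff_functors_embedding[OF that]] .
  have "(\<lambda>F. ?r `` {Im_star K \<J> A T F}) respects C_rel K A T \<Gamma>"
    by (rule congruentI) (use equiv_class_eq[OF equiv_subgraph_rel] C_rel_iff in blast)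
  then have \<Phi>: "\<Phi> (C_rel K A T \<Gamma> `` {F}) = ?r `` {Im_star K \<J> A T F}" if "F \<in> ff_functors K A T" for F
    unfolding \<Phi>_def using UN_equiv_class[OF equiv_C_rel _ that] by blast
  have "\<Phi> \<in> C_set K A T \<Gamma> \<rightarrow> subgraphs_iso_to K \<J> A T // ?r"
    using \<Phi> Im by (auto simp: C_set_def quotient_def)
  moreover have "inj_on \<Phi> (C_set K A T \<Gamma>)"
  proof (rule inj_onI)
    fix c c' assume "c \<in> C_set K A T \<Gamma>" "c' \<in> C_set K A T \<Gamma>" and eq: "\<Phi> c = \<Phi> c'"
    then obtain F F' where F: "F \<in> ff_functors K A T" "c = C_rel K A T \<Gamma> `` {F}"
      and F': "F' \<in> ff_functors K A T" "c' = C_rel K A T \<Gamma> `` {F'}"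
      by (auto simp: C_set_def elim!: quotientE)
    have "(Im_star K \<J> A T F, Im_star K \<J> A T F') \<in> ?r"
      using eq \<Phi> F F' eq_equiv_class[OF _ equiv_subgraph_rel Im[OF F'(1)]] by metis
    then show "c = c'" using F F' equiv_class_eq[OF equiv_C_rel] C_rel_iff by metis
  qed
  ultimately show ?thesis using \<Phi> by blast
qed

end

theorem proposition7p5:
  fixes K :: "'k ring"
    and A :: "('o, 'm, 'k) tricat"
    and T :: "('p, 'n, 'k) tricat"
    and \<J> :: "('q, 'l, 'k) tricat set"
    and \<Gamma> :: "('p, 'n, 'p, 'n) gfunct set set"
  assumes "field K"
    and "linear_triangulated_category K A"
    and "linear_triangulated_category K T"
    and "\<And>J. J \<in> \<J> \<Longrightarrow> linear_triangulated_category K J"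
    and "pairwise (\<lambda>J J'. \<not> linearly_exactly_equivalent K J J') \<J>"
    and "subgroup \<Gamma> (AutK K T)"
    and "generated_subcat A (\<Union>(verts (G_digraph K \<J> A))) = Obj A"
  shows "\<exists>\<Phi> \<in> C_set K A T \<Gamma> \<rightarrow> subgraphs_iso_to K \<J> A T // subgraph_rel K \<J> A T \<Gamma>.
           inj_on \<Phi> (C_set K A T \<Gamma>) \<and>
           (\<forall>F \<in> ff_functors K A T.
              \<Phi> (C_rel K A T \<Gamma> `` {F}) = subgraph_rel K \<J> A T \<Gamma> `` {Im_star K \<J> A T F})"
proof -
  have "subcategory_graphs K A T \<J> \<Gamma>"
    using assms by (simp add: subcategory_graphs_def subcategory_graphs_axioms_def)
  then show ?thesis by (rule subcategory_graphs.image_map_injective)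
qed

end
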